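(* Let $P\in\mathbb{K}[x]$ be a polynomial of uniqueness for ${\cal M}(\mathbb{K})$ such that $$P'(x)=b(x-a_1)^n\prod_{i=2}^l(x-a_i),$$ where $b\in\mathbb{K}^*$, $l\geq 3$, $a_1,\dots,a_l\in\mathbb{K}$ are pairwise distinct and $n$ is a positive integer, satisfying $n\geq l+10$, and, if $l=3$, $n\neq 2l-1$. Let $f,g\in{\cal M}(\mathbb{K})$ be transcendental and let $\alpha\in{\cal M}(\mathbb{K})$ be non-identically zero and small with respect to both $f$ and $g$. If $f'P'(f)$ and $g'P'(g)$ share $\alpha$ C.M., then $f=g$.
   Context: $\mathbb{K}$ is an algebraically closed field of characteristic zero, complete with respect to an ultrametric absolute value $|\cdot|$. ${\cal M}(\mathbb{K})$ is the field of meromorphic functions on $\mathbb{K}$, i.e. the field of fractions of the ring of entire functions (power series converging on all of $\mathbb{K}$). A function in ${\cal M}(\mathbb{K})$ is transcendental if it is not a rational function. For $h\in{\cal M}(\mathbb{K})$ and $\gamma\in\mathbb{K}$, $\omega_\gamma(h)$ is $m$ if $h$ has a zero of order $m$ at $\gamma$, $-m$ if a pole of order $m$, $0$ otherwise. For $h$ with no zero or pole at $0$ and $r>0$: $Z(r,h)=\sum_{\omega_\gamma(h)>0,\ |\gamma|\leq r}\omega_\gamma(h)(\log r-\log|\gamma|)$, $N(r,h)=Z(r,1/h)$, $T(r,h)=\max\{Z(r,h)+\log|h(0)|,N(r,h)\}$. $\alpha\in{\cal M}(\mathbb{K})$ is small with respect to $f$ if $\lim_{r\to+\infty}T(r,\alpha)/T(r,f)=0$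 (if $0$ is a zero or pole of $f$ or $\alpha$, one first translates the variable; the condition does not depend on this). Two meromorphic functions $F,G$ share $\alpha$ C.M. if $F-\alpha$ and $G-\alpha$ have the same zeroes with the same multiplicities. A polynomial $P$ is a polynomial of uniqueness for a class ${\cal F}$ if for all $f,g\in{\cal F}$, $P(f)=P(g)$ implies $f=g$. *)

theory Defs
  imports
    "HOL-Analysis.Abstract_Metric_Spaces"
    "HOL-Computational_Algebra.Computational_Algebra"
    "HOL-Library.Extended_Nat"
begin

locale ultrametric_absolute_value =
  fixes v :: "'a::field \<Rightarrow> real"
  assumes nonneg: "0 \<le> v x"
    and eq_0_iff: "v x = 0 \<longleftrightarrow> x = 0"
    and mult: "v (x * y) = v x * v y"
    and ultrametric: "v (x + y) \<le> max (v x) (v y)"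
begin

lemma v_one: "v 1 = 1"
  using mult[of 1 1] eq_0_iff[of 1] by simp

lemma v_minus: "v (- x) = v x"
proof -
  have "v (- 1) * v (- 1) = 1"
    using mult[of "- 1" "- 1"] v_one by simp
  then have "v (- 1) = 1"
    using nonneg[of "- 1"] by (metis abs_of_nonneg abs_mult_self_eq real_sqrt_abs2 real_sqrt_one)
  then show ?thesis
    using mult[of "- 1" x] by simp
qed

lemma v_triangle: "v (x + y) \<le> v x + v y"
  using ultrametric[of x y] nonneg[of x] nonneg[of y] by simp

sublocale Metric_space UNIV "\<lambda>x y. v (x - y)"
proof
  show "v (x - y) = v (y - x)" for x y
    using v_minus[of "x - y"] by simp
  show "v (x - z) \<le> v (x - y) + v (y - z)" for x y z
    using v_triangle[of "x - y" "y - z"] by simp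
qed (auto simp: nonneg eq_0_iff)

end

locale complete_ultrametric_absolute_value = ultrametric_absolute_value +
  assumes complete: mcomplete

definition v_sums :: "('a::field \<Rightarrow> real) \<Rightarrow> (nat \<Rightarrow> 'a) \<Rightarrow> 'a \<Rightarrow> bool"
  where "v_sums v u s \<longleftrightarrow> (\<lambda>n. v ((\<Sum>k<n. u k) - s)) \<longlonglongrightarrow> 0"

definition entire :: "('a::field \<Rightarrow> real) \<Rightarrow> 'a fps \<Rightarrow> bool"
  where "entire v F \<longleftrightarrow> (\<forall>x. \<exists>s. v_sums v (\<lambda>n. fps_nth F n * x ^ n) s)"

definition entire_eval :: "('a::field \<Rightarrow> real) \<Rightarrow> 'a fps \<Rightarrow> 'a \<Rightarrow> 'a"
  where "entire_eval v F x = (THE s. v_sums v (\<lambda>n. fps_nth F n * x ^ n) s)"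

text \<open>
  The field of fractions of the ring of entire functions is realised inside the field
  of formal Laurent series: a meromorphic function is identified with its Laurent expansion at 0.
  In particular the derivative of a meromorphic function is \<^const>\<open>fls_deriv\<close>.
\<close>

definition meromorphic :: "('a::field \<Rightarrow> real) \<Rightarrow> 'a fls set"
  where "meromorphic v =
    {fps_to_fls F / fps_to_fls G | F G. entire v F \<and> entire v G \<and> G \<noteq> 0}"

definition rational_function :: "'a::field fls \<Rightarrow> bool"
  where "rational_function h \<longleftrightarrow>
    (\<exists>p q. q \<noteq> 0 \<and> h = fps_to_fls (fps_of_poly p) / fps_to_fls (fps_of_poly q))"

definition transcendental :: "'a::field fls \<Rightarrow> bool"
  where "transcendental h \<longleftrightarrow> \<not> rational_function h"

text \<open>
  The Taylor series of an entire function at a point; in characteristic 0 its coefficients are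
  the derivatives divided by factorials.
\<close>

definition taylor_at :: "('a::field_char_0 \<Rightarrow> real) \<Rightarrow> 'a \<Rightarrow> 'a fps \<Rightarrow> 'a fps"
  where "taylor_at v c F = Abs_fps (\<lambda>n. entire_eval v (fps_nth_deriv n F) c / fact n)"

text \<open>
  The translate \<open>x \<mapsto> h (c + x)\<close> of a meromorphic function \<open>h\<close>, that is, its Laurent expansion
  at \<open>c\<close>. It does not depend on the representation of \<open>h\<close> as a quotient, since taking the
  Taylor series at \<open>c\<close> is an injective ring homomorphism on entire functions.
\<close>

definition translate :: "('a::field_char_0 \<Rightarrow> real) \<Rightarrow> 'a \<Rightarrow> 'a fls \<Rightarrow> 'a fls"
  where "translate v c h = (THE k. \<exists>F G. entire v F \<and> entire v G \<and> G \<noteq> 0 \<and>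
    h = fps_to_fls F / fps_to_fls G \<and>
    k = fps_to_fls (taylor_at v c F) / fps_to_fls (taylor_at v c G))"

text \<open>
  Positive at a zero, negative at a pole, 0 otherwise. Note that \<^const>\<open>fls_subdegree\<close> of
  the zero series is 0.
\<close>

definition ord_at :: "('a::field_char_0 \<Rightarrow> real) \<Rightarrow> 'a \<Rightarrow> 'a fls \<Rightarrow> int"
  where "ord_at v c h = fls_subdegree (translate v c h)"

definition zero_multiplicity :: "('a::field_char_0 \<Rightarrow> real) \<Rightarrow> 'a \<Rightarrow> 'a fls \<Rightarrow> enat"
  where "zero_multiplicity v c h = (if h = 0 then \<infinity> else enat (nat (ord_at v c h)))"

definition share_CM :: "('a::field_char_0 \<Rightarrow> real) \<Rightarrow> 'a fls \<Rightarrow> 'a fls \<Rightarrow> 'a fls \<Rightarrow> bool"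
  where "share_CM v \<alpha> F G \<longleftrightarrow>
    (\<forall>c. zero_multiplicity v c (F - \<alpha>) = zero_multiplicity v c (G - \<alpha>))"

text \<open>
  The counting functions and the characteristic function below are meant for nonzero meromorphic
  functions having neither a zero nor a pole at 0; the zeros in a disk are then finite
  in number, and \<open>fls_nth h 0\<close> is the value of \<open>h\<close> at 0.
\<close>

definition count_Z :: "('a::field_char_0 \<Rightarrow> real) \<Rightarrow> real \<Rightarrow> 'a fls \<Rightarrow> real"
  where "count_Z v r h =
    (\<Sum>c | ord_at v c h > 0 \<and> v c \<le> r. of_int (ord_at v c h) * (ln r - ln (v c)))"

definition count_N :: "('a::field_char_0 \<Rightarrow> real) \<Rightarrow> real \<Rightarrow> 'a fls \<Rightarrow> real"
  where "count_N v r h = count_Z v r (1 / h)"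

definition char_T :: "('a::field_char_0 \<Rightarrow> real) \<Rightarrow> real \<Rightarrow> 'a fls \<Rightarrow> real"
  where "char_T v r h = max (count_Z v r h + ln (v (fls_nth h 0))) (count_N v r h)"

text \<open>
  The centre \<open>c\<close> may be 0 when neither function has a zero or a pole at 0; the limit condition
  does not depend on the choice of an admissible \<open>c\<close>.
\<close>

definition small_wrt :: "('a::field_char_0 \<Rightarrow> real) \<Rightarrow> 'a fls \<Rightarrow> 'a fls \<Rightarrow> bool"
  where "small_wrt v \<alpha> f \<longleftrightarrow> (\<exists>c. ord_at v c f = 0 \<and> ord_at v c \<alpha> = 0 \<and>
    ((\<lambda>r. char_T v r (translate v c \<alpha>) / char_T v r (translate v c f)) \<longlongrightarrow> 0) at_top)"

definition poly_of_fun :: "'a::field poly \<Rightarrow> 'a fls \<Rightarrow> 'a fls"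
  where "poly_of_fun P f = poly (map_poly fls_const P) f"

definition polynomial_of_uniqueness :: "'a::field poly \<Rightarrow> 'a fls set \<Rightarrow> bool"
  where "polynomial_of_uniqueness P \<F> \<longleftrightarrow>
    (\<forall>f\<in>\<F>. \<forall>g\<in>\<F>. poly_of_fun P f = poly_of_fun P g \<longrightarrow> f = g)"

text \<open>
  Uniqueness for meromorphic functions has to be understood for nonconstant functions:
  a polynomial of degree at least 2 over an algebraically closed field of characteristic 0
  takes some value at two distinct constants, so it is never a polynomial of uniqueness
  for a class containing all constants.
\<close>

definition nonconstant_meromorphic :: "('a::field \<Rightarrow> real) \<Rightarrow> 'a fls set"
  where "nonconstant_meromorphic v = meromorphic v - range fls_const"

end

theory Submission
  imports Defs
begin

text \<open>
  The argument is Nevanlinna theory over \<open>v\<close>. An entire function whose last dominant monomial on a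
  circle is not constant has a zero in the disc (a limit of zeros of its truncations), and this
  gives Jensen's formula: the logarithm of the Gauss norm of a meromorphic function on the circle of
  radius \<open>r\<close> is, up to a constant, the weighted number of its zeros minus that of its poles. Since
  derivation does not increase Gauss norms, Wronskians yield Cartan's truncated second main theorem
  without any error term.

  With \<open>F = f' P'(f)\<close>, \<open>G = g' P'(g)\<close>, \<open>x = F / \<alpha>\<close>, \<open>y = G / \<alpha>\<close> and \<open>h = (F - \<alpha>) / (G - \<alpha>)\<close>, the zeros
  and poles of \<open>h\<close> come only from poles of \<open>f\<close> and \<open>g\<close> (and from \<open>\<alpha>\<close>). Cartan's theorem for
  \<open>x + h - 1 = h y\<close> contradicts \<open>n \<ge> l + 10\<close> unless \<open>x\<close>, \<open>h\<close>, \<open>1\<close> are linearly dependent, that is,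
  unless \<open>x\<close> is a Moebius transform of \<open>y\<close>. The truncated second main theorem for \<open>y\<close> with a third
  value that corresponds to \<open>x = 0\<close> or \<open>x = \<infinity>\<close> leaves only \<open>x y = 1\<close> and \<open>x = y\<close>. In the first case the zeros of
  the \<open>f - a\<^sub>i\<close> are poles of \<open>g\<close> and have too high multiplicities; in the second
  \<open>P(f) - P(g)\<close> is constant, and it vanishes by the second main theorem for \<open>P(f) - P(a\<^sub>1)\<close>.
\<close>

text \<open>The bound on \<open>n\<close> comes from the Cartan step. Let \<open>T\<close> be the
  sum of the heights of \<open>f\<close> and \<open>g\<close>, and \<open>Z\<close> the counting
  function of the zeros of \<open>f'\<close> and \<open>g'\<close> together. Up to terms in \<alpha>
  and constants, the heights of \<open>x\<close> and \<open>y\<close> add up to at least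
  \<open>(n + l - 1) T + Z\<close>, while each is at most Cartan's characteristic, hence at most
  \<open>(l + 3) T + Z\<close>: truncation at 2 charges poles twice, the root \<open>a 1\<close>
  twice and every other root once. One \<open>Z\<close> cancels and the other is at most
  \<open>2 T\<close>; this gives \<open>n + l - 1 <= 2 l + 8\<close>, which
  \<open>n >= l + 10\<close> just excludes. So the zeros of the derivatives have to be kept in the
  lower estimates. Two features shape the preparations. The residue characteristic may be positive,
  so nonzero integers can be small, and norm estimates must avoid division by factorials. Moreover,
  the height of a nonconstant function is unbounded, so estimates up to additive constants suffice;
  radii are compared with 1 and nothing is normalised at the origin.\<close>

locale padic_field = complete_ultrametric_absolute_value v
  for v :: "'a::{alg_closed_field,field_char_0} \<Rightarrow> real"
begin

subsection \<open>Ultrametric series\<close>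

abbreviation mero_fun ("\<M>") where "\<M> \<equiv> meromorphic v"

lemma v_0 [simp]: "v 0 = 0"
  by (simp add: eq_0_iff)

lemma v_1 [simp]: "v 1 = 1"
  by (rule v_one)

lemma v_pos_iff [simp]: "0 < v x \<longleftrightarrow> x \<noteq> 0"
  using nonneg[of x] eq_0_iff[of x] by linarith

lemma v_diff_commute: "v (x - y) = v (y - x)"
  using v_minus[of "x - y"] by simp

lemma v_diff: "v (x - y) \<le> max (v x) (v y)"
  using ultrametric[of x "- y"] by (simp add: v_minus)

lemma v_power: "v (x ^ n) = v x ^ n"
  by (induction n) (auto simp: mult)

lemma v_inverse: "v (inverse x) = inverse (v x)"
proof (cases "x = 0")
  case False
  then have "v x * v (inverse x) = 1" using mult[of x "inverse x"] by simp
  then show ?thesis by (metis inverse_unique)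
qed simp

lemma v_of_nat: "v (of_nat n) \<le> 1"
proof (induction n)
  case (Suc n)
  then show ?case using ultrametric[of 1 "of_nat n"] by simp
qed simp

text \<open>Otherwise \<open>x = (x + y) - y\<close> would be a difference of two elements smaller
  than \<open>x\<close>.\<close>

lemma v_add_eq_left: "v y < v x \<Longrightarrow> v (x + y) = v x"
  using ultrametric[of x y] v_diff[of "x + y" y] by (auto simp: max_def split: if_splits)

lemma v_add_eq_right: "v x < v y \<Longrightarrow> v (x + y) = v y"
  using v_add_eq_left[of x y] by (simp add: add.commute)

lemma v_sum_le:
  assumes "0 \<le> C" "\<And>i. i \<in> S \<Longrightarrow> v (u i) \<le> C"
  shows "v (\<Sum>i\<in>S. u i) \<le> C"
  using assms
proof (induction S rule: infinite_finite_induct)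
  case (insert x S)
  have "v (u x + (\<Sum>i\<in>S. u i)) \<le> max (v (u x)) (v (\<Sum>i\<in>S. u i))" by (rule ultrametric)
  also have "\<dots> \<le> C" using insert by auto
  finally show ?case using insert by simp
qed (auto simp: eq_0_iff)

lemma v_sum_less:
  assumes "0 < C" "\<And>i. i \<in> S \<Longrightarrow> v (u i) < C"
  shows "v (\<Sum>i\<in>S. u i) < C"
  using assms
proof (induction S rule: infinite_finite_induct)
  case (insert x S)
  have "v (u x + (\<Sum>i\<in>S. u i)) \<le> max (v (u x)) (v (\<Sum>i\<in>S. u i))" by (rule ultrametric)
  also have "\<dots> < C" using insert by auto
  finally show ?case using insert by simp
qed auto

lemma v_sums_unique:
  assumes "v_sums v u s" "v_sums v u t"
  shows "s = t"
proof -
  have "(\<lambda>n. v ((\<Sum>k<n. u k) - s) + v ((\<Sum>k<n. u k) - t)) \<longlonglongrightarrow> 0 + 0"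
    using assms unfolding v_sums_def by (intro tendsto_add)
  moreover have "v (s - t) \<le> v ((\<Sum>k<n. u k) - s) + v ((\<Sum>k<n. u k) - t)" for n
    using v_triangle[of "s - (\<Sum>k<n. u k)" "(\<Sum>k<n. u k) - t"]
    by (simp add: v_diff_commute)
  ultimately have "v (s - t) \<le> 0"
    by (intro LIMSEQ_le_const[where X = "\<lambda>n. v ((\<Sum>k<n. u k) - s) + v ((\<Sum>k<n. u k) - t)"]) auto
  then show ?thesis using nonneg[of "s - t"] eq_0_iff[of "s - t"] by simp
qed

lemma v_sums_terms_to_0:
  assumes "v_sums v u s"
  shows "(\<lambda>n. v (u n)) \<longlonglongrightarrow> 0"
proof -
  have 1: "(\<lambda>n. v ((\<Sum>k<n. u k) - s)) \<longlonglongrightarrow> 0" using assms by (simp add: v_sums_def)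
  have "(\<lambda>n. v ((\<Sum>k<Suc n. u k) - s) + v ((\<Sum>k<n. u k) - s)) \<longlonglongrightarrow> 0 + 0"
    by (intro tendsto_add LIMSEQ_Suc 1)
  then have 2: "(\<lambda>n. v ((\<Sum>k<Suc n. u k) - s) + v ((\<Sum>k<n. u k) - s)) \<longlonglongrightarrow> 0" by simp
  have "v (u n) \<le> v ((\<Sum>k<Suc n. u k) - s) + v ((\<Sum>k<n. u k) - s)" for n
    using v_triangle[of "(\<Sum>k<n. u k) + u n - s" "- ((\<Sum>k<n. u k) - s)"]
    unfolding v_minus by simp
  then show ?thesis
    by (intro tendsto_sandwich[OF _ _ tendsto_const 2] always_eventually allI) (auto simp: nonneg)
qed

text \<open>A block of consecutive terms is never larger than its largest term, so terms tending to
  0 already make the partial sums Cauchy. This is where completeness enters.\<close>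

lemma v_sums_exists:
  assumes "(\<lambda>n. v (u n)) \<longlonglongrightarrow> 0"
  shows "\<exists>s. v_sums v u s"
proof -
  define \<sigma> where "\<sigma> = (\<lambda>n. \<Sum>k<n. u k)"
  have "MCauchy \<sigma>"
    unfolding MCauchy_def
  proof (intro conjI allI impI)
    fix e :: real assume e: "e > 0"
    from assms e obtain N where N: "\<And>n. n \<ge> N \<Longrightarrow> v (u n) < e"
      by (metis LIMSEQ_D abs_of_nonneg diff_zero nonneg real_norm_def)
    have *: "v (\<sigma> m - \<sigma> n) < e" if "N \<le> n" "n \<le> m" for m n
    proof -
      have "\<sigma> m - \<sigma> n = sum u {n..<m}"
        using that by (simp add: \<sigma>_def lessThan_atLeast0 sum_diff_nat_ivl)
      then show ?thesis using v_sum_less[of e "{n..<m}" u] e N that by auto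
    qed
    show "\<exists>N. \<forall>n n'. N \<le> n \<longrightarrow> N \<le> n' \<longrightarrow> v (\<sigma> n - \<sigma> n') < e"
    proof (intro exI allI impI)
      fix n n' assume "N \<le> n" "N \<le> n'"
      then show "v (\<sigma> n - \<sigma> n') < e"
        using *[of n n'] *[of n' n] v_diff_commute[of "\<sigma> n" "\<sigma> n'"]
        by (cases "n \<le> n'") auto
    qed
  qed auto
  then obtain s where "limitin mtopology \<sigma> s sequentially"
    using complete by (auto simp: mcomplete_def)
  then show ?thesis
    by (auto simp: limitin_metric_dist_null v_sums_def \<sigma>_def)
qed

lemma v_sums_le:
  assumes "v_sums v u s" "\<And>n. v (u n) \<le> C"
  shows "v s \<le> C"
proof -
  have C: "0 \<le> C" using assms(2)[of 0] nonneg[of "u 0"] by linarith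
  have "v s \<le> C + v ((\<Sum>k<n. u k) - s)" for n
  proof -
    have "v s \<le> v (\<Sum>k<n. u k) + v ((\<Sum>k<n. u k) - s)"
      using v_triangle[of "\<Sum>k<n. u k" "- ((\<Sum>k<n. u k) - s)"] unfolding v_minus by simp
    moreover have "v (\<Sum>k<n. u k) \<le> C" using C assms(2) by (intro v_sum_le) auto
    ultimately show ?thesis by simp
  qed
  moreover have "(\<lambda>n. C + v ((\<Sum>k<n. u k) - s)) \<longlonglongrightarrow> C + 0"
    using assms(1) unfolding v_sums_def by (intro tendsto_add tendsto_const)
  ultimately show ?thesis by (intro LIMSEQ_le_const) auto
qed

lemma v_sums_add:
  assumes "v_sums v u s" "v_sums v w t"
  shows "v_sums v (\<lambda>n. u n + w n) (s + t)"
  unfolding v_sums_def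
proof (rule tendsto_sandwich[where f = "\<lambda>_. 0"])
  show "(\<lambda>n. v ((\<Sum>k<n. u k) - s) + v ((\<Sum>k<n. w k) - t)) \<longlonglongrightarrow> 0"
    using tendsto_add[of "\<lambda>n. v ((\<Sum>k<n. u k) - s)" 0 sequentially] assms
    by (fastforce simp: v_sums_def)
  show "\<forall>\<^sub>F n in sequentially. v ((\<Sum>k<n. u k + w k) - (s + t))
      \<le> v ((\<Sum>k<n. u k) - s) + v ((\<Sum>k<n. w k) - t)"
  proof (rule always_eventually, rule allI)
    fix n
    have "(\<Sum>k<n. u k + w k) - (s + t) = ((\<Sum>k<n. u k) - s) + ((\<Sum>k<n. w k) - t)"
      by (simp add: sum.distrib)
    then show "v ((\<Sum>k<n. u k + w k) - (s + t))
      \<le> v ((\<Sum>k<n. u k) - s) + v ((\<Sum>k<n. w k) - t)" by (metis v_triangle)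
  qed
qed (auto simp: nonneg)

lemma v_sums_mult:
  assumes "v_sums v u s"
  shows "v_sums v (\<lambda>n. c * u n) (c * s)"
proof -
  have "(\<lambda>n. v c * v ((\<Sum>k<n. u k) - s)) \<longlonglongrightarrow> v c * 0"
    using assms unfolding v_sums_def by (intro tendsto_mult tendsto_const)
  then show ?thesis
    unfolding v_sums_def
    by (simp add: mult[symmetric] right_diff_distrib sum_distrib_left)
qed

lemma v_sums_shift:
  assumes "v_sums v (\<lambda>n. u (Suc n)) s" "u 0 = 0"
  shows "v_sums v u s"
proof -
  have "(\<Sum>k<Suc n. u k) = (\<Sum>k<n. u (Suc k))" for n
    using assms(2) by (simp add: sum.lessThan_Suc_shift del: sum.lessThan_Suc)
  then show ?thesis
    using assms(1) unfolding v_sums_def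
    by (intro LIMSEQ_offset[of "\<lambda>n. v ((\<Sum>k<n. u k) - s)" 1]) (simp del: sum.lessThan_Suc)
qed

lemma v_sums_single: "v_sums v (\<lambda>n. if n = 0 then c else 0) c"
proof -
  have "v ((\<Sum>k<n. if k = 0 then c else 0) - c) = 0" if "n \<ge> 1" for n :: nat
  proof -
    have "(\<Sum>k<n. if k = 0 then c else 0) = c"
      using that by (subst sum.delta) auto
    then show ?thesis by simp
  qed
  then show ?thesis unfolding v_sums_def
    by (intro tendsto_eventually) (auto simp: eventually_sequentially)
qed

subsection \<open>Gauss norms of entire functions\<close>

text \<open>If the valuation is trivial, then the entire functions are the polynomials.\<close>

lemma entire_iff: "entire v A \<longleftrightarrow> (\<forall>r\<ge>0. (\<lambda>n. v (fps_nth A n) * r ^ n) \<longlonglongrightarrow> 0)"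
proof
  assume A: "\<forall>r\<ge>0. (\<lambda>n. v (fps_nth A n) * r ^ n) \<longlonglongrightarrow> 0"
  show "entire v A" unfolding entire_def
  proof
    fix x
    have "(\<lambda>n. v (fps_nth A n * x ^ n)) \<longlonglongrightarrow> 0"
      using A nonneg[of x] by (simp add: mult v_power)
    then show "\<exists>s. v_sums v (\<lambda>n. fps_nth A n * x ^ n) s" by (rule v_sums_exists)
  qed
next
  assume "entire v A"
  then have A: "(\<lambda>n. v (fps_nth A n) * v x ^ n) \<longlonglongrightarrow> 0" for x
    using v_sums_terms_to_0 unfolding entire_def by (fastforce simp: mult v_power)
  have "(\<lambda>n. v (fps_nth A n) * r ^ n) \<longlonglongrightarrow> 0" if r: "r \<ge> 0" for r
  proof (cases "\<exists>x. v x \<ge> r")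
    case True
    then obtain x where x: "v x \<ge> r" by blast
    show ?thesis
    proof (rule tendsto_sandwich[OF _ _ _ A[of x], where f = "\<lambda>_. 0"])
      show "\<forall>\<^sub>F n in sequentially. v (fps_nth A n) * r ^ n \<le> v (fps_nth A n) * v x ^ n"
        using x r nonneg by (intro always_eventually allI mult_left_mono power_mono) auto
    qed (use r in \<open>auto simp: nonneg\<close>)
  next
    case False
    \<comment> \<open>If no element reaches the size \<open>r\<close>, no element can exceed 1,
      since its powers would pass \<open>r\<close>. Applied to inverses as well, this makes
      \<open>v\<close> trivial, and coefficients tending to 0 eventually vanish.\<close>
    have v1: "v x \<le> 1" for x
    proof (rule ccontr)
      assume "\<not> v x \<le> 1"
      then obtain n where "r < v x ^ n" using real_arch_pow[of "v x" r] by auto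
      then show False using False v_power[of x n] by (metis less_imp_le)
    qed
    have triv: "v x = 1" if "x \<noteq> 0" for x
    proof -
      have "inverse (v x) \<le> 1" using v1[of "inverse x"] by (simp add: v_inverse)
      moreover have "v x > 0" using that by simp
      ultimately show ?thesis using v1[of x] by (simp add: field_simps)
    qed
    have "(\<lambda>n. v (fps_nth A n)) \<longlonglongrightarrow> 0" using A[of 1] by simp
    then have "\<forall>\<^sub>F n in sequentially. v (fps_nth A n) < 1" by (rule order_tendstoD) simp
    then have "\<forall>\<^sub>F n in sequentially. v (fps_nth A n) * r ^ n = 0"
      by eventually_elim (metis triv less_irrefl mult_zero_left v_0)
    then show ?thesis by (rule tendsto_eventually)
  qed
  then show "\<forall>r\<ge>0. (\<lambda>n. v (fps_nth A n) * r ^ n) \<longlonglongrightarrow> 0" by blast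
qed

text \<open>The last index at which the maximal term is attained. Ties go to the largest index, so
  that this index counts the zeros in the closed disc, those on the boundary circle
  included.\<close>

definition dominant :: "real \<Rightarrow> 'a fps \<Rightarrow> nat \<Rightarrow> bool" where
  "dominant r A n \<longleftrightarrow> (\<forall>m. v (fps_nth A m) * r ^ m \<le> v (fps_nth A n) * r ^ n) \<and>
     (\<forall>m>n. v (fps_nth A m) * r ^ m < v (fps_nth A n) * r ^ n)"

definition gauss_norm :: "real \<Rightarrow> 'a fps \<Rightarrow> real" where
  "gauss_norm r A = (SUP n. v (fps_nth A n) * r ^ n)"

lemma dominant_exists:
  assumes "entire v A" "A \<noteq> 0" "r > 0"
  shows "\<exists>n. dominant r A n"
proof -
  define t where "t = (\<lambda>n. v (fps_nth A n) * r ^ n)"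
  obtain k where k: "fps_nth A k \<noteq> 0" using assms(2) by (auto simp: fps_eq_iff)
  have tk: "t k > 0" using k assms by (simp add: t_def)
  have "t \<longlonglongrightarrow> 0" using assms by (simp add: entire_iff t_def)
  then obtain N where N: "\<And>n. n \<ge> N \<Longrightarrow> t n < t k"
    using order_tendstoD(2)[of t 0 sequentially "t k"] tk by (auto simp: eventually_sequentially)
  define M where "M = Max (t ` {..max N k})"
  have M: "t m \<le> M" for m
  proof (cases "m \<le> max N k")
    case True then show ?thesis by (simp add: M_def)
  next
    case False
    then have "t m < t k" using N by auto
    also have "t k \<le> M" by (simp add: M_def)
    finally show ?thesis by simp
  qed
  define S where "S = {n. t n = M}"
  have "M \<in> t ` {..max N k}" unfolding M_def by (intro Max_in) auto
  then have "S \<noteq> {}" by (auto simp: S_def)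
  moreover have "S \<subseteq> {..N}"
  proof
    fix n assume "n \<in> S"
    then have "t n \<ge> t k" using M[of k] by (simp add: S_def)
    then show "n \<in> {..N}" using N[of n] by (cases "n \<ge> N") auto
  qed
  then have fin: "finite S" by (rule finite_subset) auto
  ultimately have "Max S \<in> S" by simp
  have "t m < M" if "m > Max S" for m
  proof -
    have "m \<notin> S" using that fin Max_ge by fastforce
    then show ?thesis using M[of m] by (auto simp: S_def)
  qed
  then have "dominant r A (Max S)"
    using M \<open>Max S \<in> S\<close> by (auto simp: dominant_def t_def S_def)
  then show ?thesis by blast
qed

lemma dominant_unique: "dominant r A m \<Longrightarrow> dominant r A n \<Longrightarrow> m = n"
  unfolding dominant_def by (metis linorder_neqE_nat not_less)

lemma gauss_norm_eq: "dominant r A n \<Longrightarrow> gauss_norm r A = v (fps_nth A n) * r ^ n"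
  unfolding gauss_norm_def dominant_def by (intro cSup_eq_maximum) auto

lemma gauss_norm_0 [simp]: "gauss_norm r 0 = 0"
  by (simp add: gauss_norm_def)

lemma gauss_norm_upper:
  assumes "entire v A" "r > 0"
  shows "v (fps_nth A n) * r ^ n \<le> gauss_norm r A"
proof (cases "A = 0")
  case False
  then obtain m where "dominant r A m" using dominant_exists assms by blast
  then show ?thesis using gauss_norm_eq by (simp add: dominant_def)
qed auto

lemma gauss_norm_least: "(\<And>n. v (fps_nth A n) * r ^ n \<le> C) \<Longrightarrow> gauss_norm r A \<le> C"
  unfolding gauss_norm_def by (intro cSUP_least) auto

lemma gauss_norm_nonneg:
  assumes "entire v A" "r > 0"
  shows "0 \<le> gauss_norm r A"
  using gauss_norm_upper[OF assms, of 0] nonneg[of "fps_nth A 0"] by simp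

lemma gauss_norm_pos:
  assumes "entire v A" "r > 0" "A \<noteq> 0"
  shows "0 < gauss_norm r A"
proof -
  obtain k where k: "fps_nth A k \<noteq> 0" using assms(3) by (auto simp: fps_eq_iff)
  then have "0 < v (fps_nth A k) * r ^ k" using assms by simp
  then show ?thesis using gauss_norm_upper[OF assms(1,2), of k] by linarith
qed

lemma gauss_norm_eq_0_iff:
  assumes "entire v A" "r > 0"
  shows "gauss_norm r A = 0 \<longleftrightarrow> A = 0"
  using gauss_norm_pos[OF assms] by fastforce

text \<open>The exponent of the last dominant monomial is additive because the product of the
  two last dominant monomials strictly dominates every other contribution to its degree.\<close>

lemma dominant_mult:
  assumes A: "dominant r A i" and B: "dominant r B j" and r: "r > 0"
    and nz: "A \<noteq> 0" "B \<noteq> 0"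
  shows "dominant r (A * B) (i + j)"
    and "v (fps_nth (A * B) (i + j)) * r ^ (i + j) =
      v (fps_nth A i) * r ^ i * (v (fps_nth B j) * r ^ j)"
proof -
  define a b where "a = (\<lambda>n. v (fps_nth A n) * r ^ n)" and "b = (\<lambda>n. v (fps_nth B n) * r ^ n)"
  have a: "a m \<le> a i" "m > i \<Longrightarrow> a m < a i" for m using A by (auto simp: dominant_def a_def)
  have b: "b m \<le> b j" "m > j \<Longrightarrow> b m < b j" for m using B by (auto simp: dominant_def b_def)
  have a0: "0 \<le> a m" and b0: "0 \<le> b m" for m using r nonneg by (auto simp: a_def b_def)
  obtain k where "fps_nth A k \<noteq> 0" using nz by (auto simp: fps_eq_iff)
  then have "0 < a k" using r by (simp add: a_def)
  then have ai: "0 < a i" using a(1)[of k] by linarith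
  obtain k where "fps_nth B k \<noteq> 0" using nz by (auto simp: fps_eq_iff)
  then have "0 < b k" using r by (simp add: b_def)
  then have bj: "0 < b j" using b(1)[of k] by linarith
  have strict: "a s * b t < a i * b j" if "s > i \<or> t > j" for s t
  proof (cases "s > i")
    case True
    have "a s * b t \<le> a s * b j" using b(1) a0 by (intro mult_left_mono) auto
    also have "\<dots> < a i * b j" using a(2)[OF True] bj by simp
    finally show ?thesis .
  next
    case False
    then have "t > j" using that by simp
    have "a s * b t \<le> a i * b t" using a(1) b0 by (intro mult_right_mono) auto
    also have "\<dots> < a i * b j" using b(2)[OF \<open>t > j\<close>] ai by simp
    finally show ?thesis .
  qed
  have term_eq: "v (fps_nth A s * fps_nth B (k - s)) * r ^ k = a s * b (k - s)"
    if "s \<le> k" for s k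
  proof -
    have "r ^ k = r ^ s * r ^ (k - s)" using that by (simp flip: power_add)
    then show ?thesis by (simp add: a_def b_def mult mult_ac)
  qed
  have upper: "v (\<Sum>s\<in>S. fps_nth A s * fps_nth B (k - s)) * r ^ k < a i * b j"
    if S: "\<And>s. s \<in> S \<Longrightarrow> s \<le> k \<and> (s > i \<or> k - s > j)" for S k
  proof -
    have "v (\<Sum>s\<in>S. fps_nth A s * fps_nth B (k - s)) < a i * b j / r ^ k"
    proof (rule v_sum_less)
      fix s assume "s \<in> S"
      then have "v (fps_nth A s * fps_nth B (k - s)) * r ^ k < a i * b j"
        using S term_eq strict by auto
      then show "v (fps_nth A s * fps_nth B (k - s)) < a i * b j / r ^ k"
        using r by (simp add: field_simps)
    qed (use ai bj r in auto)
    then show ?thesis using r by (simp add: field_simps)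
  qed
  have big: "v (fps_nth (A * B) k) * r ^ k < a i * b j" if "k > i + j" for k
    unfolding fps_mult_nth using that by (intro upper) auto
  have main: "v (fps_nth (A * B) (i + j)) * r ^ (i + j) = a i * b j"
  proof -
    let ?h = "\<lambda>s. fps_nth A s * fps_nth B (i + j - s)"
    have split: "fps_nth (A * B) (i + j) = ?h i + sum ?h ({0..i + j} - {i})"
      unfolding fps_mult_nth by (subst sum.remove[of _ i]) auto
    have hi: "v (?h i) * r ^ (i + j) = a i * b j" using term_eq[of i "i + j"] by simp
    have "v (sum ?h ({0..i + j} - {i})) * r ^ (i + j) < a i * b j"
      by (rule upper) auto
    then have "v (sum ?h ({0..i + j} - {i})) * r ^ (i + j) < v (?h i) * r ^ (i + j)"
      unfolding hi .
    then have "v (sum ?h ({0..i + j} - {i})) < v (?h i)"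
      by (simp only: mult_less_cancel_right_pos[OF zero_less_power[OF r]])
    then have "v (?h i + sum ?h ({0..i + j} - {i})) = v (?h i)" by (rule v_add_eq_left)
    then show ?thesis unfolding split using hi by (simp only:)
  qed
  have le: "v (fps_nth (A * B) k) * r ^ k \<le> a i * b j" for k
  proof -
    have "v (fps_nth (A * B) k) \<le> a i * b j / r ^ k"
      unfolding fps_mult_nth
    proof (rule v_sum_le)
      fix s assume "s \<in> {0..k}"
      then have "v (fps_nth A s * fps_nth B (k - s)) * r ^ k = a s * b (k - s)"
        by (intro term_eq) auto
      also have "\<dots> \<le> a i * b j" using ai by (intro mult_mono a(1) b(1) b0) simp
      finally show "v (fps_nth A s * fps_nth B (k - s)) \<le> a i * b j / r ^ k"
        using r by (simp add: field_simps)
    qed (use ai bj r in auto)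
    then show ?thesis using r by (simp add: field_simps)
  qed
  show "v (fps_nth (A * B) (i + j)) * r ^ (i + j) =
      v (fps_nth A i) * r ^ i * (v (fps_nth B j) * r ^ j)"
    using main by (simp add: a_def b_def)
  show "dominant r (A * B) (i + j)"
    unfolding dominant_def main using le big by auto
qed

section \<open>The ring of entire functions and the rules for Gauss norms\<close>

lemma entire_0 [simp]: "entire v 0"
  by (simp add: entire_iff)

lemma entire_fps_of_poly [simp]: "entire v (fps_of_poly p)"
proof -
  have "\<forall>\<^sub>F n in sequentially. v (coeff p n) * r ^ n = 0" for r
    unfolding eventually_sequentially
    by (rule exI[of _ "Suc (degree p)"]) (auto simp: coeff_eq_0 Suc_le_eq)
  then show ?thesis unfolding entire_iff by (auto intro: tendsto_eventually)
qed

lemma entire_const [simp]: "entire v (fps_const c)"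
  using entire_fps_of_poly[of "[:c:]"] by (simp add: fps_of_poly_const)

lemma entire_1 [simp]: "entire v 1"
  using entire_const[of 1] by simp

lemma entire_X [simp]: "entire v fps_X"
  using entire_fps_of_poly[of "[:0, 1:]"] by simp

lemma entire_cutoff [simp]: "entire v (fps_cutoff n A)"
  using entire_fps_of_poly[of "truncate_fps n A"] by simp

lemma entire_add [simp]:
  assumes "entire v A" "entire v B"
  shows "entire v (A + B)"
  unfolding entire_def fps_add_nth distrib_right
  using assms v_sums_add unfolding entire_def by meson

lemma entire_uminus [simp]:
  assumes "entire v A"
  shows "entire v (- A)"
  using assms by (simp add: entire_iff v_minus)

lemma entire_diff [simp]:
  assumes "entire v A" "entire v B"
  shows "entire v (A - B)"
  using entire_add[of A "- B"] assms by simp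

lemma entire_deriv [simp]:
  assumes "entire v A"
  shows "entire v (fps_deriv A)"
  unfolding entire_iff
proof (intro allI impI)
  fix r :: real assume r: "r \<ge> 0"
  \<comment> \<open>A radius of at least 1 absorbs the shift of the index:
    \<open>r ^ n \<le> R ^ (n + 1)\<close>.\<close>
  define R where "R = max r 1"
  have R: "R \<ge> 1" "R \<ge> r" by (auto simp: R_def)
  have "(\<lambda>n. v (fps_nth A n) * R ^ n) \<longlonglongrightarrow> 0" using assms R by (simp add: entire_iff)
  then have "(\<lambda>n. v (fps_nth A (Suc n)) * R ^ Suc n) \<longlonglongrightarrow> 0" by (rule LIMSEQ_Suc)
  then have lim: "(\<lambda>n. v (fps_nth A (Suc n)) * (R * R ^ n)) \<longlonglongrightarrow> 0" by simp
  show "(\<lambda>n. v (fps_nth (fps_deriv A) n) * r ^ n) \<longlonglongrightarrow> 0"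
  proof (rule tendsto_sandwich[OF _ _ tendsto_const lim])
    show "\<forall>\<^sub>F n in sequentially. v (fps_nth (fps_deriv A) n) * r ^ n
        \<le> v (fps_nth A (Suc n)) * (R * R ^ n)"
    proof (intro always_eventually allI)
      fix n
      have "v (fps_nth (fps_deriv A) n) \<le> v (fps_nth A (Suc n))"
        using v_of_nat[of "n + 1"] nonneg by (simp add: mult mult_left_le_one_le)
      moreover have "r ^ n \<le> R ^ n" "R ^ n \<le> R * R ^ n"
        using r R by (auto intro: power_mono)
      ultimately show "v (fps_nth (fps_deriv A) n) * r ^ n \<le> v (fps_nth A (Suc n)) * (R * R ^ n)"
        using r nonneg by (intro mult_mono) auto
    qed
  qed (use r in \<open>auto simp: nonneg\<close>)
qed

lemma gauss_norm_add:
  assumes "entire v A" "entire v B" "r > 0"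
  shows "gauss_norm r (A + B) \<le> max (gauss_norm r A) (gauss_norm r B)"
proof (rule gauss_norm_least)
  fix n
  have "v (fps_nth (A + B) n) * r ^ n \<le> max (v (fps_nth A n)) (v (fps_nth B n)) * r ^ n"
    using assms by (intro mult_right_mono) (auto simp: ultrametric)
  also have "\<dots> \<le> max (gauss_norm r A) (gauss_norm r B)"
    using gauss_norm_upper[OF assms(1,3), of n] gauss_norm_upper[OF assms(2,3), of n]
    by (auto simp: max_def)
  finally show "v (fps_nth (A + B) n) * r ^ n \<le> max (gauss_norm r A) (gauss_norm r B)" .
qed

lemma gauss_norm_uminus [simp]: "gauss_norm r (- A) = gauss_norm r A"
  by (simp add: gauss_norm_def v_minus)

lemma gauss_norm_mult:
  assumes "entire v A" "entire v B" "r > 0"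
  shows "gauss_norm r (A * B) = gauss_norm r A * gauss_norm r B"
proof (cases "A = 0 \<or> B = 0")
  case False
  then obtain i j where "dominant r A i" "dominant r B j" using dominant_exists assms by meson
  then show ?thesis
    using dominant_mult[of r A i B j] assms False by (simp add: gauss_norm_eq)
qed auto

text \<open>Boundedness of the terms at a radius \<open>R > r\<close> gives geometric decay with
  ratio \<open>r / R\<close> at \<open>r\<close>. Hence no convergence has to be proved for derived
  series, only bounds at all large radii.\<close>

lemma entire_coeff_boundI:
  assumes "\<And>R. R \<ge> \<rho> \<Longrightarrow> \<exists>C. \<forall>n. v (fps_nth A n) * R ^ n \<le> C"
  shows "entire v A"
  unfolding entire_iff
proof (intro allI impI)
  fix r :: real assume r: "r \<ge> 0"
  define R where "R = max \<rho> (2 * r + 1)"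
  have R: "R \<ge> \<rho>" "R > 0" "R > r" using r by (auto simp: R_def)
  obtain C where C: "\<And>n. v (fps_nth A n) * R ^ n \<le> C" using assms[OF R(1)] by blast
  have "(\<lambda>n. C * (r / R) ^ n) \<longlonglongrightarrow> C * 0"
    using r R by (intro tendsto_mult tendsto_const LIMSEQ_realpow_zero) auto
  then have lim: "(\<lambda>n. C * (r / R) ^ n) \<longlonglongrightarrow> 0" by simp
  show "(\<lambda>n. v (fps_nth A n) * r ^ n) \<longlonglongrightarrow> 0"
  proof (rule tendsto_sandwich[OF _ _ tendsto_const lim])
    show "\<forall>\<^sub>F n in sequentially. v (fps_nth A n) * r ^ n \<le> C * (r / R) ^ n"
    proof (intro always_eventually allI)
      fix n
      have "v (fps_nth A n) * r ^ n = v (fps_nth A n) * R ^ n * (r / R) ^ n"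
        using R by (simp add: power_divide)
      also have "\<dots> \<le> C * (r / R) ^ n" using C r R by (intro mult_right_mono) auto
      finally show "v (fps_nth A n) * r ^ n \<le> C * (r / R) ^ n" .
    qed
  qed (use r in \<open>auto simp: nonneg\<close>)
qed

lemma entire_mult [simp]:
  assumes "entire v A" "entire v B"
  shows "entire v (A * B)"
proof (rule entire_coeff_boundI[of 1])
  fix R :: real assume R: "R \<ge> 1"
  show "\<exists>C. \<forall>n. v (fps_nth (A * B) n) * R ^ n \<le> C"
  proof (cases "A = 0 \<or> B = 0")
    case False
    then obtain i j where "dominant R A i" "dominant R B j"
      using dominant_exists assms R by (meson less_le_trans zero_less_one)
    then show ?thesis
      using dominant_mult(1)[of R A i B j] R False unfolding dominant_def by auto
  qed auto
qed

lemma gauss_norm_deriv: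
  assumes "entire v A" "r > 0"
  shows "gauss_norm r (fps_deriv A) \<le> gauss_norm r A / r"
proof (rule gauss_norm_least)
  fix n
  have "v (fps_nth (fps_deriv A) n) \<le> v (fps_nth A (Suc n))"
    using v_of_nat[of "n + 1"] nonneg by (simp add: mult mult_left_le_one_le)
  then have "v (fps_nth (fps_deriv A) n) * r ^ n \<le> v (fps_nth A (Suc n)) * r ^ n"
    using assms by (intro mult_right_mono) auto
  also have "\<dots> = v (fps_nth A (Suc n)) * r ^ Suc n / r" using assms by simp
  also have "\<dots> \<le> gauss_norm r A / r"
    using assms by (intro divide_right_mono gauss_norm_upper) auto
  finally show "v (fps_nth (fps_deriv A) n) * r ^ n \<le> gauss_norm r A / r" .
qed

lemma gauss_norm_const [simp]:
  assumes "r > 0"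
  shows "gauss_norm r (fps_const c) = v c"
proof (cases "c = 0")
  case False
  then have "dominant r (fps_const c) 0"
    using assms by (auto simp: dominant_def nonneg)
  then show ?thesis by (simp add: gauss_norm_eq)
qed simp

lemma gauss_norm_cutoff_tendsto:
  assumes "entire v A" "r > 0"
  shows "(\<lambda>n. gauss_norm r (A - fps_cutoff n A)) \<longlonglongrightarrow> 0"
proof (rule LIMSEQ_I)
  fix e :: real assume e: "e > 0"
  have "(\<lambda>n. v (fps_nth A n) * r ^ n) \<longlonglongrightarrow> 0" using assms by (simp add: entire_iff)
  then have "\<forall>\<^sub>F n in sequentially. v (fps_nth A n) * r ^ n < e / 2"
    by (rule order_tendstoD) (use e in simp)
  then obtain N where N: "\<And>n. n \<ge> N \<Longrightarrow> v (fps_nth A n) * r ^ n < e / 2"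
    by (auto simp: eventually_sequentially)
  show "\<exists>no. \<forall>n\<ge>no. norm (gauss_norm r (A - fps_cutoff n A) - 0) < e"
  proof (intro exI allI impI)
    fix n assume n: "n \<ge> N"
    have "gauss_norm r (A - fps_cutoff n A) \<le> e / 2"
      using N n e by (intro gauss_norm_least) (auto simp: less_imp_le)
    then show "norm (gauss_norm r (A - fps_cutoff n A) - 0) < e"
      using gauss_norm_nonneg[of "A - fps_cutoff n A" r] assms e by simp
  qed
qed

text \<open>Polynomials are dense in the entire functions.\<close>

lemma bounded_additive_eq_0:
  assumes add: "\<And>A B. entire v A \<Longrightarrow> entire v B \<Longrightarrow> \<phi> (A + B) = \<phi> A + \<phi> B"
    and bound: "\<And>A. entire v A \<Longrightarrow> v (\<phi> A) \<le> C * gauss_norm r A"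
    and poly: "\<And>p. \<phi> (fps_of_poly p) = 0"
    and A: "entire v A" and r: "r > 0"
  shows "\<phi> A = 0"
proof -
  have "v (\<phi> A) \<le> C * gauss_norm r (A - fps_cutoff n A)" for n
  proof -
    have "\<phi> A = \<phi> (A - fps_cutoff n A) + \<phi> (fps_cutoff n A)"
      using add[of "A - fps_cutoff n A" "fps_cutoff n A"] A by simp
    also have "\<phi> (fps_cutoff n A) = 0" using poly[of "truncate_fps n A"] by simp
    finally show ?thesis using bound[of "A - fps_cutoff n A"] A by simp
  qed
  moreover have "(\<lambda>n. C * gauss_norm r (A - fps_cutoff n A)) \<longlonglongrightarrow> C * 0"
    using A r by (intro tendsto_mult tendsto_const gauss_norm_cutoff_tendsto)
  ultimately have "v (\<phi> A) \<le> 0" by (intro LIMSEQ_le_const) auto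
  then show ?thesis using nonneg[of "\<phi> A"] eq_0_iff by fastforce
qed

subsection \<open>Taylor expansions\<close>

text \<open>The derivative of order \<open>n\<close> divided by \<open>n!\<close>. Its coefficients
  involve binomial numbers only, which are integers and thus have absolute value at most 1; dividing
  afterwards by a possibly small \<open>n!\<close> would destroy the norm estimates.\<close>

definition hasse_deriv :: "nat \<Rightarrow> 'a fps \<Rightarrow> 'a fps" where
  "hasse_deriv n A = Abs_fps (\<lambda>k. of_nat ((k + n) choose n) * fps_nth A (k + n))"

lemma fact_mult_fps_nth_deriv:
  "fact k * fps_nth (fps_nth_deriv n A) k = fact (k + n) * fps_nth (A :: 'a fps) (k + n)"
proof (induction n arbitrary: A)
  case (Suc n)
  have "fact k * fps_nth (fps_nth_deriv (Suc n) A) k = fact (k + n) * fps_nth (fps_deriv A) (k + n)"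
    using Suc[of "fps_deriv A"] by simp
  also have "\<dots> = fact (k + Suc n) * fps_nth A (k + Suc n)"
    by (simp add: algebra_simps)
  finally show ?case .
qed simp

lemma fps_nth_deriv_hasse: "fps_nth_deriv n A = fps_const (fact n) * hasse_deriv n A"
proof (rule fps_ext)
  fix k
  have "(fact n :: 'a) * fact k * of_nat ((k + n) choose n) = fact (k + n)"
    using binomial_fact_lemma[of n "k + n"] by (metis of_nat_fact of_nat_mult diff_add_inverse2 le_add2)
  then have "fact k * fps_nth (fps_const (fact n) * hasse_deriv n A) k
      = fact k * fps_nth (fps_nth_deriv n A) k"
    unfolding fact_mult_fps_nth_deriv by (simp add: hasse_deriv_def flip: mult.assoc) (simp add: mult_ac)
  then show "fps_nth (fps_nth_deriv n A) k = fps_nth (fps_const (fact n) * hasse_deriv n A) k"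
    by (metis mult_left_cancel fact_nonzero)
qed

section \<open>Evaluation of entire functions at a point\<close>

lemma entire_eval_eqI:
  assumes "v_sums v (\<lambda>n. fps_nth A n * x ^ n) s"
  shows "entire_eval v A x = s"
  unfolding entire_eval_def using assms by (rule the_equality) (erule v_sums_unique[OF _ assms])

lemma entire_eval_v_sums:
  assumes "entire v A"
  shows "v_sums v (\<lambda>n. fps_nth A n * x ^ n) (entire_eval v A x)"
proof -
  obtain s where s: "v_sums v (\<lambda>n. fps_nth A n * x ^ n) s"
    using assms unfolding entire_def by blast
  show ?thesis unfolding entire_eval_eqI[OF s] by (rule s)
qed

lemma entire_eval_add:
  assumes "entire v A" "entire v B"
  shows "entire_eval v (A + B) x = entire_eval v A x + entire_eval v B x"
  using v_sums_add[OF entire_eval_v_sums[OF assms(1), of x] entire_eval_v_sums[OF assms(2), of x]]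
  by (intro entire_eval_eqI) (simp add: distrib_right)

lemma entire_eval_cmult:
  assumes "entire v A"
  shows "entire_eval v (fps_const c * A) x = c * entire_eval v A x"
  using v_sums_mult[OF entire_eval_v_sums[OF assms(1), of x], of c]
  by (intro entire_eval_eqI) (simp add: mult.assoc)

lemma entire_eval_X_mult:
  assumes "entire v A"
  shows "entire_eval v (fps_X * A) x = x * entire_eval v A x"
proof -
  have "v_sums v (\<lambda>n. fps_nth (fps_X * A) (Suc n) * x ^ Suc n) (x * entire_eval v A x)"
    using v_sums_mult[OF entire_eval_v_sums[OF assms(1), of x], of x] by (simp add: mult_ac)
  then show ?thesis
    by (intro entire_eval_eqI, elim v_sums_shift) simp
qed

lemma entire_eval_const [simp]: "entire_eval v (fps_const c) x = c"
proof (rule entire_eval_eqI)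
  have "(\<lambda>n. fps_nth (fps_const c) n * x ^ n) = (\<lambda>n. if n = 0 then c else 0)" by auto
  then show "v_sums v (\<lambda>n. fps_nth (fps_const c) n * x ^ n) c" by (simp only: v_sums_single)
qed

lemma v_entire_eval_le:
  assumes "entire v A" "r > 0" "v x \<le> r"
  shows "v (entire_eval v A x) \<le> gauss_norm r A"
proof (rule v_sums_le[OF entire_eval_v_sums[OF assms(1)]])
  fix n
  have "v (fps_nth A n * x ^ n) \<le> v (fps_nth A n) * r ^ n"
    using assms nonneg by (auto simp: mult v_power intro!: mult_left_mono power_mono)
  also have "\<dots> \<le> gauss_norm r A" using assms by (intro gauss_norm_upper)
  finally show "v (fps_nth A n * x ^ n) \<le> gauss_norm r A" .
qed

lemma v_hasse_coeff_le:
  assumes "entire v A" "r > 0"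
  shows "v (fps_nth (hasse_deriv n A) k) * r ^ k \<le> gauss_norm r A / r ^ n"
proof -
  have "v (fps_nth (hasse_deriv n A) k) \<le> v (fps_nth A (k + n))"
    using v_of_nat[of "(k + n) choose n"] nonneg
    by (simp add: hasse_deriv_def mult mult_left_le_one_le)
  then have "v (fps_nth (hasse_deriv n A) k) * r ^ k \<le> v (fps_nth A (k + n)) * r ^ k"
    using assms by (intro mult_right_mono) auto
  also have "\<dots> = v (fps_nth A (k + n)) * r ^ (k + n) / r ^ n"
    using assms by (simp add: power_add)
  also have "\<dots> \<le> gauss_norm r A / r ^ n"
    using assms by (intro divide_right_mono gauss_norm_upper) auto
  finally show ?thesis .
qed

lemma entire_hasse_deriv [simp]:
  assumes "entire v A"
  shows "entire v (hasse_deriv n A)"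
proof (rule entire_coeff_boundI[of 1])
  fix R :: real assume "R \<ge> 1"
  then show "\<exists>C. \<forall>k. v (fps_nth (hasse_deriv n A) k) * R ^ k \<le> C"
    using v_hasse_coeff_le[OF assms, of R n] by auto
qed

lemma gauss_norm_hasse_deriv:
  assumes "entire v A" "r > 0"
  shows "gauss_norm r (hasse_deriv n A) \<le> gauss_norm r A / r ^ n"
  using assms by (intro gauss_norm_least v_hasse_coeff_le)

lemma hasse_deriv_add: "hasse_deriv n (A + B) = hasse_deriv n A + hasse_deriv n B"
  by (rule fps_ext) (simp add: hasse_deriv_def distrib_left)

lemma hasse_deriv_cmult: "hasse_deriv n (fps_const c * A) = fps_const c * hasse_deriv n A"
  by (rule fps_ext) (simp add: hasse_deriv_def mult_ac)

lemma hasse_deriv_0 [simp]: "hasse_deriv 0 A = A"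
  by (rule fps_ext) (simp add: hasse_deriv_def)

lemma hasse_deriv_Suc_X_mult:
  "hasse_deriv (Suc n) (fps_X * A) = fps_X * hasse_deriv (Suc n) A + hasse_deriv n A"
proof (rule fps_ext)
  fix k
  show "fps_nth (hasse_deriv (Suc n) (fps_X * A)) k =
    fps_nth (fps_X * hasse_deriv (Suc n) A + hasse_deriv n A) k"
    by (cases k) (simp_all add: hasse_deriv_def algebra_simps)
qed

section \<open>Taylor expansion as a ring homomorphism\<close>

lemma fps_nth_taylor_at:
  assumes "entire v A"
  shows "fps_nth (taylor_at v c A) n = entire_eval v (hasse_deriv n A) c"
  using assms by (simp add: taylor_at_def fps_nth_deriv_hasse entire_eval_cmult)

text \<open>On a disc that contains \<open>c\<close>, translation by \<open>c\<close> does not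
  increase the Gauss norm. This is the continuity on which the density arguments below rest.\<close>

lemma v_taylor_at_le:
  assumes "entire v A" "r > 0" "v c \<le> r"
  shows "v (fps_nth (taylor_at v c A) n) * r ^ n \<le> gauss_norm r A"
proof -
  have "v (fps_nth (taylor_at v c A) n) \<le> gauss_norm r A / r ^ n"
    unfolding fps_nth_taylor_at[OF assms(1)]
    using v_entire_eval_le[of "hasse_deriv n A" r c] gauss_norm_hasse_deriv[of A r n] assms by auto
  then show ?thesis using assms by (simp add: field_simps)
qed

lemma entire_taylor_at [simp]:
  assumes "entire v A"
  shows "entire v (taylor_at v c A)"
proof (rule entire_coeff_boundI[of "max 1 (v c)"])
  fix R assume "R \<ge> max 1 (v c)"
  then show "\<exists>C. \<forall>n. v (fps_nth (taylor_at v c A) n) * R ^ n \<le> C"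
    using v_taylor_at_le[OF assms, of R c] by auto
qed

lemma gauss_norm_taylor_at_le:
  assumes "entire v A" "r > 0" "v c \<le> r"
  shows "gauss_norm r (taylor_at v c A) \<le> gauss_norm r A"
  using assms by (intro gauss_norm_least v_taylor_at_le)

lemma taylor_at_add:
  assumes "entire v A" "entire v B"
  shows "taylor_at v c (A + B) = taylor_at v c A + taylor_at v c B"
  using assms by (intro fps_ext) (simp add: fps_nth_taylor_at hasse_deriv_add entire_eval_add)

lemma taylor_at_cmult:
  assumes "entire v A"
  shows "taylor_at v c (fps_const k * A) = fps_const k * taylor_at v c A"
  using assms by (intro fps_ext) (simp add: fps_nth_taylor_at hasse_deriv_cmult entire_eval_cmult)

lemma taylor_at_uminus:
  assumes "entire v A"
  shows "taylor_at v c (- A) = - taylor_at v c A"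
  using taylor_at_cmult[OF assms, of c "-1"] by (simp flip: fps_const_neg)

lemma taylor_at_diff:
  assumes "entire v A" "entire v B"
  shows "taylor_at v c (A - B) = taylor_at v c A - taylor_at v c B"
  using taylor_at_add[of A "- B" c] assms by (simp add: taylor_at_uminus)

lemma taylor_at_const [simp]: "taylor_at v c (fps_const k) = fps_const k"
proof (rule fps_ext)
  fix n
  have "hasse_deriv n (fps_const k) = (if n = 0 then fps_const k else 0)"
    by (rule fps_ext) (simp add: hasse_deriv_def)
  then show "fps_nth (taylor_at v c (fps_const k)) n = fps_nth (fps_const k) n"
    using entire_eval_const[of 0] by (simp add: fps_nth_taylor_at del: entire_eval_const)
      (metis entire_eval_const fps_const_0_eq_0)
qed

lemma taylor_at_0_right [simp]: "taylor_at v c 0 = 0"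
  using taylor_at_const[of c 0] by simp

lemma taylor_at_1 [simp]: "taylor_at v c 1 = 1"
  using taylor_at_const[of c 1] by simp

lemma taylor_at_X_mult:
  assumes "entire v A"
  shows "taylor_at v c (fps_X * A) = (fps_X + fps_const c) * taylor_at v c A"
proof (rule fps_ext)
  fix n
  show "fps_nth (taylor_at v c (fps_X * A)) n =
    fps_nth ((fps_X + fps_const c) * taylor_at v c A) n"
    using assms by (cases n)
      (simp_all add: fps_nth_taylor_at hasse_deriv_Suc_X_mult entire_eval_X_mult entire_eval_add
        distrib_right)
qed

text \<open>Horner's scheme reduces this to constants and to multiplication by \<open>X\<close>,
  which translates into multiplication by \<open>X + c\<close>. Only one factor is a polynomial;
  density removes this restriction.\<close>

lemma taylor_at_poly_mult:
  assumes "entire v A"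
  shows "taylor_at v c (fps_of_poly p * A) = taylor_at v c (fps_of_poly p) * taylor_at v c A"
proof (induction p)
  case (pCons k p)
  have 1: "fps_of_poly (pCons k p) = fps_const k + fps_X * fps_of_poly p"
    by (simp add: fps_of_poly_pCons mult.commute)
  have 2: "fps_of_poly (pCons k p) * A = fps_const k * A + fps_X * (fps_of_poly p * A)"
    unfolding 1 by (simp add: algebra_simps)
  let ?T = "taylor_at v c"
  have "?T (fps_of_poly (pCons k p) * A)
      = fps_const k * ?T A + (fps_X + fps_const c) * (?T (fps_of_poly p) * ?T A)"
    unfolding 2 using assms pCons.IH by (simp add: taylor_at_add taylor_at_cmult taylor_at_X_mult)
  also have "\<dots> = (fps_const k + (fps_X + fps_const c) * ?T (fps_of_poly p)) * ?T A"
    by (simp add: algebra_simps)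
  also have "fps_const k + (fps_X + fps_const c) * ?T (fps_of_poly p) = ?T (fps_of_poly (pCons k p))"
    unfolding 1 by (simp add: taylor_at_add taylor_at_X_mult)
  finally show ?case .
qed simp

lemma taylor_at_mult:
  assumes "entire v A" "entire v B"
  shows "taylor_at v c (A * B) = taylor_at v c A * taylor_at v c B"
proof (rule fps_ext)
  fix n
  define r where "r = max 1 (v c)"
  have r: "r > 0" "v c \<le> r" by (auto simp: r_def)
  \<comment> \<open>The defect of multiplicativity in degree \<open>n\<close>, as a function of
    \<open>A\<close> with \<open>B\<close> fixed: additive, bounded by a multiple of the Gauss norm,
    and zero on polynomials.\<close>
  define \<phi> where "\<phi> = (\<lambda>A. fps_nth (taylor_at v c (A * B) - taylor_at v c A * taylor_at v c B) n)"
  have "\<phi> A = 0"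
  proof (rule bounded_additive_eq_0[where C = "gauss_norm r B / r ^ n" and r = r])
    show "\<phi> (A1 + A2) = \<phi> A1 + \<phi> A2" if "entire v A1" "entire v A2" for A1 A2
      using that assms by (simp add: \<phi>_def distrib_right taylor_at_add)
    show "\<phi> (fps_of_poly p) = 0" for p
      using assms by (simp add: \<phi>_def taylor_at_poly_mult)
    show "v (\<phi> A1) \<le> gauss_norm r B / r ^ n * gauss_norm r A1" if A1: "entire v A1" for A1
    proof -
      let ?D = "taylor_at v c (A1 * B) - taylor_at v c A1 * taylor_at v c B"
      have *: "gauss_norm r (taylor_at v c A1 * taylor_at v c B) \<le> gauss_norm r A1 * gauss_norm r B"
        using A1 assms r
        by (simp add: gauss_norm_mult gauss_norm_taylor_at_le gauss_norm_nonneg mult_mono)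
      have "v (\<phi> A1) * r ^ n \<le> gauss_norm r ?D"
        unfolding \<phi>_def using A1 assms r by (intro gauss_norm_upper) auto
      also have "\<dots> \<le> max (gauss_norm r (taylor_at v c (A1 * B)))
          (gauss_norm r (- (taylor_at v c A1 * taylor_at v c B)))"
        using gauss_norm_add[of "taylor_at v c (A1 * B)" "- (taylor_at v c A1 * taylor_at v c B)" r]
          A1 assms r by simp
      also have "\<dots> \<le> gauss_norm r A1 * gauss_norm r B"
        using * gauss_norm_taylor_at_le[of "A1 * B" r c] A1 assms r
        by (simp add: gauss_norm_mult)
      finally show ?thesis using r by (simp add: field_simps)
    qed
  qed (use assms r in auto)
  then show "fps_nth (taylor_at v c (A * B)) n = fps_nth (taylor_at v c A * taylor_at v c B) n"
    by (simp add: \<phi>_def)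
qed

lemma taylor_at_X: "taylor_at v c fps_X = fps_X + fps_const c"
  using taylor_at_X_mult[of 1 c] by simp

text \<open>On polynomials both sides are ring homomorphisms that fix the constants and send
  \<open>X\<close> to \<open>X + c + d\<close>; the general case follows by density. In particular
  translation is invertible.\<close>

lemma taylor_at_taylor_at:
  assumes "entire v A"
  shows "taylor_at v d (taylor_at v c A) = taylor_at v (d + c) A"
proof (rule fps_ext)
  fix n
  define r where "r = max 1 (max (v c) (v d))"
  have r: "r > 0" "v c \<le> r" "v d \<le> r" "v (d + c) \<le> r"
    using ultrametric[of d c] by (auto simp: r_def)
  define \<phi> where "\<phi> = (\<lambda>A. fps_nth (taylor_at v d (taylor_at v c A) - taylor_at v (d + c) A) n)"
  have "\<phi> A = 0"
  proof (rule bounded_additive_eq_0[where C = "1 / r ^ n" and r = r])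
    show "\<phi> (A1 + A2) = \<phi> A1 + \<phi> A2" if "entire v A1" "entire v A2" for A1 A2
      using that by (simp add: \<phi>_def taylor_at_add)
    show "\<phi> (fps_of_poly p) = 0" for p
    proof -
      have "taylor_at v d (taylor_at v c (fps_of_poly p)) = taylor_at v (d + c) (fps_of_poly p)"
      proof (induction p)
        case (pCons k p)
        have 1: "fps_of_poly (pCons k p) = fps_const k + fps_X * fps_of_poly p"
          by (simp add: fps_of_poly_pCons mult.commute)
        show ?case
          unfolding 1 using pCons
          by (simp add: taylor_at_add taylor_at_mult taylor_at_X add.assoc)
      qed simp
      then show ?thesis by (simp add: \<phi>_def)
    qed
    show "v (\<phi> A1) \<le> 1 / r ^ n * gauss_norm r A1" if A1: "entire v A1" for A1
    proof -
      let ?D = "taylor_at v d (taylor_at v c A1) - taylor_at v (d + c) A1"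
      have *: "gauss_norm r (taylor_at v d (taylor_at v c A1)) \<le> gauss_norm r A1"
        using A1 r by (intro order_trans[OF gauss_norm_taylor_at_le gauss_norm_taylor_at_le]) auto
      have "v (\<phi> A1) * r ^ n \<le> gauss_norm r ?D"
        unfolding \<phi>_def using A1 r by (intro gauss_norm_upper) auto
      also have "\<dots> \<le> max (gauss_norm r (taylor_at v d (taylor_at v c A1)))
          (gauss_norm r (- taylor_at v (d + c) A1))"
        using gauss_norm_add[of "taylor_at v d (taylor_at v c A1)" "- taylor_at v (d + c) A1" r]
          A1 r by simp
      also have "\<dots> \<le> gauss_norm r A1"
        using * gauss_norm_taylor_at_le[of A1 r "d + c"] A1 r by simp
      finally show ?thesis using r by (simp add: field_simps)
    qed
  qed (use assms r in auto)
  then show "fps_nth (taylor_at v d (taylor_at v c A)) n = fps_nth (taylor_at v (d + c) A) n"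
    by (simp add: \<phi>_def)
qed

lemma taylor_at_0_left [simp]:
  assumes "entire v A"
  shows "taylor_at v 0 A = A"
proof (rule fps_ext)
  fix n
  have "v_sums v (\<lambda>k. fps_nth (hasse_deriv n A) k * 0 ^ k) (fps_nth A n)"
  proof -
    have "(\<lambda>k. fps_nth (hasse_deriv n A) k * 0 ^ k) = (\<lambda>k. if k = 0 then fps_nth A n else 0)"
      by (rule ext) (simp add: hasse_deriv_def)
    then show ?thesis by (simp only: v_sums_single)
  qed
  then show "fps_nth (taylor_at v 0 A) n = fps_nth A n"
    using assms by (simp add: fps_nth_taylor_at entire_eval_eqI)
qed

lemma taylor_at_eq_0_iff:
  assumes "entire v A"
  shows "taylor_at v c A = 0 \<longleftrightarrow> A = 0"
proof
  assume "taylor_at v c A = 0"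
  then have "taylor_at v (- c) (taylor_at v c A) = 0" by simp
  then show "A = 0" using assms by (simp add: taylor_at_taylor_at)
qed simp

lemma taylor_at_deriv:
  assumes "entire v A"
  shows "taylor_at v c (fps_deriv A) = fps_deriv (taylor_at v c A)"
proof (rule fps_ext)
  fix n
  have "fps_nth (taylor_at v c (fps_deriv A)) n = entire_eval v (fps_nth_deriv (Suc n) A) c / fact n"
    by (simp add: taylor_at_def)
  also have "\<dots> = of_nat (Suc n) * (entire_eval v (fps_nth_deriv (Suc n) A) c / fact (Suc n))"
    by (simp add: field_simps del: of_nat_Suc)
  also have "\<dots> = fps_nth (fps_deriv (taylor_at v c A)) n"
    by (simp add: taylor_at_def del: of_nat_Suc fps_nth_deriv.simps)
  finally show "fps_nth (taylor_at v c (fps_deriv A)) n = fps_nth (fps_deriv (taylor_at v c A)) n" .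
qed

lemma entire_eval_eq_taylor: "entire v A \<Longrightarrow> entire_eval v A x = fps_nth (taylor_at v x A) 0"
  by (simp add: fps_nth_taylor_at)

lemma entire_eval_mult:
  assumes "entire v A" "entire v B"
  shows "entire_eval v (A * B) x = entire_eval v A x * entire_eval v B x"
  using assms by (simp add: entire_eval_eq_taylor taylor_at_mult)

lemma entire_eval_diff:
  assumes "entire v A" "entire v B"
  shows "entire_eval v (A - B) x = entire_eval v A x - entire_eval v B x"
  using assms by (simp add: entire_eval_eq_taylor taylor_at_diff)

lemma entire_eval_poly: "entire_eval v (fps_of_poly p) x = poly p x"
proof (induction p)
  case (pCons k p)
  have 1: "fps_of_poly (pCons k p) = fps_const k + fps_X * fps_of_poly p"
    by (simp add: fps_of_poly_pCons mult.commute)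
  show ?case unfolding 1 using pCons by (simp add: entire_eval_add entire_eval_X_mult)
qed (metis entire_eval_const fps_const_0_eq_0 fps_of_poly_0 poly_0)

text \<open>Translation moves the zero to \<open>0\<close>, where it can be divided out.\<close>

lemma entire_factor_zero:
  assumes "entire v A" "entire_eval v A c = 0"
  obtains B where "entire v B" "A = (fps_X - fps_const c) * B"
proof -
  define S where "S = fps_shift 1 (taylor_at v c A)"
  have S: "taylor_at v c A = fps_X * S"
    using assms by (intro fps_ext) (auto simp: S_def entire_eval_eq_taylor)
  have "entire v S"
  proof (rule entire_coeff_boundI[of 1])
    fix R :: real assume R: "R \<ge> 1"
    have "v (fps_nth S n) * R ^ n \<le> gauss_norm R (taylor_at v c A)" for n
    proof -
      have "v (fps_nth S n) * R ^ n \<le> v (fps_nth S n) * R ^ Suc n"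
        using R nonneg by (intro mult_left_mono power_increasing) auto
      also have "\<dots> \<le> gauss_norm R (taylor_at v c A)"
        using gauss_norm_upper[of "taylor_at v c A" R "Suc n"] assms R by (simp add: S_def)
      finally show ?thesis .
    qed
    then show "\<exists>C. \<forall>n. v (fps_nth S n) * R ^ n \<le> C" by blast
  qed
  have "A = taylor_at v (- c) (taylor_at v c A)"
    using assms by (simp add: taylor_at_taylor_at)
  also have "\<dots> = (fps_X - fps_const c) * taylor_at v (- c) S"
    unfolding S using \<open>entire v S\<close> by (simp add: taylor_at_mult taylor_at_X flip: fps_const_neg)
  finally show ?thesis using \<open>entire v S\<close> that[of "taylor_at v (- c) S"] by simp
qed

subsection \<open>Zeros of entire functions and Jensen's formula\<close>

text \<open>At the tie \<open>v c = r\<close> the later index 1 is chosen, so a zero on the boundary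
  circle counts as lying in the disc.\<close>

lemma dominant_linear:
  assumes "r > 0"
  shows "dominant r (fps_X - fps_const c) (if v c \<le> r then 1 else 0)"
proof -
  have *: "v (fps_nth (fps_X - fps_const c) m) * r ^ m =
      (if m = 0 then v c else if m = 1 then r else 0)" for m
    by (auto simp: v_minus)
  show ?thesis unfolding dominant_def * using assms nonneg[of c] by auto
qed

lemma gauss_norm_linear:
  assumes "r > 0"
  shows "gauss_norm r (fps_X - fps_const c) = max r (v c)"
  using gauss_norm_eq[OF dominant_linear[OF assms, of c]]
  by (auto simp: v_minus max_def)

lemma entire_linear [simp]: "entire v (fps_X - fps_const c)"
  by simp

lemma fps_of_poly_root_factor: "fps_of_poly [:- c, 1:] = fps_X - fps_const (c :: 'a)"
  by (rule fps_ext) (auto simp: coeff_pCons split: nat.splits)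

text \<open>Both parts compare the linear factors one by one. A root in the disc raises the dominant
  index by one and has Gauss norm \<open>r\<close>, while its value at \<open>y\<close> is at least
  \<delta>. For a root \<open>z\<close> outside the disc \<open>v (y - z) = v z\<close>, which is
  exactly its Gauss norm, so that nothing is lost.\<close>

lemma dominant_split_poly:
  assumes "r > 0" "\<beta> \<noteq> 0" "p = smult \<beta> (\<Prod>z\<in>#Z. [:- z, 1:])"
    "n = size (filter_mset (\<lambda>z. v z \<le> r) Z)"
  shows "dominant r (fps_of_poly p) n"
    and "v y \<le> r \<Longrightarrow> 0 < \<delta> \<Longrightarrow> \<delta> \<le> r \<Longrightarrow> (\<And>z. z \<in># Z \<Longrightarrow> v z \<le> r \<Longrightarrow> \<delta> \<le> v (y - z)) \<Longrightarrow>
      gauss_norm r (fps_of_poly p) * \<delta> ^ n \<le> v (poly p y) * r ^ n"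
  using assms(3,4)
proof (induction Z arbitrary: p n)
  case empty
  {
    case 1
    then show ?case using assms by (auto simp: dominant_def fps_of_poly_const nonneg)
  next
    case 2
    then show ?case using assms by (simp add: fps_of_poly_const)
  }
next
  case (add x Z)
  define q where "q = smult \<beta> (\<Prod>z\<in>#Z. [:- z, 1:])"
  define m where "m = size (filter_mset (\<lambda>z. v z \<le> r) Z)"
  have q0: "q \<noteq> 0" using assms(2) unfolding q_def
    by (auto simp: prod_mset_zero_iff)
  have p: "p = [:- x, 1:] * q" if "p = smult \<beta> (\<Prod>z\<in>#add_mset x Z. [:- z, 1:])" for p
    using that by (simp add: q_def mult_smult_right del: mult_pCons_left)
  have n: "n = (if v x \<le> r then 1 else 0) + m"
    if "n = size (filter_mset (\<lambda>z. v z \<le> r) (add_mset x Z))" for n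
    using that by (simp add: m_def)
  have fp: "fps_of_poly ([:- x, 1:] * q) = (fps_X - fps_const x) * fps_of_poly q"
    by (simp only: fps_of_poly_mult fps_of_poly_root_factor)
  {
    case 1
    have "dominant r (fps_of_poly q) m" using add.IH(1)[OF q_def m_def] .
    then show ?case
      unfolding p[OF 1(1)] n[OF 1(2)] fp
      using q0 assms by (intro dominant_mult dominant_linear) (auto simp: fps_of_poly_eq_iff[of _ 0, simplified])
  next
    case 2
    have IH: "gauss_norm r (fps_of_poly q) * \<delta> ^ m \<le> v (poly q y) * r ^ m"
      using 2 by (intro add.IH(2)[OF _ _ _ _ q_def m_def]) auto
    have G: "gauss_norm r (fps_of_poly p) = max r (v x) * gauss_norm r (fps_of_poly q)"
      unfolding p[OF 2(5)] fp using assms by (simp add: gauss_norm_mult gauss_norm_linear)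
    have E: "v (poly p y) = v (y - x) * v (poly q y)"
      unfolding p[OF 2(5)] poly_mult mult by simp
    show ?case
    proof (cases "v x \<le> r")
      case True
      have "\<delta> \<le> v (y - x)" using 2 True by auto
      then have r1: "r * \<delta> \<le> r * v (y - x)" using assms by simp
      have "(r * \<delta>) * (gauss_norm r (fps_of_poly q) * \<delta> ^ m) \<le> (r * v (y - x)) * (v (poly q y) * r ^ m)"
        using assms 2 gauss_norm_nonneg[of "fps_of_poly q" r] nonneg
        by (intro mult_mono[OF r1 IH]) auto
      then show ?thesis using True unfolding G E n[OF 2(6)] by (simp add: mult_ac max_def)
    next
      case False
      then have "v (y - x) = v x" using v_add_eq_right[of y "- x"] 2 by (simp add: v_minus)
      then have "max r (v x) * (gauss_norm r (fps_of_poly q) * \<delta> ^ m) \<le> v (y - x) * (v (poly q y) * r ^ m)"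
        using False IH nonneg by (auto intro!: mult_left_mono)
      then show ?thesis using False unfolding G E n[OF 2(6)] by (simp add: mult_ac)
    qed
  }
qed

text \<open>If all \<open>n\<close> roots in the disc had distance at least \<delta> from
  \<open>y\<close>, the value at \<open>y\<close> would be too large. The root nearest to
  \<open>y\<close> therefore works for all \<delta> at once.\<close>

lemma poly_zero_nearby:
  assumes "r > 0" "p \<noteq> 0" "dominant r (fps_of_poly p) n" "n > 0" "v y \<le> r"
  obtains z where "poly p z = 0" "v z \<le> r"
    "\<And>\<delta>. 0 < \<delta> \<Longrightarrow> \<delta> \<le> r \<Longrightarrow>
      v (poly p y) * r ^ n < gauss_norm r (fps_of_poly p) * \<delta> ^ n \<Longrightarrow> v (y - z) < \<delta>"
proof -
  obtain Z where Z: "p = smult (lead_coeff p) (\<Prod>z\<in>#Z. [:- z, 1:])"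
    using alg_closed_imp_factorization[OF assms(2)] by blast
  have lc: "lead_coeff p \<noteq> 0" using assms by simp
  define S where "S = {z. z \<in># Z \<and> v z \<le> r}"
  have "finite S" unfolding S_def by (rule finite_subset[of _ "set_mset Z"]) auto
  have n: "n = size (filter_mset (\<lambda>z. v z \<le> r) Z)"
    using dominant_split_poly(1)[OF assms(1) lc Z refl] assms(3) dominant_unique by blast
  then have "filter_mset (\<lambda>z. v z \<le> r) Z \<noteq> {#}"
    using assms(4) by (metis size_empty less_irrefl)
  then obtain x where "x \<in># filter_mset (\<lambda>z. v z \<le> r) Z" by (rule multiset_nonemptyE)
  then have "S \<noteq> {}" by (auto simp: S_def)
  define z where "z = arg_min_on (\<lambda>z. v (y - z)) S"
  have "z \<in> S" unfolding z_def using \<open>finite S\<close> \<open>S \<noteq> {}\<close> by (rule arg_min_if_finite)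
  have min: "v (y - z) \<le> v (y - x)" if "x \<in> S" for x
    unfolding z_def using arg_min_least[OF \<open>finite S\<close> \<open>S \<noteq> {}\<close> that, of "\<lambda>z. v (y - z)"] .
  show thesis
  proof (rule that[of z])
    have "poly (\<Prod>z\<in>#Z. [:- z, 1:]) z = 0"
      using \<open>z \<in> S\<close> by (auto simp: S_def poly_prod_mset prod_mset_zero_iff)
    then show "poly p z = 0" by (subst Z) simp
    show "v z \<le> r" using \<open>z \<in> S\<close> by (simp add: S_def)
    fix \<delta> assume \<delta>: "0 < \<delta>" "\<delta> \<le> r" "v (poly p y) * r ^ n < gauss_norm r (fps_of_poly p) * \<delta> ^ n"
    show "v (y - z) < \<delta>"
    proof (rule ccontr)
      assume "\<not> v (y - z) < \<delta>"
      then have "\<delta> \<le> v (y - x)" if "x \<in># Z" "v x \<le> r" for x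
        using min[of x] that by (auto simp: S_def)
      then show False
        using dominant_split_poly(2)[OF assms(1) lc Z n assms(5) \<delta>(1,2)] \<delta>(3) by force
    qed
  qed
qed

text \<open>Write \<open>A - A(y) = (X - y) * B\<close>. As \<open>X - y\<close> has Gauss norm
  \<open>r\<close>, multiplicativity bounds the norm of \<open>B\<close> by that of \<open>A\<close>
  divided by \<open>r\<close>.\<close>

lemma entire_eval_lipschitz:
  assumes "entire v A" "r > 0" "v x \<le> r" "v y \<le> r"
  shows "v (entire_eval v A x - entire_eval v A y) \<le> gauss_norm r A / r * v (x - y)"
proof -
  let ?A = "A - fps_const (entire_eval v A y)"
  have "entire_eval v ?A y = 0" using assms by (simp add: entire_eval_diff)
  then obtain B where B: "entire v B" "?A = (fps_X - fps_const y) * B"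
    using entire_factor_zero[of ?A y] assms by auto
  have "r * gauss_norm r B = gauss_norm r ?A"
    unfolding B(2) using B(1) assms by (simp add: gauss_norm_mult gauss_norm_linear)
  also have "\<dots> \<le> max (gauss_norm r A) (v (entire_eval v A y))"
    using gauss_norm_add[of A "- fps_const (entire_eval v A y)" r] assms
    by (simp del: fps_const_neg)
  also have "\<dots> = gauss_norm r A" using v_entire_eval_le[OF assms(1,2,4)] by simp
  finally have gB: "gauss_norm r B \<le> gauss_norm r A / r" using assms by (simp add: field_simps)
  have "entire_eval v A x - entire_eval v A y = entire_eval v ?A x"
    using assms by (simp add: entire_eval_diff)
  also have "\<dots> = (x - y) * entire_eval v B x"
  proof -
    have "entire_eval v (fps_X - fps_const y) x = x - y"
      using entire_eval_poly[of "[:- y, 1:]" x] by (simp add: fps_of_poly_root_factor)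
    then show ?thesis unfolding B(2) using B(1) by (simp add: entire_eval_mult)
  qed
  finally have "v (entire_eval v A x - entire_eval v A y) = v (x - y) * v (entire_eval v B x)"
    by (simp add: mult)
  also have "\<dots> \<le> v (x - y) * (gauss_norm r A / r)"
    using v_entire_eval_le[OF B(1) assms(2,3)] gB nonneg by (intro mult_left_mono) auto
  finally show ?thesis by (simp add: mult.commute)
qed

text \<open>A zero is the limit of suitably chosen zeros of the truncations.\<close>

lemma entire_zero_exists:
  assumes A: "entire v A" and r: "r > 0" and dom: "dominant r A n" and n: "n > 0"
  obtains c where "v c \<le> r" "entire_eval v A c = 0"
proof -
  \<comment> \<open>Truncation starts beyond degree \<open>n\<close>, so every \<open>p m\<close>
    retains the dominant monomial and has the dominant index and the Gauss norm of
    \<open>A\<close>.\<close>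
  define p where "p = (\<lambda>m. truncate_fps (Suc n + m) A)"
  define g where "g = (\<lambda>m. gauss_norm r (A - fps_cutoff (Suc n + m) A))"
  have A0: "A \<noteq> 0"
  proof
    assume "A = 0"
    then show False using dom by (auto simp: dominant_def)
  qed
  define G where "G = gauss_norm r A"
  have G: "G > 0" using gauss_norm_pos[OF A r A0] by (simp add: G_def)
  have fp: "fps_of_poly (p m) = fps_cutoff (Suc n + m) A" for m
    by (simp add: p_def)
  have "0 \<le> v (fps_nth A (Suc n)) * r ^ Suc n" using r nonneg by simp
  also have "\<dots> < v (fps_nth A n) * r ^ n" using dom unfolding dominant_def by blast
  finally have pos: "0 < v (fps_nth A n) * r ^ n" .
  have domp: "dominant r (fps_of_poly (p m)) n" for m
    using dom pos unfolding fp dominant_def by (auto simp: less_imp_le)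
  have Gp: "gauss_norm r (fps_of_poly (p m)) = G" for m
    using gauss_norm_eq[OF domp[of m]] gauss_norm_eq[OF dom] unfolding fp G_def by simp
  have p0: "p m \<noteq> 0" for m
    using Gp[of m] G by auto
  have g0: "g \<longlonglongrightarrow> 0"
    using LIMSEQ_ignore_initial_segment[OF gauss_norm_cutoff_tendsto[OF A r], of "Suc n"]
    by (simp add: g_def add.commute)
  have near: "v (entire_eval v A y - poly (p m) y) \<le> g m" if "v y \<le> r" for m y
  proof -
    have "entire_eval v A y - poly (p m) y = entire_eval v (A - fps_cutoff (Suc n + m) A) y"
      using A by (simp add: entire_eval_diff fp flip: entire_eval_poly)
    then show ?thesis
      using v_entire_eval_le[of "A - fps_cutoff (Suc n + m) A" r y] A r that by (simp add: g_def)
  qed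
  \<comment> \<open>Each \<open>c (Suc m)\<close> is a zero of the next truncation near
    \<open>c m\<close>. The distance is controlled by the value of \<open>p (Suc m)\<close> at
    \<open>c m\<close>, which is small because both truncations are close to
    \<open>A\<close>.\<close>
  have "\<exists>c. \<forall>m. (poly (p m) (c m) = 0 \<and> v (c m) \<le> r) \<and>
      (\<forall>\<delta>. 0 < \<delta> \<longrightarrow> \<delta> \<le> r \<longrightarrow> v (poly (p (Suc m)) (c m)) * r ^ n < G * \<delta> ^ n
        \<longrightarrow> v (c m - c (Suc m)) < \<delta>)"
  proof (rule dependent_nat_choice)
    obtain z where "poly (p 0) z = 0" "v z \<le> r"
      by (rule poly_zero_nearby[OF r p0 domp n, of 0 0]) (use r in auto)
    then show "\<exists>x. poly (p 0) x = 0 \<and> v x \<le> r" by blast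
    fix y m assume "poly (p m) y = 0 \<and> v y \<le> r"
    then show "\<exists>z. (poly (p (Suc m)) z = 0 \<and> v z \<le> r) \<and>
      (\<forall>\<delta>. 0 < \<delta> \<longrightarrow> \<delta> \<le> r \<longrightarrow> v (poly (p (Suc m)) y) * r ^ n < G * \<delta> ^ n \<longrightarrow> v (y - z) < \<delta>)"
      using poly_zero_nearby[OF r p0 domp n, of y "Suc m"] unfolding Gp by metis
  qed
  then obtain c where c: "\<And>m. poly (p m) (c m) = 0" "\<And>m. v (c m) \<le> r"
    "\<And>m \<delta>. 0 < \<delta> \<Longrightarrow> \<delta> \<le> r \<Longrightarrow> v (poly (p (Suc m)) (c m)) * r ^ n < G * \<delta> ^ n
        \<Longrightarrow> v (c m - c (Suc m)) < \<delta>" by metis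
  have cg: "v (entire_eval v A (c m)) \<le> g m" for m
    using near[OF c(2)[of m], of m] c(1)[of m] by simp
  have small: "v (poly (p (Suc m)) (c m)) \<le> max (g m) (g (Suc m))" for m
  proof -
    have "v (poly (p (Suc m)) (c m)) =
        v (entire_eval v A (c m) - (entire_eval v A (c m) - poly (p (Suc m)) (c m)))" by simp
    also have "\<dots> \<le> max (v (entire_eval v A (c m)))
        (v (entire_eval v A (c m) - poly (p (Suc m)) (c m)))" by (rule v_diff)
    also have "\<dots> \<le> max (g m) (g (Suc m))"
      using cg[of m] near[OF c(2)[of m], of "Suc m"] by (auto simp: max_def)
    finally show ?thesis .
  qed
  have steps: "(\<lambda>m. v (c (Suc m) - c m)) \<longlonglongrightarrow> 0"
  proof (rule LIMSEQ_I)
    fix e :: real assume e: "e > 0"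
    define \<delta> where "\<delta> = min e r"
    have \<delta>: "0 < \<delta>" "\<delta> \<le> r" "\<delta> \<le> e" using e r by (auto simp: \<delta>_def)
    have "(\<lambda>m. max (g m) (g (Suc m))) \<longlonglongrightarrow> max 0 0"
      by (intro tendsto_max g0 LIMSEQ_Suc)
    then have "\<forall>\<^sub>F m in sequentially. max (g m) (g (Suc m)) < G * \<delta> ^ n / r ^ n"
      by (rule order_tendstoD) (use G \<delta> r in simp)
    then obtain M where M: "\<And>m. m \<ge> M \<Longrightarrow> max (g m) (g (Suc m)) < G * \<delta> ^ n / r ^ n"
      by (auto simp: eventually_sequentially)
    show "\<exists>M. \<forall>m\<ge>M. norm (v (c (Suc m) - c m) - 0) < e"
    proof (intro exI allI impI)
      fix m assume "m \<ge> M"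
      then have "v (poly (p (Suc m)) (c m)) < G * \<delta> ^ n / r ^ n"
        using M[of m] small[of m] by linarith
      then have "v (c m - c (Suc m)) < \<delta>"
        using r by (intro c(3) \<delta>) (simp add: field_simps)
      then show "norm (v (c (Suc m) - c m) - 0) < e"
        using \<delta> nonneg by (simp add: v_diff_commute[of "c (Suc m)"])
    qed
  qed
  \<comment> \<open>Steps tending to 0 are enough for convergence, without any rate.\<close>
  obtain s where s: "v_sums v (\<lambda>m. c (Suc m) - c m) s"
    using v_sums_exists[OF steps] by blast
  define x where "x = c 0 + s"
  have "(\<Sum>k<m. c (Suc k) - c k) - s = c m - x" for m
    by (simp add: sum_lessThan_telescope x_def)
  then have lim: "(\<lambda>m. v (c m - x)) \<longlonglongrightarrow> 0" using s by (simp add: v_sums_def)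
  have vx: "v x \<le> r"
  proof -
    have "\<forall>\<^sub>F m in sequentially. v (c m - x) < r" using lim r by (rule order_tendstoD)
    then obtain m where "v (c m - x) < r" by (auto simp: eventually_sequentially)
    then show ?thesis using v_diff[of "c m" "c m - x"] c(2)[of m] by simp
  qed
  have "v (entire_eval v A x) \<le> G / r * v (c m - x) + g m" for m
  proof -
    have "v (entire_eval v A x) = v ((entire_eval v A x - entire_eval v A (c m)) + entire_eval v A (c m))"
      by simp
    also have "\<dots> \<le> v (entire_eval v A x - entire_eval v A (c m)) + v (entire_eval v A (c m))"
      by (rule v_triangle)
    also have "\<dots> \<le> G / r * v (x - c m) + g m"
      unfolding G_def by (intro add_mono entire_eval_lipschitz A r vx c(2) cg)
    finally show ?thesis by (simp add: v_diff_commute[of x])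
  qed
  moreover have "(\<lambda>m. G / r * v (c m - x) + g m) \<longlonglongrightarrow> G / r * 0 + 0"
    by (intro tendsto_intros lim g0)
  ultimately have "v (entire_eval v A x) \<le> 0" by (intro LIMSEQ_le_const) auto
  then have "entire_eval v A x = 0" using nonneg[of "entire_eval v A x"] eq_0_iff by fastforce
  with vx show thesis by (rule that)
qed

text \<open>The growth of the logarithmic Gauss norm of \<open>X - c\<close> from radius 1 to radius
  \<open>r\<close>. For \<open>r \<ge> 1\<close> it vanishes as soon as \<open>c\<close> lies
  outside the disc of radius \<open>r\<close>.\<close>

definition weight :: "real \<Rightarrow> 'a \<Rightarrow> real" where
  "weight r c = ln (max r (v c)) - ln (max 1 (v c))"

lemma subdegree_taylor_linear:
  "subdegree (taylor_at v z (fps_X - fps_const c)) = (if z = c then 1 else 0)"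
  by (auto simp: taylor_at_diff taylor_at_X intro!: subdegreeI)

text \<open>Induction on the dominant index, that is, on the number of zeros in the disc of radius
  \<open>R\<close>. With index 0 the constant term dominates on all smaller circles as well, and the
  norm is constant. Otherwise one zero is divided out, which lowers the index by one and contributes
  its weight. The sum extends over the fixed disc of radius \<open>R\<close> while \<open>r\<close>
  varies, because the zeros beyond \<open>r\<close> have weight 0.\<close>

lemma jensen_entire_aux:
  assumes "entire v A" "A \<noteq> 0" "R \<ge> 1" "dominant R A n"
  shows "finite {c. v c \<le> R \<and> subdegree (taylor_at v c A) \<noteq> 0} \<and>
    (\<forall>r. 1 \<le> r \<longrightarrow> r \<le> R \<longrightarrow> ln (gauss_norm r A) = ln (gauss_norm 1 A) +
      (\<Sum>c | v c \<le> R \<and> subdegree (taylor_at v c A) \<noteq> 0. real (subdegree (taylor_at v c A)) * weight r c))"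
  using assms
proof (induction n arbitrary: A)
  case 0
  let ?a = "fps_nth A 0"
  have dom: "dominant R A 0" and A: "entire v A" by fact+
  have domr: "dominant r A 0" if r: "1 \<le> r" "r \<le> R" for r
  proof -
    have "v (fps_nth A m) * r ^ m \<le> v (fps_nth A m) * R ^ m" for m
      using r nonneg by (intro mult_left_mono power_mono) auto
    then show ?thesis using dom unfolding dominant_def by (auto intro: order_trans order_le_less_trans)
  qed
  \<comment> \<open>A linear factor with zero in the disc has dominant index 1, and indices
    add.\<close>
  have nz: "entire_eval v A c \<noteq> 0" if "v c \<le> R" for c
  proof
    assume z: "entire_eval v A c = 0"
    obtain B where B: "entire v B" "A = (fps_X - fps_const c) * B"
      using entire_factor_zero[OF A z] .
    then have "B \<noteq> 0" using 0 by auto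
    then obtain m where "dominant R B m" using B 0 dominant_exists[of B R] by auto
    then have "dominant R A (1 + m)"
      unfolding B(2) using dominant_linear[of R c] that 0 \<open>B \<noteq> 0\<close> by (intro dominant_mult) auto
    then show False using dominant_unique[OF dom] by fastforce
  qed
  have e: "{c. v c \<le> R \<and> subdegree (taylor_at v c A) \<noteq> 0} = {}"
    using nz A by (auto simp: entire_eval_eq_taylor)
  have "gauss_norm r A = v ?a" if "1 \<le> r" "r \<le> R" for r
    using gauss_norm_eq[OF domr[OF that]] by simp
  then show ?case unfolding e using 0 by simp
next
  case (Suc n)
  obtain c where c: "v c \<le> R" "entire_eval v A c = 0"
    using entire_zero_exists[OF Suc.prems(1) _ Suc.prems(4)] Suc.prems(3) by auto
  obtain B where B: "entire v B" "A = (fps_X - fps_const c) * B"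
    using entire_factor_zero[OF Suc.prems(1) c(2)] .
  have B0: "B \<noteq> 0" using Suc.prems B by auto
  then obtain m where m: "dominant R B m" using B Suc.prems dominant_exists[of B R] by auto
  then have "dominant R A (1 + m)"
    unfolding B(2) using dominant_linear[of R c] c Suc.prems B0 by (intro dominant_mult) auto
  then have "m = n" using dominant_unique[OF Suc.prems(4)] by fastforce
  let ?S = "\<lambda>A. {c. v c \<le> R \<and> subdegree (taylor_at v c A) \<noteq> 0}"
  let ?d = "\<lambda>A c. real (subdegree (taylor_at v c A))"
  have m': "dominant R B n" using m \<open>m = n\<close> by simp
  note IH = Suc.IH[OF B(1) B0 Suc.prems(3) m', THEN conjunct1]
    Suc.IH[OF B(1) B0 Suc.prems(3) m', THEN conjunct2, rule_format]
  have sub: "subdegree (taylor_at v z A) = (if z = c then 1 else 0) + subdegree (taylor_at v z B)" for z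
    unfolding B(2) using B(1) B0
    by (simp add: taylor_at_mult subdegree_taylor_linear taylor_at_eq_0_iff)
  have S: "?S A = insert c (?S B)" using c by (auto simp: sub)
  have "ln (gauss_norm r A) = ln (gauss_norm 1 A) + (\<Sum>z\<in>?S A. ?d A z * weight r z)"
    if r: "1 \<le> r" "r \<le> R" for r
  proof -
    have gA: "ln (gauss_norm s A) = ln (max s (v c)) + ln (gauss_norm s B)" if "s \<ge> 1" for s
      unfolding B(2) using that B(1) B0 gauss_norm_pos[of B s]
      by (simp add: gauss_norm_mult gauss_norm_linear ln_mult)
    have "(\<Sum>z\<in>?S A. ?d A z * weight r z) =
        (\<Sum>z\<in>?S A. (if z = c then weight r z else 0) + ?d B z * weight r z)"
      by (intro sum.cong refl) (auto simp: sub algebra_simps)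
    also have "\<dots> = (\<Sum>z\<in>?S A. if z = c then weight r z else 0) + (\<Sum>z\<in>?S A. ?d B z * weight r z)"
      by (rule sum.distrib)
    also have "(\<Sum>z\<in>?S A. if z = c then weight r z else 0) = weight r c"
      using IH(1) unfolding S by (subst sum.delta) auto
    also have "(\<Sum>z\<in>?S A. ?d B z * weight r z) = (\<Sum>z\<in>?S B. ?d B z * weight r z)"
      using IH(1) c unfolding S by (intro sum.mono_neutral_right) auto
    finally show ?thesis
      using IH(2)[OF r] gA[OF r(1)] gA[of 1] by (simp add: weight_def)
  qed
  moreover have "finite (?S A)" unfolding S using IH(1) by simp
  ultimately show ?case by blast
qed

lemma jensen_entire:
  assumes "entire v A" "A \<noteq> 0" "r \<ge> 1"
  shows "finite {c. v c \<le> r \<and> subdegree (taylor_at v c A) \<noteq> 0}"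
    and "ln (gauss_norm r A) = ln (gauss_norm 1 A) +
      (\<Sum>c | v c \<le> r \<and> subdegree (taylor_at v c A) \<noteq> 0. real (subdegree (taylor_at v c A)) * weight r c)"
proof -
  obtain n where "dominant r A n" using dominant_exists[of A r] assms by auto
  note J = jensen_entire_aux[OF assms this]
  show "finite {c. v c \<le> r \<and> subdegree (taylor_at v c A) \<noteq> 0}"
    by (rule J[THEN conjunct1])
  show "ln (gauss_norm r A) = ln (gauss_norm 1 A) +
      (\<Sum>c | v c \<le> r \<and> subdegree (taylor_at v c A) \<noteq> 0. real (subdegree (taylor_at v c A)) * weight r c)"
    by (rule J[THEN conjunct2, rule_format, OF assms(3) order_refl])
qed

subsection \<open>Meromorphic functions and their orders\<close>

lemma meromorphicE:
  assumes "h \<in> \<M>"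
  obtains A B where "entire v A" "entire v B" "B \<noteq> 0" "h = fps_to_fls A / fps_to_fls B"
  using assms unfolding meromorphic_def by blast

lemma meromorphicI:
  "entire v A \<Longrightarrow> entire v B \<Longrightarrow> B \<noteq> 0 \<Longrightarrow> fps_to_fls A / fps_to_fls B \<in> \<M>"
  unfolding meromorphic_def by blast

lemma quot_add:
  assumes "B \<noteq> 0" "D \<noteq> 0"
  shows "fps_to_fls A / fps_to_fls B + fps_to_fls C / fps_to_fls D =
    fps_to_fls (A * D + C * B) / fps_to_fls (B * D :: 'a fps)"
  using assms by (simp add: add_frac_eq fls_times_fps_to_fls)

lemma quot_mult:
  "fps_to_fls A / fps_to_fls B * (fps_to_fls C / fps_to_fls D) =
    fps_to_fls (A * C) / fps_to_fls (B * D :: 'a fps)"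
  by (simp add: fls_times_fps_to_fls)

lemma fls_const_quot: "fls_const k = fps_to_fls (fps_const k) / fps_to_fls (1 :: 'a fps)"
proof -
  have "fps_to_fls (fps_const k) = fls_const k" by (intro fls_eqI) auto
  then show ?thesis by simp
qed

lemma fls_deriv_quot:
  assumes "B \<noteq> 0"
  shows "fls_deriv (fps_to_fls A / fps_to_fls B) =
    fps_to_fls (fps_deriv A * B - A * fps_deriv B) / fps_to_fls (B * B :: 'a fps)"
proof -
  let ?h = "fps_to_fls A / fps_to_fls B" and ?b = "fps_to_fls B"
  have b: "?b \<noteq> 0" using assms by simp
  have "fps_to_fls A = ?h * ?b" using b by simp
  then have "fps_to_fls (fps_deriv A) = fls_deriv ?h * ?b + ?h * fps_to_fls (fps_deriv B)"
    using fls_deriv_mult[of ?h ?b] by (simp add: fls_deriv_fps_to_fls add.commute mult.commute)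
  then have "fls_deriv ?h * ?b * ?b = fps_to_fls (fps_deriv A) * ?b - ?h * ?b * fps_to_fls (fps_deriv B)"
    by (simp add: algebra_simps)
  also have "?h * ?b = fps_to_fls A" using b by simp
  finally show ?thesis
    using b by (simp add: fls_times_fps_to_fls field_simps)
qed

lemma meromorphic_const [simp]: "fls_const k \<in> \<M>"
  unfolding fls_const_quot by (intro meromorphicI) auto

lemma meromorphic_0 [simp]: "0 \<in> \<M>"
  using meromorphic_const[of 0] by simp

lemma meromorphic_1 [simp]: "1 \<in> \<M>"
  using meromorphic_const[of 1] by simp

lemma meromorphic_add [simp]:
  assumes "h \<in> \<M>" "k \<in> \<M>"
  shows "h + k \<in> \<M>"
  using assms by (elim meromorphicE) (simp add: quot_add meromorphicI del: fps_to_fls_plus)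

lemma meromorphic_mult [simp]:
  assumes "h \<in> \<M>" "k \<in> \<M>"
  shows "h * k \<in> \<M>"
  using assms by (elim meromorphicE) (simp only: quot_mult, intro meromorphicI, auto)

lemma meromorphic_uminus [simp]:
  assumes "h \<in> \<M>"
  shows "- h \<in> \<M>"
proof -
  show ?thesis
    using meromorphic_mult[OF meromorphic_const[of "- 1"] assms] by simp
qed

lemma meromorphic_diff [simp]:
  assumes "h \<in> \<M>" "k \<in> \<M>"
  shows "h - k \<in> \<M>"
  using meromorphic_add[of h "- k"] assms by simp

lemma meromorphic_inverse [simp]:
  assumes "h \<in> \<M>"
  shows "inverse h \<in> \<M>"
proof (cases "h = 0")
  case False
  then show ?thesis using assms by (elim meromorphicE) (auto intro: meromorphicI)
qed simp

lemma meromorphic_divide [simp]: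
  assumes "h \<in> \<M>" "k \<in> \<M>"
  shows "h / k \<in> \<M>"
  using assms by (simp add: divide_inverse)

lemma meromorphic_power [simp]:
  assumes "h \<in> \<M>"
  shows "h ^ n \<in> \<M>"
  using assms by (induction n) auto

lemma meromorphic_prod [simp]:
  assumes "\<And>i. i \<in> I \<Longrightarrow> h i \<in> \<M>"
  shows "(\<Prod>i\<in>I. h i) \<in> \<M>"
  using assms by (induction I rule: infinite_finite_induct) auto

lemma meromorphic_deriv [simp]:
  assumes "h \<in> \<M>"
  shows "fls_deriv h \<in> \<M>"
  using assms by (elim meromorphicE) (simp add: fls_deriv_quot meromorphicI del: fps_to_fls_minus)

text \<open>Two representations of one quotient agree after cross multiplication, which the
  multiplicative and injective Taylor map preserves. This settles the definite description in
  \<open>translate\<close>.\<close>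

lemma translate_quot:
  assumes "entire v A" "entire v B" "B \<noteq> 0"
  shows "translate v c (fps_to_fls A / fps_to_fls B) =
    fps_to_fls (taylor_at v c A) / fps_to_fls (taylor_at v c B)"
  unfolding translate_def
proof (rule the_equality)
  show "\<exists>F G. entire v F \<and> entire v G \<and> G \<noteq> 0 \<and>
    fps_to_fls A / fps_to_fls B = fps_to_fls F / fps_to_fls G \<and>
    fps_to_fls (taylor_at v c A) / fps_to_fls (taylor_at v c B) =
    fps_to_fls (taylor_at v c F) / fps_to_fls (taylor_at v c G)"
    using assms by blast
next
  fix k assume "\<exists>F G. entire v F \<and> entire v G \<and> G \<noteq> 0 \<and>
    fps_to_fls A / fps_to_fls B = fps_to_fls F / fps_to_fls G \<and>
    k = fps_to_fls (taylor_at v c F) / fps_to_fls (taylor_at v c G)"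
  then obtain F G where FG: "entire v F" "entire v G" "G \<noteq> 0"
    "fps_to_fls A / fps_to_fls B = fps_to_fls F / fps_to_fls G"
    "k = fps_to_fls (taylor_at v c F) / fps_to_fls (taylor_at v c G)" by blast
  have "fps_to_fls (A * G) = fps_to_fls (F * B)"
    using FG assms by (simp add: fls_times_fps_to_fls frac_eq_eq)
  then have "A * G = F * B" by simp
  then have "taylor_at v c A * taylor_at v c G = taylor_at v c F * taylor_at v c B"
    using FG assms by (simp flip: taylor_at_mult)
  then have "fps_to_fls (taylor_at v c A) * fps_to_fls (taylor_at v c G) =
    fps_to_fls (taylor_at v c F) * fps_to_fls (taylor_at v c B)"
    by (simp flip: fls_times_fps_to_fls)
  then show "k = fps_to_fls (taylor_at v c A) / fps_to_fls (taylor_at v c B)"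
    using FG assms by (simp add: frac_eq_eq taylor_at_eq_0_iff)
qed

lemma translate_add:
  assumes "h \<in> \<M>" "k \<in> \<M>"
  shows "translate v c (h + k) = translate v c h + translate v c k"
proof -
  obtain A B where h: "entire v A" "entire v B" "B \<noteq> 0" "h = fps_to_fls A / fps_to_fls B"
    using assms(1) by (rule meromorphicE)
  obtain C D where k: "entire v C" "entire v D" "D \<noteq> 0" "k = fps_to_fls C / fps_to_fls D"
    using assms(2) by (rule meromorphicE)
  have "h + k = fps_to_fls (A * D + C * B) / fps_to_fls (B * D)"
    unfolding h k using h k by (intro quot_add)
  then have "translate v c (h + k) = fps_to_fls (taylor_at v c (A * D + C * B)) / fps_to_fls (taylor_at v c (B * D))"
    using h k by (simp only: translate_quot entire_add entire_mult mult_eq_0_iff simp_thms)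
  also have "\<dots> = translate v c h + translate v c k"
    unfolding h(4) k(4) using h(1-3) k(1-3)
    by (simp add: translate_quot quot_add taylor_at_add taylor_at_mult taylor_at_eq_0_iff del: fps_to_fls_plus)
  finally show ?thesis .
qed

lemma translate_mult:
  assumes "h \<in> \<M>" "k \<in> \<M>"
  shows "translate v c (h * k) = translate v c h * translate v c k"
proof -
  obtain A B where h: "entire v A" "entire v B" "B \<noteq> 0" "h = fps_to_fls A / fps_to_fls B"
    using assms(1) by (rule meromorphicE)
  obtain C D where k: "entire v C" "entire v D" "D \<noteq> 0" "k = fps_to_fls C / fps_to_fls D"
    using assms(2) by (rule meromorphicE)
  have "translate v c (h * k) = fps_to_fls (taylor_at v c (A * C)) / fps_to_fls (taylor_at v c (B * D))"
    unfolding h(4) k(4) quot_mult using h(1-3) k(1-3)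
    by (intro translate_quot) auto
  also have "\<dots> = translate v c h * translate v c k"
    unfolding h(4) k(4) using h(1-3) k(1-3)
    by (simp add: translate_quot taylor_at_mult fls_times_fps_to_fls)
  finally show ?thesis .
qed

lemma translate_const [simp]: "translate v c (fls_const k) = fls_const k"
  unfolding fls_const_quot by (subst translate_quot) auto

lemma translate_0 [simp]: "translate v c 0 = 0"
  using translate_const[of c 0] by simp

lemma translate_1 [simp]: "translate v c 1 = 1"
  using translate_const[of c 1] by simp

lemma translate_deriv:
  assumes "h \<in> \<M>"
  shows "translate v c (fls_deriv h) = fls_deriv (translate v c h)"
proof -
  obtain A B where h: "entire v A" "entire v B" "B \<noteq> 0" "h = fps_to_fls A / fps_to_fls B"
    using assms(1) by (rule meromorphicE)
  have "translate v c (fls_deriv h) =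
      fps_to_fls (taylor_at v c (fps_deriv A * B - A * fps_deriv B)) / fps_to_fls (taylor_at v c (B * B))"
    unfolding h(4) fls_deriv_quot[OF h(3)] using h(1-3) by (intro translate_quot) auto
  also have "\<dots> = fls_deriv (translate v c h)"
    unfolding h(4) using h(1-3)
    by (simp add: translate_quot fls_deriv_quot taylor_at_eq_0_iff taylor_at_mult taylor_at_diff
        taylor_at_deriv)
  finally show ?thesis .
qed

lemma translate_translate:
  assumes "h \<in> \<M>"
  shows "translate v d (translate v c h) = translate v (d + c) h"
  using assms by (elim meromorphicE) (simp add: translate_quot taylor_at_taylor_at taylor_at_eq_0_iff)

lemma translate_0_left [simp]:
  assumes "h \<in> \<M>"
  shows "translate v 0 h = h"
  using assms by (elim meromorphicE) (simp add: translate_quot)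

lemma translate_eq_0_iff [simp]:
  assumes "h \<in> \<M>"
  shows "translate v c h = 0 \<longleftrightarrow> h = 0"
  using assms by (elim meromorphicE) (simp add: translate_quot taylor_at_eq_0_iff)

lemma translate_inverse:
  assumes "h \<in> \<M>"
  shows "translate v c (inverse h) = inverse (translate v c h)"
proof (cases "h = 0")
  case False
  then have "translate v c h * translate v c (inverse h) = 1"
    using assms by (simp flip: translate_mult)
  then show ?thesis by (metis inverse_unique)
qed simp

section \<open>Orders of meromorphic functions at a point\<close>

abbreviation ord :: "'a \<Rightarrow> 'a fls \<Rightarrow> int" where "ord \<equiv> ord_at v"

lemma ord_0 [simp]: "ord c 0 = 0"
  by (simp add: ord_at_def)

lemma ord_const [simp]: "ord c (fls_const k) = 0"
  by (simp add: ord_at_def)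

lemma ord_1 [simp]: "ord c 1 = 0"
  by (simp add: ord_at_def)

lemma ord_mult:
  assumes "h \<in> \<M>" "k \<in> \<M>" "h \<noteq> 0" "k \<noteq> 0"
  shows "ord c (h * k) = ord c h + ord c k"
  using assms by (simp add: ord_at_def translate_mult)

lemma ord_inverse:
  assumes "h \<in> \<M>"
  shows "ord c (inverse h) = - ord c h"
  using assms by (simp add: ord_at_def translate_inverse)

lemma ord_divide:
  assumes "h \<in> \<M>" "k \<in> \<M>" "h \<noteq> 0" "k \<noteq> 0"
  shows "ord c (h / k) = ord c h - ord c k"
  using assms by (simp add: divide_inverse ord_mult ord_inverse)

lemma ord_uminus [simp]:
  assumes "h \<in> \<M>"
  shows "ord c (- h) = ord c h"
proof (cases "h = 0")
  case False
  have "ord c (- 1) = 0" using ord_const[of c "- 1"] by simp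
  then show ?thesis
    using assms False ord_mult[of "fls_const (- 1)" h c] by simp
qed simp

lemma ord_power:
  assumes "h \<in> \<M>" "h \<noteq> 0"
  shows "ord c (h ^ n) = int n * ord c h"
  using assms by (induction n) (auto simp: ord_mult algebra_simps)

lemma ord_prod:
  assumes "\<And>i. i \<in> I \<Longrightarrow> h i \<in> \<M>" "\<And>i. i \<in> I \<Longrightarrow> h i \<noteq> 0"
  shows "ord c (\<Prod>i\<in>I. h i) = (\<Sum>i\<in>I. ord c (h i))"
  using assms by (induction I rule: infinite_finite_induct) (auto simp: ord_mult)

text \<open>The zero function has \<open>ord\<close> 0 by default, whereas valuation estimates need
  it to have infinite order. With this predicate sums that cancel completely require no case
  distinction.\<close>

definition ord_ge :: "'a \<Rightarrow> int \<Rightarrow> 'a fls \<Rightarrow> bool" where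
  "ord_ge c k h \<longleftrightarrow> h = 0 \<or> k \<le> ord c h"

lemma ord_ge_mono: "ord_ge c k h \<Longrightarrow> j \<le> k \<Longrightarrow> ord_ge c j h"
  by (auto simp: ord_ge_def)

lemma ord_ge_add:
  assumes "h \<in> \<M>" "k \<in> \<M>" "ord_ge c m h" "ord_ge c m k"
  shows "ord_ge c m (h + k)"
proof (cases "h = 0 \<or> k = 0 \<or> h + k = 0")
  case False
  then have "translate v c h + translate v c k \<noteq> 0"
    using assms by (simp flip: translate_add)
  then show ?thesis
    using False assms fls_plus_subdegree[of "translate v c h" "translate v c k"]
    by (auto simp: ord_ge_def ord_at_def translate_add)
qed (use assms in \<open>auto simp: ord_ge_def\<close>)

lemma ord_ge_uminus:
  assumes "h \<in> \<M>" "ord_ge c m h"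
  shows "ord_ge c m (- h)"
  using assms by (auto simp: ord_ge_def)

lemma ord_ge_diff:
  assumes "h \<in> \<M>" "k \<in> \<M>" "ord_ge c m h" "ord_ge c m k"
  shows "ord_ge c m (h - k)"
  using ord_ge_add[of h "- k" c m] assms by (auto simp: ord_ge_uminus)

lemma ord_ge_mult:
  assumes "h \<in> \<M>" "k \<in> \<M>" "ord_ge c i h" "ord_ge c j k"
  shows "ord_ge c (i + j) (h * k)"
  using assms by (cases "h = 0 \<or> k = 0") (auto simp: ord_ge_def ord_mult)

text \<open>The leading coefficient gets multiplied by the order, a nonzero integer, and
  characteristic 0 keeps it from vanishing.\<close>

lemma ord_deriv:
  assumes "h \<in> \<M>" "ord c h \<noteq> 0"
  shows "ord c (fls_deriv h) = ord c h - 1" "fls_deriv h \<noteq> 0"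
proof -
  show "ord c (fls_deriv h) = ord c h - 1"
    using assms by (simp add: ord_at_def translate_deriv fls_subdegree_deriv)
  show "fls_deriv h \<noteq> 0"
  proof
    assume "fls_deriv h = 0"
    then have "h = fls_const (fls_nth h 0)" by (simp add: fls_deriv_eq_0_iff)
    then have "ord c h = 0" by (metis ord_const)
    then show False using assms by simp
  qed
qed

lemma ord_deriv_nonneg:
  assumes "h \<in> \<M>" "ord c h \<ge> 0"
  shows "ord c (fls_deriv h) \<ge> 0"
proof (cases "ord c h = 0")
  case True
  then show ?thesis
    using assms by (simp add: ord_at_def translate_deriv fls_deriv_subdegree0)
next
  case False
  then show ?thesis using assms ord_deriv(1)[of h c] by simp
qed

lemma ord_ge_deriv:
  assumes "h \<in> \<M>" "ord_ge c m h" "m \<ge> 0"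
  shows "ord_ge c (max 0 (m - 1)) (fls_deriv h)"
proof (cases "h = 0 \<or> ord c h = 0")
  case True
  then show ?thesis using assms ord_deriv_nonneg[of h c] by (auto simp: ord_ge_def)
next
  case False
  then show ?thesis using assms ord_deriv(1)[of h c] by (auto simp: ord_ge_def)
qed

subsection \<open>Gauss norms of meromorphic functions\<close>

text \<open>The extension of the Gauss norm to fractions; it is well defined because the Gauss norm
  is multiplicative.\<close>

definition mero_norm :: "real \<Rightarrow> 'a fls \<Rightarrow> real" where
  "mero_norm r h = (THE x. \<exists>A B. entire v A \<and> entire v B \<and> B \<noteq> 0 \<and>
    h = fps_to_fls A / fps_to_fls B \<and> x = gauss_norm r A / gauss_norm r B)"

lemma mero_norm_quot:
  assumes "entire v A" "entire v B" "B \<noteq> 0" "r > 0"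
  shows "mero_norm r (fps_to_fls A / fps_to_fls B) = gauss_norm r A / gauss_norm r B"
  unfolding mero_norm_def
proof (rule the_equality)
  show "\<exists>F G. entire v F \<and> entire v G \<and> G \<noteq> 0 \<and>
    fps_to_fls A / fps_to_fls B = fps_to_fls F / fps_to_fls G \<and>
    gauss_norm r A / gauss_norm r B = gauss_norm r F / gauss_norm r G"
    using assms by blast
next
  fix k assume "\<exists>F G. entire v F \<and> entire v G \<and> G \<noteq> 0 \<and>
    fps_to_fls A / fps_to_fls B = fps_to_fls F / fps_to_fls G \<and>
    k = gauss_norm r F / gauss_norm r G"
  then obtain F G where FG: "entire v F" "entire v G" "G \<noteq> 0"
    "fps_to_fls A / fps_to_fls B = fps_to_fls F / fps_to_fls G"
    "k = gauss_norm r F / gauss_norm r G" by blast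
  have "fps_to_fls (A * G) = fps_to_fls (F * B)"
    using FG assms by (simp add: fls_times_fps_to_fls frac_eq_eq)
  then have "A * G = F * B" by simp
  then have "gauss_norm r A * gauss_norm r G = gauss_norm r F * gauss_norm r B"
    using FG assms by (simp flip: gauss_norm_mult)
  then show "k = gauss_norm r A / gauss_norm r B"
    using FG assms by (simp add: frac_eq_eq gauss_norm_eq_0_iff)
qed

lemma mero_norm_const [simp]: "r > 0 \<Longrightarrow> mero_norm r (fls_const k) = v k"
  unfolding fls_const_quot using gauss_norm_const[of r 1]
  by (subst mero_norm_quot) auto

lemma mero_norm_0 [simp]: "r > 0 \<Longrightarrow> mero_norm r 0 = 0"
  using mero_norm_const[of r 0] by simp

lemma mero_norm_mult:
  assumes "h \<in> \<M>" "k \<in> \<M>" "r > 0"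
  shows "mero_norm r (h * k) = mero_norm r h * mero_norm r k"
proof -
  obtain A B where h: "entire v A" "entire v B" "B \<noteq> 0" "h = fps_to_fls A / fps_to_fls B"
    using assms(1) by (rule meromorphicE)
  obtain C D where k: "entire v C" "entire v D" "D \<noteq> 0" "k = fps_to_fls C / fps_to_fls D"
    using assms(2) by (rule meromorphicE)
  have "mero_norm r (h * k) = gauss_norm r (A * C) / gauss_norm r (B * D)"
    unfolding h(4) k(4) quot_mult using h(1-3) k(1-3) assms by (intro mero_norm_quot) auto
  also have "\<dots> = mero_norm r h * mero_norm r k"
    unfolding h(4) k(4) using h(1-3) k(1-3) assms
    by (simp add: mero_norm_quot gauss_norm_mult)
  finally show ?thesis .
qed

lemma mero_norm_pos:
  assumes "h \<in> \<M>" "h \<noteq> 0" "r > 0"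
  shows "mero_norm r h > 0"
  using assms by (elim meromorphicE) (auto simp: mero_norm_quot gauss_norm_pos)

lemma mero_norm_nonneg:
  assumes "h \<in> \<M>" "r > 0"
  shows "mero_norm r h \<ge> 0"
  using mero_norm_pos[of h r] assms by (cases "h = 0") auto

lemma mero_norm_add:
  assumes "h \<in> \<M>" "k \<in> \<M>" "r > 0"
  shows "mero_norm r (h + k) \<le> max (mero_norm r h) (mero_norm r k)"
proof -
  obtain A B where h: "entire v A" "entire v B" "B \<noteq> 0" "h = fps_to_fls A / fps_to_fls B"
    using assms(1) by (rule meromorphicE)
  obtain C D where k: "entire v C" "entire v D" "D \<noteq> 0" "k = fps_to_fls C / fps_to_fls D"
    using assms(2) by (rule meromorphicE)
  have B: "gauss_norm r B > 0" and D: "gauss_norm r D > 0"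
    using h k assms by (auto intro: gauss_norm_pos)
  have "h + k = fps_to_fls (A * D + C * B) / fps_to_fls (B * D)"
    unfolding h k using h k by (intro quot_add)
  then have "mero_norm r (h + k) = gauss_norm r (A * D + C * B) / gauss_norm r (B * D)"
    using h k assms by (simp only: mero_norm_quot entire_add entire_mult mult_eq_0_iff simp_thms)
  also have "\<dots> \<le> max (gauss_norm r (A * D)) (gauss_norm r (C * B)) / gauss_norm r (B * D)"
    using h k assms by (intro divide_right_mono gauss_norm_add gauss_norm_nonneg) auto
  also have "\<dots> = max (mero_norm r h) (mero_norm r k)"
    unfolding h(4) k(4) using h(1-3) k(1-3) assms B D
    by (simp add: mero_norm_quot gauss_norm_mult max_divide_distrib_right)
  finally show ?thesis .
qed

lemma mero_norm_uminus [simp]: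
  assumes "h \<in> \<M>" "r > 0"
  shows "mero_norm r (- h) = mero_norm r h"
proof -
  have "mero_norm r (- 1) = 1"
    using mero_norm_const[of r "- 1"] assms by (simp add: v_minus)
  then show ?thesis
    using assms mero_norm_mult[of "fls_const (- 1)" h r] by simp
qed

lemma mero_norm_diff:
  assumes "h \<in> \<M>" "k \<in> \<M>" "r > 0"
  shows "mero_norm r (h - k) \<le> max (mero_norm r h) (mero_norm r k)"
  using mero_norm_add[of h "- k" r] assms by simp

text \<open>Each product in the numerator of the quotient rule contains one derivative and gains a
  factor \<open>1 / r\<close>; the ultrametric inequality takes their maximum.\<close>

lemma mero_norm_deriv:
  assumes "h \<in> \<M>" "r > 0"
  shows "mero_norm r (fls_deriv h) \<le> mero_norm r h / r"
proof -
  obtain A B where h: "entire v A" "entire v B" "B \<noteq> 0" "h = fps_to_fls A / fps_to_fls B"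
    using assms(1) by (rule meromorphicE)
  have B: "gauss_norm r B > 0" and A: "gauss_norm r A \<ge> 0"
    using h assms by (auto intro: gauss_norm_pos gauss_norm_nonneg)
  have 1: "gauss_norm r (fps_deriv A * B) \<le> gauss_norm r A * gauss_norm r B / r"
    using h assms B gauss_norm_deriv[of A r] mult_right_mono[of "gauss_norm r (fps_deriv A)" _ "gauss_norm r B"]
    by (fastforce simp: gauss_norm_mult)
  have 2: "gauss_norm r (A * fps_deriv B) \<le> gauss_norm r A * gauss_norm r B / r"
    using h assms A gauss_norm_deriv[of B r] mult_left_mono[of "gauss_norm r (fps_deriv B)" _ "gauss_norm r A"]
    by (fastforce simp: gauss_norm_mult)
  have "mero_norm r (fls_deriv h) =
      gauss_norm r (fps_deriv A * B - A * fps_deriv B) / gauss_norm r (B * B)"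
    unfolding h(4) fls_deriv_quot[OF h(3)] using h(1-3) assms by (intro mero_norm_quot) auto
  also have "\<dots> \<le> (gauss_norm r A * gauss_norm r B / r) / gauss_norm r (B * B)"
  proof (intro divide_right_mono)
    have "gauss_norm r (fps_deriv A * B + - (A * fps_deriv B)) \<le> gauss_norm r A * gauss_norm r B / r"
      using 1 2 h assms gauss_norm_add[of "fps_deriv A * B" "- (A * fps_deriv B)" r] by simp
    then show "gauss_norm r (fps_deriv A * B - A * fps_deriv B) \<le> gauss_norm r A * gauss_norm r B / r"
      by simp
  qed (use h assms in \<open>auto intro!: gauss_norm_nonneg\<close>)
  also have "\<dots> = mero_norm r h / r"
    unfolding h(4) using h(1-3) B assms by (simp add: mero_norm_quot gauss_norm_mult)
  finally show ?thesis .
qed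

definition lnorm :: "real \<Rightarrow> 'a fls \<Rightarrow> real" where
  "lnorm r h = ln (mero_norm r h)"

lemma lnorm_mult:
  assumes "h \<in> \<M>" "k \<in> \<M>" "h \<noteq> 0" "k \<noteq> 0" "r > 0"
  shows "lnorm r (h * k) = lnorm r h + lnorm r k"
proof -
  have "mero_norm r h > 0" "mero_norm r k > 0" using assms by (auto intro: mero_norm_pos)
  then show ?thesis using assms by (simp add: lnorm_def mero_norm_mult ln_mult)
qed

lemma lnorm_const: "r > 0 \<Longrightarrow> lnorm r (fls_const k) = ln (v k)"
  by (simp add: lnorm_def)

lemma lnorm_1 [simp]: "r > 0 \<Longrightarrow> lnorm r 1 = 0"
  using lnorm_const[of r 1] by simp

lemma lnorm_inverse:
  assumes "h \<in> \<M>" "h \<noteq> 0" "r > 0"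
  shows "lnorm r (inverse h) = - lnorm r h"
  using lnorm_mult[of h "inverse h" r] assms by simp

lemma lnorm_divide:
  assumes "h \<in> \<M>" "k \<in> \<M>" "h \<noteq> 0" "k \<noteq> 0" "r > 0"
  shows "lnorm r (h / k) = lnorm r h - lnorm r k"
  using assms by (simp add: divide_inverse lnorm_mult lnorm_inverse)

lemma lnorm_uminus [simp]:
  assumes "h \<in> \<M>" "r > 0"
  shows "lnorm r (- h) = lnorm r h"
  using assms by (simp add: lnorm_def)

lemma lnorm_power:
  assumes "h \<in> \<M>" "h \<noteq> 0" "r > 0"
  shows "lnorm r (h ^ n) = real n * lnorm r h"
  using assms by (induction n) (auto simp: lnorm_mult algebra_simps)

lemma lnorm_prod:
  assumes "\<And>i. i \<in> I \<Longrightarrow> h i \<in> \<M>" "\<And>i. i \<in> I \<Longrightarrow> h i \<noteq> 0" "r > 0"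
  shows "lnorm r (\<Prod>i\<in>I. h i) = (\<Sum>i\<in>I. lnorm r (h i))"
  using assms by (induction I rule: infinite_finite_induct) (auto simp: lnorm_mult)

lemma mero_norm_le_exp:
  assumes "h \<in> \<M>" "r > 0" "h \<noteq> 0 \<Longrightarrow> lnorm r h \<le> x"
  shows "mero_norm r h \<le> exp x"
proof (cases "h = 0")
  case False
  then have "mero_norm r h > 0" using assms by (intro mero_norm_pos)
  then show ?thesis using assms(3)[OF False] by (metis lnorm_def ln_le_cancel_iff ln_exp exp_gt_zero)
qed (use assms in simp)

lemma lnorm_le:
  assumes "h \<in> \<M>" "h \<noteq> 0" "r > 0" "mero_norm r h \<le> exp x"
  shows "lnorm r h \<le> x"
proof -
  have "mero_norm r h > 0" using assms by (intro mero_norm_pos)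
  then show ?thesis using assms(4) by (metis lnorm_def ln_le_cancel_iff ln_exp exp_gt_zero)
qed

text \<open>The logarithm of the norm of 0 is a mere default value, so a bound is demanded only of
  the summands that do not vanish.\<close>

lemma lnorm_add:
  assumes "h \<in> \<M>" "k \<in> \<M>" "h + k \<noteq> 0" "r > 0"
    and "h \<noteq> 0 \<Longrightarrow> lnorm r h \<le> x" "k \<noteq> 0 \<Longrightarrow> lnorm r k \<le> x"
  shows "lnorm r (h + k) \<le> x"
proof (rule lnorm_le)
  show "mero_norm r (h + k) \<le> exp x"
    using mero_norm_add[of h k r] mero_norm_le_exp[of h r x] mero_norm_le_exp[of k r x] assms
    by (auto simp: max_def split: if_splits)
qed (use assms in auto)

lemma lnorm_diff:
  assumes "h \<in> \<M>" "k \<in> \<M>" "h - k \<noteq> 0" "r > 0"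
    and "h \<noteq> 0 \<Longrightarrow> lnorm r h \<le> x" "k \<noteq> 0 \<Longrightarrow> lnorm r k \<le> x"
  shows "lnorm r (h - k) \<le> x"
  using lnorm_add[of h "- k" r x] assms by simp

lemma lnorm_deriv:
  assumes "h \<in> \<M>" "fls_deriv h \<noteq> 0" "r > 0"
  shows "lnorm r (fls_deriv h) \<le> lnorm r h - ln r"
proof -
  have "h \<noteq> 0" using assms by auto
  then have h: "mero_norm r h > 0" "mero_norm r (fls_deriv h) > 0" using assms
    by (auto intro: mero_norm_pos)
  then have "ln (mero_norm r (fls_deriv h)) \<le> ln (mero_norm r h / r)"
    using mero_norm_deriv[of h r] assms by (subst ln_le_cancel_iff) auto
  then show ?thesis using h assms by (simp add: lnorm_def ln_div)
qed

subsection \<open>Counting functions\<close>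

definition locally_finite :: "('a \<Rightarrow> int) \<Rightarrow> bool" where
  "locally_finite D \<longleftrightarrow> (\<forall>r. finite {c. v c \<le> r \<and> D c \<noteq> 0})"

text \<open>Measuring \<open>r\<close> against \<open>max 1 (v c)\<close> instead of \<open>v c\<close> changes the usual counting function
  by a constant and gives the origin no special role.\<close>

definition counting :: "real \<Rightarrow> ('a \<Rightarrow> int) \<Rightarrow> real" where
  "counting r D = (\<Sum>c | v c \<le> r \<and> D c \<noteq> 0. of_int (D c) * weight r c)"

lemma weight_nonneg: "r \<ge> 1 \<Longrightarrow> weight r c \<ge> 0"
  unfolding weight_def using ln_le_cancel_iff[of "max 1 (v c)" "max r (v c)"] by simp

lemma weight_eq_0: "r \<ge> 1 \<Longrightarrow> v c > r \<Longrightarrow> weight r c = 0"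
  by (simp add: weight_def)

text \<open>Points outside the disc have weight 0, so any larger finite set may serve as the range
  of summation; this lets several divisors be summed over a common support.\<close>

lemma counting_superset:
  assumes "r \<ge> 1" "finite S" "{c. v c \<le> r \<and> D c \<noteq> 0} \<subseteq> S"
  shows "counting r D = (\<Sum>c\<in>S. of_int (D c) * weight r c)"
  unfolding counting_def
proof (intro sum.mono_neutral_left ballI)
  fix c assume "c \<in> S - {c. v c \<le> r \<and> D c \<noteq> 0}"
  then show "of_int (D c) * weight r c = 0"
    using weight_eq_0[of r c] assms(1) by (cases "v c > r") auto
qed (use assms in auto)

lemma locally_finite_subset:
  assumes "locally_finite D" "\<And>c. D c = 0 \<Longrightarrow> E c = 0"
  shows "locally_finite E"
  unfolding locally_finite_def
proof
  fix r
  show "finite {c. v c \<le> r \<and> E c \<noteq> 0}"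
    by (rule finite_subset[of _ "{c. v c \<le> r \<and> D c \<noteq> 0}"])
      (use assms in \<open>auto simp: locally_finite_def\<close>)
qed

lemma locally_finite_subset2:
  assumes "locally_finite D" "locally_finite D'" "\<And>c. D c = 0 \<Longrightarrow> D' c = 0 \<Longrightarrow> E c = 0"
  shows "locally_finite E"
  unfolding locally_finite_def
proof
  fix r
  have "finite ({c. v c \<le> r \<and> D c \<noteq> 0} \<union> {c. v c \<le> r \<and> D' c \<noteq> 0})"
    using assms by (simp add: locally_finite_def)
  then show "finite {c. v c \<le> r \<and> E c \<noteq> 0}"
    by (rule finite_subset[rotated]) (use assms(3) in auto)
qed

lemma locally_finite_0 [simp]: "locally_finite (\<lambda>c. 0)"
  by (simp add: locally_finite_def)

lemma locally_finite_add [simp]: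
  "locally_finite D \<Longrightarrow> locally_finite E \<Longrightarrow> locally_finite (\<lambda>c. D c + E c)"
  by (rule locally_finite_subset2[of D E]) auto

lemma locally_finite_diff [simp]:
  "locally_finite D \<Longrightarrow> locally_finite E \<Longrightarrow> locally_finite (\<lambda>c. D c - E c)"
  by (rule locally_finite_subset2[of D E]) auto

lemma locally_finite_min [simp]:
  "locally_finite D \<Longrightarrow> locally_finite E \<Longrightarrow> locally_finite (\<lambda>c. min (D c) (E c))"
  by (rule locally_finite_subset2[of D E]) auto

lemma locally_finite_cmult [simp]: "locally_finite D \<Longrightarrow> locally_finite (\<lambda>c. k * D c)"
  by (rule locally_finite_subset[of D]) auto

lemma locally_finite_sum [simp]:
  "(\<And>i. i \<in> I \<Longrightarrow> locally_finite (D i)) \<Longrightarrow> locally_finite (\<lambda>c. \<Sum>i\<in>I. D i c)"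
  by (induction I rule: infinite_finite_induct) auto

lemma counting_0 [simp]: "counting r (\<lambda>c. 0) = 0"
  by (simp add: counting_def)

lemma counting_add:
  assumes "r \<ge> 1" "locally_finite D" "locally_finite E"
  shows "counting r (\<lambda>c. D c + E c) = counting r D + counting r E"
proof -
  let ?S = "{c. v c \<le> r \<and> D c \<noteq> 0} \<union> {c. v c \<le> r \<and> E c \<noteq> 0}"
  have "finite ?S" using assms by (simp add: locally_finite_def)
  have "counting r D = (\<Sum>c\<in>?S. of_int (D c) * weight r c)"
    "counting r E = (\<Sum>c\<in>?S. of_int (E c) * weight r c)"
    "counting r (\<lambda>c. D c + E c) = (\<Sum>c\<in>?S. of_int (D c + E c) * weight r c)"
    by (rule counting_superset[OF assms(1) \<open>finite ?S\<close>], force)+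
  then show ?thesis by (simp add: sum.distrib distrib_right)
qed

lemma counting_cmult: "counting r (\<lambda>c. k * D c) = of_int k * counting r D"
  by (cases "k = 0") (simp_all add: counting_def sum_distrib_left mult.assoc)

lemma counting_diff:
  assumes "r \<ge> 1" "locally_finite D" "locally_finite E"
  shows "counting r (\<lambda>c. D c - E c) = counting r D - counting r E"
  using counting_add[of r D "\<lambda>c. - 1 * E c"] counting_cmult[of r "- 1" E] assms
    locally_finite_cmult[of E "- 1"] by simp

lemma counting_sum:
  assumes "r \<ge> 1" "\<And>i. i \<in> I \<Longrightarrow> locally_finite (D i)"
  shows "counting r (\<lambda>c. \<Sum>i\<in>I. D i c) = (\<Sum>i\<in>I. counting r (D i))"
  using assms by (induction I rule: infinite_finite_induct) (auto simp: counting_add)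

lemma counting_mono:
  assumes "r \<ge> 1" "locally_finite D" "locally_finite E" "\<And>c. D c \<le> E c"
  shows "counting r D \<le> counting r E"
proof -
  let ?S = "{c. v c \<le> r \<and> D c \<noteq> 0} \<union> {c. v c \<le> r \<and> E c \<noteq> 0}"
  have "finite ?S" using assms by (simp add: locally_finite_def)
  then show ?thesis
    using assms counting_superset[of r ?S D] counting_superset[of r ?S E] weight_nonneg
    by (auto intro!: sum_mono mult_right_mono)
qed

lemma counting_nonneg:
  assumes "r \<ge> 1" "locally_finite D" "\<And>c. 0 \<le> D c"
  shows "0 \<le> counting r D"
  using counting_mono[of r "\<lambda>c. 0" D] assms by simp

text \<open>The difference of Jensen's formulas for numerator and denominator. They need not be
  coprime, since common zeros cancel in the order as well as in the norm.\<close>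

lemma jensen:
  assumes "h \<in> \<M>" "h \<noteq> 0"
  shows locally_finite_ord: "locally_finite (\<lambda>c. ord c h)"
    and lnorm_jensen: "r \<ge> 1 \<Longrightarrow> lnorm r h = lnorm 1 h + counting r (\<lambda>c. ord c h)"
proof -
  obtain A B where h: "entire v A" "entire v B" "B \<noteq> 0" "h = fps_to_fls A / fps_to_fls B"
    using assms(1) by (rule meromorphicE)
  then have A0: "A \<noteq> 0" using assms by auto
  define sA sB where "sA = (\<lambda>c. int (subdegree (taylor_at v c A)))"
    and "sB = (\<lambda>c. int (subdegree (taylor_at v c B)))"
  have ord: "ord c h = sA c - sB c" for c
    using h A0 fls_divide_subdegree[of "fps_to_fls (taylor_at v c A)" "fps_to_fls (taylor_at v c B)"]
    by (simp add: ord_at_def translate_quot taylor_at_eq_0_iff fls_subdegree_fls_to_fps sA_def sB_def)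
  have lf: "locally_finite (\<lambda>c. int (subdegree (taylor_at v c C)))" if "entire v C" "C \<noteq> 0" for C
    unfolding locally_finite_def
  proof
    fix r
    have "finite {c. v c \<le> max 1 r \<and> subdegree (taylor_at v c C) \<noteq> 0}"
      using that by (intro jensen_entire) auto
    then show "finite {c. v c \<le> r \<and> int (subdegree (taylor_at v c C)) \<noteq> 0}"
      by (rule finite_subset[rotated]) auto
  qed
  have lf': "locally_finite sA" "locally_finite sB"
    unfolding sA_def sB_def using lf h A0 by auto
  then show "locally_finite (\<lambda>c. ord c h)" by (simp add: ord)
  show "lnorm r h = lnorm 1 h + counting r (\<lambda>c. ord c h)" if r: "r \<ge> 1"
  proof -
    have A: "ln (gauss_norm r A) = ln (gauss_norm 1 A) + counting r sA"
      using jensen_entire(2)[OF h(1) A0 r] by (simp add: counting_def sA_def)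
    have B: "ln (gauss_norm r B) = ln (gauss_norm 1 B) + counting r sB"
      using jensen_entire(2)[OF h(2,3) r] by (simp add: counting_def sB_def)
    have l: "lnorm s h = ln (gauss_norm s A) - ln (gauss_norm s B)" if "s \<ge> 1" for s
      unfolding h(4) using h(1-3) A0 that gauss_norm_pos[of A s] gauss_norm_pos[of B s]
      by (simp add: lnorm_def mero_norm_quot ln_div)
    show ?thesis
      unfolding ord using l[of r] l[of 1] A B r lf' by (simp add: counting_diff)
  qed
qed

subsection \<open>The Nevanlinna characteristic\<close>

definition zero_div :: "'a fls \<Rightarrow> 'a \<Rightarrow> int" where "zero_div h c = max 0 (ord c h)"
definition pole_div :: "'a fls \<Rightarrow> 'a \<Rightarrow> int" where "pole_div h c = max 0 (- ord c h)"

text \<open>Nevanlinna's characteristic with the norm on the circle as proximity function. By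
  Jensen's formula it is, up to a constant, the larger of the counting functions of the poles and of
  the zeros.\<close>

definition height :: "real \<Rightarrow> 'a fls \<Rightarrow> real" where
  "height r h = counting r (pole_div h) + max 0 (lnorm r h)"

lemma locally_finite_ord' [simp]: "h \<in> \<M> \<Longrightarrow> locally_finite (\<lambda>c. ord c h)"
  by (cases "h = 0") (auto intro: locally_finite_ord)

lemma locally_finite_zero_div [simp]: "h \<in> \<M> \<Longrightarrow> locally_finite (zero_div h)"
  by (rule locally_finite_subset[of "\<lambda>c. ord c h"]) (auto simp: zero_div_def)

lemma locally_finite_pole_div [simp]: "h \<in> \<M> \<Longrightarrow> locally_finite (pole_div h)"
  by (rule locally_finite_subset[of "\<lambda>c. ord c h"]) (auto simp: pole_div_def)

lemma locally_finite_min_const [simp]: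
  "locally_finite D \<Longrightarrow> 0 \<le> k \<Longrightarrow> locally_finite (\<lambda>c. min k (D c))"
  by (rule locally_finite_subset[of D]) auto

lemma zero_div_nonneg [simp]: "0 \<le> zero_div h c"
  by (simp add: zero_div_def)

lemma pole_div_nonneg [simp]: "0 \<le> pole_div h c"
  by (simp add: pole_div_def)

lemma counting_zero_div:
  assumes "h \<in> \<M>" "h \<noteq> 0" "r \<ge> 1"
  shows "counting r (zero_div h) = counting r (pole_div h) + lnorm r h - lnorm 1 h"
proof -
  have "(\<lambda>c. ord c h) = (\<lambda>c. zero_div h c - pole_div h c)"
    by (auto simp: zero_div_def pole_div_def)
  then show ?thesis
    using lnorm_jensen[OF assms] assms by (simp add: counting_diff)
qed

lemma counting_pole_div_le: "counting r (pole_div h) \<le> height r h"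
  by (simp add: height_def)

lemma counting_zero_div_le:
  assumes "h \<in> \<M>" "h \<noteq> 0" "r \<ge> 1"
  shows "counting r (zero_div h) \<le> height r h - lnorm 1 h"
  using counting_zero_div[OF assms] by (simp add: height_def)

lemma height_nonneg:
  assumes "h \<in> \<M>" "r \<ge> 1"
  shows "0 \<le> height r h"
  using counting_nonneg[of r "pole_div h"] assms by (simp add: height_def)

lemma height_mult:
  assumes "h \<in> \<M>" "k \<in> \<M>" "h \<noteq> 0" "k \<noteq> 0" "r \<ge> 1"
  shows "height r (h * k) \<le> height r h + height r k"
proof -
  have "pole_div (h * k) c \<le> pole_div h c + pole_div k c" for c
    using assms by (simp add: pole_div_def ord_mult)
  then have "counting r (pole_div (h * k)) \<le> counting r (\<lambda>c. pole_div h c + pole_div k c)"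
    using assms by (intro counting_mono) auto
  then show ?thesis
    using assms by (simp add: height_def counting_add lnorm_mult)
qed

lemma zero_div_inverse: "h \<in> \<M> \<Longrightarrow> zero_div (inverse h) = pole_div h"
  by (auto simp: zero_div_def pole_div_def ord_inverse)

lemma pole_div_inverse: "h \<in> \<M> \<Longrightarrow> pole_div (inverse h) = zero_div h"
  by (auto simp: zero_div_def pole_div_def ord_inverse)

text \<open>The first main theorem for the value 0: Jensen's formula exchanges zeros and poles, and
  the error is an explicit constant.\<close>

lemma height_inverse:
  assumes "h \<in> \<M>" "h \<noteq> 0" "r \<ge> 1"
  shows "height r (inverse h) = height r h - lnorm 1 h"
  using assms counting_zero_div[OF assms]
  by (simp add: height_def pole_div_inverse lnorm_inverse max_def)

lemma ord_diff_const_ge: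
  assumes "h \<in> \<M>" "h \<noteq> fls_const a"
  shows "ord c (h - fls_const a) \<ge> min 0 (ord c h)"
  using ord_ge_diff[of h "fls_const a" c "min 0 (ord c h)"] assms
  by (auto simp: ord_ge_def)

lemma ord_diff_const_pole:
  assumes "h \<in> \<M>" "ord c h < 0"
  shows "ord c (h - fls_const a) = ord c h"
proof -
  have nz: "h \<noteq> fls_const a" using assms by auto
  have 1: "ord c (h - fls_const a) \<ge> ord c h" using ord_diff_const_ge[OF assms(1) nz, of c] assms by auto
  moreover have "ord_ge c (min 0 (ord c (h - fls_const a))) ((h - fls_const a) + fls_const a)"
    using assms by (intro ord_ge_add) (auto simp: ord_ge_def)
  then have "ord c h \<ge> min 0 (ord c (h - fls_const a))" using assms by (auto simp: ord_ge_def)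
  ultimately show ?thesis using assms by linarith
qed

lemma pole_div_diff_const:
  assumes "h \<in> \<M>" "h \<noteq> fls_const a"
  shows "pole_div (h - fls_const a) = pole_div h"
proof
  fix c
  show "pole_div (h - fls_const a) c = pole_div h c"
    using ord_diff_const_ge[OF assms, of c] ord_diff_const_pole[OF assms(1), of c a]
    by (auto simp: pole_div_def min_def max_def split: if_splits)
qed

text \<open>The first main theorem as an inequality: \<open>h - a\<close> has the poles of
  \<open>h\<close>, and its norm exceeds that of \<open>h\<close> only by a constant depending on
  \<open>a\<close>.\<close>

lemma counting_zero_div_diff_const:
  assumes "h \<in> \<M>" "h \<noteq> fls_const a"
  shows "\<exists>C. \<forall>r\<ge>1. counting r (zero_div (h - fls_const a)) \<le> height r h + C"
proof (intro exI allI impI)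
  fix r :: real assume r: "r \<ge> 1"
  have "lnorm r (h - fls_const a) \<le> max (max 0 (lnorm r h)) (max 0 (ln (v a)))"
    using assms r by (intro lnorm_diff) (auto simp: lnorm_const)
  also have "\<dots> \<le> max 0 (lnorm r h) + max 0 (ln (v a))" by auto
  finally show "counting r (zero_div (h - fls_const a)) \<le>
      height r h + (max 0 (ln (v a)) - lnorm 1 (h - fls_const a))"
    using counting_zero_div[of "h - fls_const a" r] pole_div_diff_const[OF assms] assms r
    by (simp add: height_def)
qed

lemma weight_0: "r \<ge> 1 \<Longrightarrow> weight r 0 = ln r"
  by (simp add: weight_def)

lemma counting_ge_ln:
  assumes "locally_finite D" "\<And>c. 0 \<le> D c" "0 < D 0" "r \<ge> 1"
  shows "counting r D \<ge> ln r"
proof -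
  have "ln r = counting r (\<lambda>c. if c = 0 then 1 else 0)"
    using assms counting_superset[of r "{0}" "\<lambda>c. if c = 0 then 1 else 0"] by (auto simp: weight_0)
  also have "\<dots> \<le> counting r D"
  proof (rule counting_mono)
    show "locally_finite (\<lambda>c. if c = 0 then 1 else 0)"
      by (rule locally_finite_subset[OF assms(1)]) (use assms(3) in auto)
    show "(if c = 0 then 1 else 0) \<le> D c" for c
      using assms(2)[of c] assms(3) by auto
  qed (use assms in auto)
  finally show ?thesis .
qed

text \<open>Either \<open>h\<close> has a pole at the origin or \<open>h - h(0)\<close> has a zero
  there, and the origin alone counts \<open>ln r\<close>.\<close>

lemma height_ge_ln:
  assumes "h \<in> \<M>" "h \<notin> range fls_const"
  shows "\<exists>C. \<forall>r\<ge>1. ln r \<le> height r h + C"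
proof (cases "ord 0 h < 0")
  case True
  then have "pole_div h 0 > 0" by (simp add: pole_div_def)
  then have "ln r \<le> height r h + 0" if "r \<ge> 1" for r
    using counting_ge_ln[of "pole_div h" r] counting_pole_div_le[of r h] assms that by simp
  then show ?thesis by blast
next
  case False
  define a where "a = fls_nth h 0"
  have nz: "h \<noteq> fls_const a" using assms by auto
  have "ord 0 (h - fls_const a) > 0"
  proof -
    have sub: "fls_subdegree h \<ge> 0" using False assms by (simp add: ord_at_def)
    have "fls_nth (h - fls_const a) k = 0" if "k \<le> 0" for k
      using sub that by (cases "k = 0") (auto simp: a_def)
    then have "fls_subdegree (h - fls_const a) > 0"
      using nz by (intro fls_subdegree_greaterI) auto
    then show ?thesis using assms by (simp add: ord_at_def)
  qed
  then have *: "counting r (zero_div (h - fls_const a)) \<ge> ln r" if "r \<ge> 1" for r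
    using assms that by (intro counting_ge_ln) (auto simp: zero_div_def)
  obtain C where "\<And>r. r \<ge> 1 \<Longrightarrow> counting r (zero_div (h - fls_const a)) \<le> height r h + C"
    using counting_zero_div_diff_const[OF assms(1) nz] by auto
  with * have "\<forall>r\<ge>1. ln r \<le> height r h + C" by (meson order_trans)
  then show ?thesis ..
qed

lemma height_at_top:
  assumes "h \<in> \<M>" "h \<notin> range fls_const"
  shows "filterlim (\<lambda>r. height r h) at_top at_top"
proof -
  obtain C where C: "\<And>r. r \<ge> 1 \<Longrightarrow> ln r \<le> height r h + C" using height_ge_ln[OF assms] by auto
  have "filterlim (\<lambda>r::real. ln r - C) at_top at_top"
    using filterlim_tendsto_add_at_top[OF tendsto_const ln_at_top, of "- C"] by simp
  then show ?thesis
  proof (rule filterlim_at_top_mono)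
    show "\<forall>\<^sub>F r in at_top. ln r - C \<le> height r h"
      using eventually_ge_at_top[of 1] by eventually_elim (use C in force)
  qed
qed

section \<open>Comparison with the characteristic function used in the definition of
  smallness\<close>

lemma count_Z_translate:
  assumes "h \<in> \<M>" "h \<noteq> 0"
  shows "\<exists>K. \<forall>r\<ge>max 1 (v c). count_Z v r (translate v c h) = counting r (zero_div h) + K"
proof -
  define \<rho> where "\<rho> = max 1 (v c)"
  \<comment> \<open>The difference between what a zero at \<open>y\<close> contributes to the
    translated function and to \<open>counting\<close>. It does not involve \<open>r\<close>. The
    default value of \<open>ln 0\<close> enters only for \<open>y = c\<close> and is absorbed by the
    constant.\<close>
  define t where "t = (\<lambda>y. of_int (ord y h) * (ln (max 1 (v y)) - ln (v (y - c))))"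
  have "count_Z v r (translate v c h) = counting r (zero_div h) + (\<Sum>y | ord y h > 0 \<and> v y \<le> \<rho>. t y)"
    if r: "r \<ge> \<rho>" for r
  proof -
    have r1: "r \<ge> 1" "v c \<le> r" using r by (auto simp: \<rho>_def)
    have ord: "ord z (translate v c h) = ord (z + c) h" for z
      using assms by (simp add: ord_at_def translate_translate)
    \<comment> \<open>A translation by an element of the disc maps the disc onto itself.\<close>
    have disc: "v (y - c) \<le> r \<longleftrightarrow> v y \<le> r" for y
      using v_diff[of y c] ultrametric[of "y - c" c] r1 by auto
    let ?S = "{y. ord y h > 0 \<and> v y \<le> r}"
    have fin: "finite ?S"
      using locally_finite_ord'[OF assms(1)] unfolding locally_finite_def
      by (rule_tac finite_subset[of _ "{y. v y \<le> r \<and> ord y h \<noteq> 0}"]) auto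
    have "count_Z v r (translate v c h) =
        (\<Sum>y\<in>?S. of_int (ord y h) * (ln r - ln (v (y - c))))"
    proof -
      have "v (z + c) \<le> r \<longleftrightarrow> v z \<le> r" for z using disc[of "z + c"] by simp
      then have "bij_betw (\<lambda>z. z + c) {z. 0 < ord (z + c) h \<and> v z \<le> r} ?S"
        by (intro bij_betwI[of _ _ _ "\<lambda>y. y - c"]) (simp_all add: disc Pi_iff)
      from sum.reindex_bij_betw[OF this, of "\<lambda>y. of_int (ord y h) * (ln r - ln (v (y - c)))"]
      show ?thesis unfolding count_Z_def ord by simp
    qed
    also have "\<dots> = (\<Sum>y\<in>?S. of_int (ord y h) * weight r y + t y)"
    proof (rule sum.cong[OF refl])
      fix y assume "y \<in> ?S"
      then have "max r (v y) = r" by simp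
      then show "of_int (ord y h) * (ln r - ln (v (y - c))) = of_int (ord y h) * weight r y + t y"
        by (simp add: weight_def t_def algebra_simps)
    qed
    also have "\<dots> = (\<Sum>y\<in>?S. of_int (ord y h) * weight r y) + (\<Sum>y\<in>?S. t y)"
      by (rule sum.distrib)
    also have "(\<Sum>y\<in>?S. of_int (ord y h) * weight r y) = counting r (zero_div h)"
      unfolding counting_def by (intro sum.cong) (auto simp: zero_div_def max_def split: if_splits)
    \<comment> \<open>Beyond \<rho> one has \<open>v (y - c) = v y\<close>, so \<open>t\<close>
      vanishes and the sum stays constant as \<open>r\<close> grows.\<close>
    also have "(\<Sum>y\<in>?S. t y) = (\<Sum>y | ord y h > 0 \<and> v y \<le> \<rho>. t y)"
    proof (rule sum.mono_neutral_right[OF fin])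
      show "\<forall>y\<in>?S - {y. ord y h > 0 \<and> v y \<le> \<rho>}. t y = 0"
      proof
        fix y assume "y \<in> ?S - {y. ord y h > 0 \<and> v y \<le> \<rho>}"
        then have y: "v y > 1" "v y > v c" by (auto simp: \<rho>_def)
        then have "v (y - c) = v y" using v_add_eq_left[of "- c" y] by (simp add: v_minus)
        then show "t y = 0" using y by (simp add: t_def)
      qed
    qed (use r in auto)
    finally show ?thesis .
  qed
  then show ?thesis unfolding \<rho>_def by blast
qed

text \<open>Both sides are maxima of a count of zeros and a count of poles, and the corresponding
  entries differ by constants.\<close>

lemma char_T_translate:
  assumes "h \<in> \<M>" "h \<noteq> 0"
  shows "\<exists>C. \<forall>r\<ge>max 1 (v c). \<bar>char_T v r (translate v c h) - height r h\<bar> \<le> C"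
proof -
  obtain K where K: "\<And>r. r \<ge> max 1 (v c) \<Longrightarrow>
      count_Z v r (translate v c h) = counting r (zero_div h) + K"
    using count_Z_translate[OF assms, of c] by auto
  obtain K' where K': "\<And>r. r \<ge> max 1 (v c) \<Longrightarrow>
      count_Z v r (translate v c (inverse h)) = counting r (pole_div h) + K'"
    using count_Z_translate[of "inverse h" c] assms by (auto simp: zero_div_inverse)
  define k where "k = ln (v (fls_nth (translate v c h) 0))"
  have "\<bar>char_T v r (translate v c h) - height r h\<bar> \<le> \<bar>K + k - lnorm 1 h\<bar> + \<bar>K'\<bar>"
    if r: "r \<ge> max 1 (v c)" for r
  proof -
    have "count_N v r (translate v c h) = counting r (pole_div h) + K'"
      using K'[OF r] assms by (simp add: count_N_def translate_inverse divide_inverse)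
    then have "char_T v r (translate v c h) =
        max (counting r (zero_div h) + (K + k)) (counting r (pole_div h) + K')"
      using K[OF r] by (simp add: char_T_def k_def)
    moreover have "height r h = max (counting r (zero_div h) + lnorm 1 h) (counting r (pole_div h))"
    proof -
      have "r \<ge> 1" using r by simp
      from counting_zero_div[OF assms this] show ?thesis by (auto simp: height_def)
    qed
    ultimately show ?thesis by (auto simp: max_def)
  qed
  then show ?thesis by blast
qed

lemma small_wrt_height:
  assumes "small_wrt v \<alpha> f" "\<alpha> \<in> \<M>" "\<alpha> \<noteq> 0" "f \<in> \<M>" "f \<notin> range fls_const"
    and "\<epsilon> > 0"
  shows "\<forall>\<^sub>F r in at_top. height r \<alpha> \<le> \<epsilon> * height r f"
proof -
  have f0: "f \<noteq> 0" using assms(5) by (metis fls_const_0 rangeI)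
  obtain c where lim: "((\<lambda>r. char_T v r (translate v c \<alpha>) / char_T v r (translate v c f)) \<longlongrightarrow> 0) at_top"
    using assms(1) by (auto simp: small_wrt_def)
  obtain A where A: "\<And>r. r \<ge> max 1 (v c) \<Longrightarrow> \<bar>char_T v r (translate v c \<alpha>) - height r \<alpha>\<bar> \<le> A"
    using char_T_translate[OF assms(2,3), of c] by auto
  obtain B where B: "\<And>r. r \<ge> max 1 (v c) \<Longrightarrow> \<bar>char_T v r (translate v c f) - height r f\<bar> \<le> B"
    using char_T_translate[OF assms(4) f0, of c] by auto
  have "\<forall>\<^sub>F r in at_top. \<bar>char_T v r (translate v c \<alpha>) / char_T v r (translate v c f)\<bar> < \<epsilon> / 2"
    using order_tendstoD(2)[OF tendsto_rabs[OF lim], of "\<epsilon> / 2"] assms(6) by simp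
  moreover have "\<forall>\<^sub>F r in at_top. height r f \<ge> B + 1 + 2 / \<epsilon> * (A + \<epsilon> / 2 * B)"
    using height_at_top[OF assms(4,5)] by (simp add: filterlim_at_top)
  moreover have "\<forall>\<^sub>F r in at_top. height r f \<ge> B + 1"
    using height_at_top[OF assms(4,5)] by (simp add: filterlim_at_top)
  moreover have "\<forall>\<^sub>F r in at_top. r \<ge> max 1 (v c)" by (rule eventually_ge_at_top)
  ultimately show ?thesis
  proof eventually_elim
    case (elim r)
    let ?a = "char_T v r (translate v c \<alpha>)" and ?f = "char_T v r (translate v c f)"
    have f1: "?f > 0" using B[OF elim(4)] elim(3) by linarith
    have "?a / ?f < \<epsilon> / 2" using elim(1) by linarith
    then have "?a < \<epsilon> / 2 * ?f" using f1 by (simp add: pos_divide_less_eq)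
    also have "\<dots> \<le> \<epsilon> / 2 * (height r f + B)"
      using B[OF elim(4)] assms(6) by (intro mult_left_mono) linarith+
    finally have 1: "height r \<alpha> \<le> A + \<epsilon> / 2 * B + \<epsilon> / 2 * height r f"
      using A[OF elim(4)] by (simp add: distrib_left)
    \<comment> \<open>One half of \<epsilon> serves the limit; the other half absorbs the additive
      constants once the height of \<open>f\<close> is large.\<close>
    have "\<epsilon> / 2 * (2 / \<epsilon> * (A + \<epsilon> / 2 * B)) \<le> \<epsilon> / 2 * height r f"
    proof (rule mult_left_mono)
      have "B \<ge> 0" using B[OF elim(4)] by linarith
      then show "2 / \<epsilon> * (A + \<epsilon> / 2 * B) \<le> height r f" using elim(2) by linarith
    qed (use assms(6) in simp)
    then have "A + \<epsilon> / 2 * B \<le> \<epsilon> / 2 * height r f" using assms(6) by simp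
    with 1 show ?case by simp
  qed
qed

subsection \<open>Truncated second main theorems\<close>

text \<open>The height of the point \<open>[h : k]\<close> of the projective line. By Jensen's
  formula a common factor changes it only by a constant.\<close>

definition pair_height :: "real \<Rightarrow> 'a fls \<Rightarrow> 'a fls \<Rightarrow> real" where
  "pair_height r h k = max (lnorm r h) (lnorm r k) - counting r (\<lambda>c. min (ord c h) (ord c k))"

lemma height_divide:
  assumes "h \<in> \<M>" "k \<in> \<M>" "h \<noteq> 0" "k \<noteq> 0" "r \<ge> 1"
  shows "height r (h / k) = pair_height r h k - lnorm 1 k"
proof -
  have "pole_div (h / k) = (\<lambda>c. ord c k - min (ord c h) (ord c k))"
    using assms by (auto simp: pole_div_def ord_divide)
  then have "counting r (pole_div (h / k)) = counting r (\<lambda>c. ord c k) - counting r (\<lambda>c. min (ord c h) (ord c k))"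
    using assms by (simp add: counting_diff)
  then show ?thesis
    using assms lnorm_jensen[of k r] by (simp add: height_def pair_height_def lnorm_divide max_def)
qed

section \<open>Wronskians of two and three functions\<close>

definition wronskian2 :: "'a fls \<Rightarrow> 'a fls \<Rightarrow> 'a fls" where
  "wronskian2 x y = x * fls_deriv y - fls_deriv x * y"

definition wronskian3 :: "'a fls \<Rightarrow> 'a fls \<Rightarrow> 'a fls \<Rightarrow> 'a fls" where
  "wronskian3 x y z =
     x * fls_deriv y * fls_deriv (fls_deriv z) - x * fls_deriv (fls_deriv y) * fls_deriv z
   - (fls_deriv x * y * fls_deriv (fls_deriv z) - fls_deriv x * fls_deriv (fls_deriv y) * z)
   + (fls_deriv (fls_deriv x) * y * fls_deriv z - fls_deriv (fls_deriv x) * fls_deriv y * z)"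

lemma wronskian2_meromorphic [simp]:
  "x \<in> \<M> \<Longrightarrow> y \<in> \<M> \<Longrightarrow> wronskian2 x y \<in> \<M>"
  by (simp add: wronskian2_def)

lemma wronskian3_meromorphic [simp]:
  "x \<in> \<M> \<Longrightarrow> y \<in> \<M> \<Longrightarrow> z \<in> \<M> \<Longrightarrow> wronskian3 x y z \<in> \<M>"
  by (simp add: wronskian3_def)

lemma wronskian2_scale: "wronskian2 (u * x) (u * y) = u * u * wronskian2 x y"
  by (simp add: wronskian2_def algebra_simps)

text \<open>In the determinant, the derivatives of \<open>u\<close> only add multiples of earlier
  rows to later ones.\<close>

lemma wronskian3_scale: "wronskian3 (u * x) (u * y) (u * z) = u * u * u * wronskian3 x y z"
  unfolding wronskian3_def fls_deriv_mult fls_deriv_add by algebra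

lemma wronskian2_add:
  "wronskian2 (x + y) y = wronskian2 x y" "wronskian2 x (x + y) = wronskian2 x y"
  by (simp_all add: wronskian2_def algebra_simps)

lemma wronskian3_add:
  "wronskian3 (x + y + z) y z = wronskian3 x y z" "wronskian3 x (x + y + z) z = wronskian3 x y z"
  "wronskian3 x y (x + y + z) = wronskian3 x y z"
  unfolding wronskian3_def fls_deriv_add by algebra+

text \<open>Up to sign, the Wronskian is \<open>y * y\<close> times the derivative of
  \<open>x / y\<close>.\<close>

lemma wronskian2_eq_0:
  assumes "wronskian2 x y = 0" "y \<noteq> 0"
  shows "x / y \<in> range fls_const"
proof -
  define q where "q = x / y"
  have "x = y * q" using assms by (simp add: q_def)
  then have "wronskian2 x y = - (y * y * fls_deriv q)"
    by (simp add: wronskian2_def algebra_simps)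
  then have "fls_deriv q = 0" using assms by simp
  then show ?thesis by (auto simp: q_def[symmetric] fls_deriv_eq_0_iff)
qed

lemma mero_norm_deriv_le:
  assumes "h \<in> \<M>" "r \<ge> 1"
  shows "mero_norm r (fls_deriv h) \<le> mero_norm r h"
proof -
  have "mero_norm r h / r \<le> mero_norm r h"
    using assms mero_norm_nonneg[of h r] by (simp add: divide_le_eq mult_le_cancel_left1)
  then show ?thesis using mero_norm_deriv[of h r] assms by linarith
qed

lemma mero_norm_mult_le:
  assumes "h \<in> \<M>" "k \<in> \<M>" "r \<ge> 1" "mero_norm r h \<le> A" "mero_norm r k \<le> B"
  shows "mero_norm r (h * k) \<le> A * B"
  using assms mero_norm_nonneg[of h r] mero_norm_nonneg[of k r]
  by (simp add: mero_norm_mult mult_mono)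

lemma mero_norm_add_le:
  assumes "h \<in> \<M>" "k \<in> \<M>" "r \<ge> 1" "mero_norm r h \<le> A" "mero_norm r k \<le> A"
  shows "mero_norm r (h + k) \<le> A"
  using mero_norm_add[of h k r] assms by simp

lemma mero_norm_diff_le:
  assumes "h \<in> \<M>" "k \<in> \<M>" "r \<ge> 1" "mero_norm r h \<le> A" "mero_norm r k \<le> A"
  shows "mero_norm r (h - k) \<le> A"
  using mero_norm_diff[of h k r] assms by simp

lemma mero_norm_wronskian2:
  assumes "x \<in> \<M>" "y \<in> \<M>" "r \<ge> 1"
  shows "mero_norm r (wronskian2 x y) \<le> mero_norm r x * mero_norm r y"
  unfolding wronskian2_def using assms
  by (intro mero_norm_diff_le mero_norm_mult_le mero_norm_deriv_le order_refl) auto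

lemma mero_norm_wronskian3:
  assumes "x \<in> \<M>" "y \<in> \<M>" "z \<in> \<M>" "r \<ge> 1"
  shows "mero_norm r (wronskian3 x y z) \<le> mero_norm r x * mero_norm r y * mero_norm r z"
  unfolding wronskian3_def using assms
  by (intro mero_norm_diff_le mero_norm_add_le mero_norm_mult_le mero_norm_deriv_le order_refl
      order_trans[OF mero_norm_deriv_le mero_norm_deriv_le]) auto

lemma lnorm_wronskian2:
  assumes "x \<in> \<M>" "y \<in> \<M>" "wronskian2 x y \<noteq> 0" "r \<ge> 1"
  shows "lnorm r (wronskian2 x y) \<le> lnorm r x + lnorm r y"
proof -
  have "x \<noteq> 0" "y \<noteq> 0" using assms(3) by (auto simp: wronskian2_def)
  then have "mero_norm r x > 0" "mero_norm r y > 0" using assms by (auto intro: mero_norm_pos)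
  then have "mero_norm r x * mero_norm r y = exp (lnorm r x + lnorm r y)"
    by (simp add: lnorm_def exp_add)
  then show ?thesis
    using mero_norm_wronskian2[of x y r] assms by (intro lnorm_le) auto
qed

lemma lnorm_wronskian3:
  assumes "x \<in> \<M>" "y \<in> \<M>" "z \<in> \<M>" "wronskian3 x y z \<noteq> 0" "r \<ge> 1"
  shows "lnorm r (wronskian3 x y z) \<le> lnorm r x + lnorm r y + lnorm r z"
proof -
  have "x \<noteq> 0" "y \<noteq> 0" "z \<noteq> 0" using assms(4) by (auto simp: wronskian3_def)
  then have "mero_norm r x > 0" "mero_norm r y > 0" "mero_norm r z > 0"
    using assms by (auto intro: mero_norm_pos)
  then have "mero_norm r x * mero_norm r y * mero_norm r z = exp (lnorm r x + lnorm r y + lnorm r z)"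
    by (simp add: lnorm_def exp_add)
  then show ?thesis
    using mero_norm_wronskian3[of x y z r] assms by (intro lnorm_le) auto
qed

text \<open>Division by \<open>u\<close>, whose order at \<open>c\<close> is at most those of
  \<open>x\<close> and \<open>y\<close>, makes both functions regular. Derivation lowers the order
  of a regular function by at most one and never below 0; scaling back restores
  \<open>2 * ord c u\<close>. In the application \<open>u\<close> is the summand that the sum has
  replaced.\<close>

lemma ord_wronskian2:
  assumes M: "x \<in> \<M>" "y \<in> \<M>" "u \<in> \<M>"
    and nz: "u \<noteq> 0" "wronskian2 x y \<noteq> 0"
    and m: "ord c u \<le> ord c x" "ord c u \<le> ord c y"
  shows "ord c (wronskian2 x y) \<ge>
    ord c x - min 1 (ord c x - ord c u) + (ord c y - min 1 (ord c y - ord c u))"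
proof -
  define X Y where "X = x / u" and "Y = y / u"
  have xy: "x = u * X" "y = u * Y" using nz by (auto simp: X_def Y_def)
  have XY: "X \<in> \<M>" "Y \<in> \<M>" using M by (auto simp: X_def Y_def)
  have nz': "x \<noteq> 0" "y \<noteq> 0" using nz by (auto simp: wronskian2_def)
  define p q where "p = ord c x - ord c u" and "q = ord c y - ord c u"
  have pq: "p \<ge> 0" "q \<ge> 0" using m by (auto simp: p_def q_def)
  have X: "ord_ge c p X" and Y: "ord_ge c q Y"
    using M nz nz' by (auto simp: X_def Y_def ord_divide ord_ge_def p_def q_def)
  have X1: "ord_ge c (max 0 (p - 1)) (fls_deriv X)" "ord_ge c (max 0 (p - 1)) X"
    and Y1: "ord_ge c (max 0 (q - 1)) (fls_deriv Y)" "ord_ge c (max 0 (q - 1)) Y"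
    using X Y pq XY ord_ge_deriv ord_ge_mono[OF X] ord_ge_mono[OF Y] by auto
  have W: "ord_ge c (max 0 (p - 1) + max 0 (q - 1)) (wronskian2 X Y)"
    unfolding wronskian2_def using XY X1 Y1 by (intro ord_ge_diff ord_ge_mult) auto
  have WW: "wronskian2 x y = u * u * wronskian2 X Y" unfolding xy by (rule wronskian2_scale)
  then have "wronskian2 X Y \<noteq> 0" using nz by auto
  then have "ord c (wronskian2 x y) \<ge> 2 * ord c u + (max 0 (p - 1) + max 0 (q - 1))"
    using W M XY nz unfolding WW by (simp add: ord_mult ord_ge_def)
  then show ?thesis using pq by (simp add: p_def q_def)
qed

text \<open>As for two functions; second derivatives now occur, so up to 2 is lost in each
  column.\<close>

lemma ord_wronskian3:
  assumes M: "x \<in> \<M>" "y \<in> \<M>" "z \<in> \<M>" "u \<in> \<M>"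
    and nz: "u \<noteq> 0" "wronskian3 x y z \<noteq> 0"
    and m: "ord c u \<le> ord c x" "ord c u \<le> ord c y" "ord c u \<le> ord c z"
  shows "ord c (wronskian3 x y z) \<ge>
    ord c x - min 2 (ord c x - ord c u) + (ord c y - min 2 (ord c y - ord c u))
    + (ord c z - min 2 (ord c z - ord c u))"
proof -
  define X Y Z where "X = x / u" and "Y = y / u" and "Z = z / u"
  have xy: "x = u * X" "y = u * Y" "z = u * Z" using nz by (auto simp: X_def Y_def Z_def)
  have XY: "X \<in> \<M>" "Y \<in> \<M>" "Z \<in> \<M>"
    using M by (auto simp: X_def Y_def Z_def)
  have nz': "x \<noteq> 0" "y \<noteq> 0" "z \<noteq> 0" using nz by (auto simp: wronskian3_def)
  have *: "ord_ge c (max 0 (p - 2)) h \<and> ord_ge c (max 0 (p - 2)) (fls_deriv h) \<and>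
      ord_ge c (max 0 (p - 2)) (fls_deriv (fls_deriv h))"
    if "h \<in> \<M>" "ord_ge c p h" "p \<ge> 0" for h p
  proof -
    have 1: "ord_ge c (max 0 (p - 1)) (fls_deriv h)" using that by (intro ord_ge_deriv)
    have "ord_ge c (max 0 (max 0 (p - 1) - 1)) (fls_deriv (fls_deriv h))"
      using that by (intro ord_ge_deriv 1) auto
    then show ?thesis using that ord_ge_mono[OF 1, of "max 0 (p - 2)"]
      ord_ge_mono[OF that(2), of "max 0 (p - 2)"] ord_ge_mono[of c "max 0 (max 0 (p - 1) - 1)"]
      by auto
  qed
  define p q s where "p = ord c x - ord c u" and "q = ord c y - ord c u" and "s = ord c z - ord c u"
  have pq: "p \<ge> 0" "q \<ge> 0" "s \<ge> 0" using m by (auto simp: p_def q_def s_def)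
  have X: "ord_ge c p X" and Y: "ord_ge c q Y" and Z: "ord_ge c s Z"
    using M nz nz' by (auto simp: X_def Y_def Z_def ord_divide ord_ge_def p_def q_def s_def)
  note X1 = *[OF XY(1) X pq(1)] and Y1 = *[OF XY(2) Y pq(2)] and Z1 = *[OF XY(3) Z pq(3)]
  have W: "ord_ge c (max 0 (p - 2) + max 0 (q - 2) + max 0 (s - 2)) (wronskian3 X Y Z)"
    unfolding wronskian3_def using XY X1 Y1 Z1
    by (intro ord_ge_diff ord_ge_add ord_ge_mult) auto
  have WW: "wronskian3 x y z = u * u * u * wronskian3 X Y Z" unfolding xy by (rule wronskian3_scale)
  then have "wronskian3 X Y Z \<noteq> 0" using nz by auto
  then have "ord c (wronskian3 x y z) \<ge> 3 * ord c u + (max 0 (p - 2) + max 0 (q - 2) + max 0 (s - 2))"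
    using W M XY nz unfolding WW by (simp add: ord_mult ord_ge_def)
  then show ?thesis using pq by (simp add: p_def q_def s_def)
qed

text \<open>The Wronskian may be computed after replacing the summand of least order (or of largest norm)
  by the total sum; hence every term but the minimal (maximal) one enters the estimates.\<close>

lemma truncated_abc:
  assumes M: "x \<in> \<M>" "y \<in> \<M>"
    and nz: "x \<noteq> 0" "y \<noteq> 0" "x + y \<noteq> 0" and W: "x / y \<notin> range fls_const"
  defines "m \<equiv> \<lambda>c. min (ord c x) (ord c y)"
  shows "\<exists>C. \<forall>r\<ge>1. pair_height r x y \<le>
    counting r (\<lambda>c. min 1 (ord c x - m c)) + counting r (\<lambda>c. min 1 (ord c y - m c))
    + counting r (\<lambda>c. min 1 (ord c (x + y) - m c)) + C"
proof (intro exI allI impI)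
  fix r :: real assume r: "r \<ge> 1"
  define w where "w = wronskian2 x y"
  have w: "w \<noteq> 0" "w \<in> \<M>" using wronskian2_eq_0 W nz M by (auto simp: w_def)
  have wx: "w = wronskian2 (x + y) y" and wy: "w = wronskian2 x (x + y)"
    by (simp_all add: w_def wronskian2_add)
  let ?z = "x + y"
  have L: "lnorm r w + max (lnorm r x) (lnorm r y) \<le> lnorm r x + lnorm r y + lnorm r ?z"
    using lnorm_wronskian2[of ?z y r] lnorm_wronskian2[of x ?z r] M w r
    by (simp flip: wx wy add: max_def)
  have mz: "m c \<le> ord c ?z" for c
    using ord_ge_add[of x y c "m c"] M nz by (auto simp: ord_ge_def m_def)
  define e where "e = (\<lambda>h c. min 1 (ord c h - m c))"
  have loc: "ord c x + ord c y + ord c ?z - m c - (e x c + e y c + e ?z c) \<le> ord c w" for c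
  proof (cases "ord c x \<le> ord c y")
    case True
    then have "m c = ord c x" by (simp add: m_def)
    then show ?thesis
      using ord_wronskian2[of ?z y x c] mz[of c] True M nz w unfolding wx[symmetric] e_def by simp
  next
    case False
    then have "m c = ord c y" by (simp add: m_def)
    then show ?thesis
      using ord_wronskian2[of x ?z y c] mz[of c] False M nz w unfolding wy[symmetric] e_def by simp
  qed
  have lm: "locally_finite m" unfolding m_def using M by simp
  have le: "locally_finite (e h)" if "h \<in> \<M>" for h
    unfolding e_def using that lm by (rule_tac locally_finite_subset2[of "\<lambda>c. ord c h" m]) auto
  have "counting r (\<lambda>c. ord c x + ord c y + ord c ?z - m c - (e x c + e y c + e ?z c))
      \<le> counting r (\<lambda>c. ord c w)"
    using M w r lm le loc by (intro counting_mono) auto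
  then have N: "counting r (\<lambda>c. ord c x) + counting r (\<lambda>c. ord c y) + counting r (\<lambda>c. ord c ?z)
      - counting r m - (counting r (e x) + counting r (e y) + counting r (e ?z)) \<le> counting r (\<lambda>c. ord c w)"
    using M r lm le by (simp add: counting_diff counting_add)
  \<comment> \<open>Jensen's formula connects the upper bound \<open>L\<close> for the norm of
    \<open>w\<close> with the lower bound \<open>N\<close> for its order: the orders of
    \<open>x\<close>, \<open>y\<close> and \<open>x + y\<close> cancel against their norms, and
    \<open>pair_height\<close> is left.\<close>
  have J: "lnorm r h = lnorm 1 h + counting r (\<lambda>c. ord c h)" if "h \<in> \<M>" "h \<noteq> 0" for h
    using lnorm_jensen[OF that r] .
  show "pair_height r x y \<le> counting r (\<lambda>c. min 1 (ord c x - m c)) + counting r (\<lambda>c. min 1 (ord c y - m c))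
    + counting r (\<lambda>c. min 1 (ord c ?z - m c)) + (lnorm 1 x + lnorm 1 y + lnorm 1 ?z - lnorm 1 w)"
    using N L J[of x] J[of y] J[of ?z] J[of w] M nz w unfolding pair_height_def m_def[symmetric] e_def
    by simp
qed

text \<open>Cartan's theorem for a sum of three functions. The left-hand side is the height of
  \<open>[x : y : z]\<close>, and the four functions enter symmetrically. Truncation is at 2 because
  the Wronskian contains second derivatives.\<close>

lemma truncated_cartan:
  assumes M: "x \<in> \<M>" "y \<in> \<M>" "z \<in> \<M>"
    and nz: "x \<noteq> 0" "y \<noteq> 0" "z \<noteq> 0" "x + y + z \<noteq> 0" and W: "wronskian3 x y z \<noteq> 0"
  defines "m \<equiv> \<lambda>c. min (ord c x) (min (ord c y) (ord c z))"
  shows "\<exists>C. \<forall>r\<ge>1. max (lnorm r x) (max (lnorm r y) (lnorm r z)) - counting r m \<le>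
    counting r (\<lambda>c. min 2 (ord c x - m c) + min 2 (ord c y - m c)
      + min 2 (ord c z - m c) + min 2 (ord c (x + y + z) - m c)) + C"
proof (intro exI allI impI)
  fix r :: real assume r: "r \<ge> 1"
  define w where "w = wronskian3 x y z"
  have w: "w \<noteq> 0" "w \<in> \<M>" using W M by (auto simp: w_def)
  let ?t = "x + y + z"
  have wx: "w = wronskian3 ?t y z" and wy: "w = wronskian3 x ?t z" and wz: "w = wronskian3 x y ?t"
    by (simp_all add: w_def wronskian3_add)
  have L: "lnorm r w + max (lnorm r x) (max (lnorm r y) (lnorm r z)) \<le>
      lnorm r x + lnorm r y + lnorm r z + lnorm r ?t"
    using lnorm_wronskian3[of ?t y z r] lnorm_wronskian3[of x ?t z r] lnorm_wronskian3[of x y ?t r] M w r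
    by (simp flip: wx wy wz add: max_def)
  have mt: "m c \<le> ord c ?t" for c
  proof -
    have "ord_ge c (m c) ?t"
      using M by (intro ord_ge_add) (auto simp: ord_ge_def m_def)
    then show ?thesis using nz by (simp add: ord_ge_def)
  qed
  define e where "e = (\<lambda>h c. min 2 (ord c h - m c))"
  have loc: "ord c x + ord c y + ord c z + ord c ?t - m c - (e x c + e y c + e z c + e ?t c) \<le> ord c w" for c
  proof -
    have "m c = ord c x \<or> m c = ord c y \<or> m c = ord c z" unfolding m_def by linarith
    then consider "m c = ord c x" | "m c = ord c y" | "m c = ord c z" by blast
    then show ?thesis
    proof cases
      case 1
      then have "ord c x \<le> ord c y" "ord c x \<le> ord c z" by (auto simp: m_def)
      then show ?thesis
        using ord_wronskian3[of ?t y z x c] mt[of c] 1 M nz w unfolding wx[symmetric] e_def by simp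
    next
      case 2
      then have "ord c y \<le> ord c x" "ord c y \<le> ord c z" by (auto simp: m_def)
      then show ?thesis
        using ord_wronskian3[of x ?t z y c] mt[of c] 2 M nz w unfolding wy[symmetric] e_def by simp
    next
      case 3
      then have "ord c z \<le> ord c x" "ord c z \<le> ord c y" by (auto simp: m_def)
      then show ?thesis
        using ord_wronskian3[of x y ?t z c] mt[of c] 3 M nz w unfolding wz[symmetric] e_def by simp
    qed
  qed
  have lm: "locally_finite m" unfolding m_def using M by simp
  have le: "locally_finite (e h)" if "h \<in> \<M>" for h
    unfolding e_def using that lm by (rule_tac locally_finite_subset2[of "\<lambda>c. ord c h" m]) auto
  define E where "E = (\<lambda>c. e x c + e y c + e z c + e ?t c)"
  have lE: "locally_finite E" unfolding E_def using le M by simp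
  have "counting r (\<lambda>c. ord c x + ord c y + ord c z + ord c ?t - m c - E c)
      \<le> counting r (\<lambda>c. ord c w)"
    using M w r lm lE loc by (intro counting_mono) (auto simp: E_def)
  then have N: "counting r (\<lambda>c. ord c x) + counting r (\<lambda>c. ord c y) + counting r (\<lambda>c. ord c z)
      + counting r (\<lambda>c. ord c ?t) - counting r m - counting r E \<le> counting r (\<lambda>c. ord c w)"
    using M r lm lE by (simp add: counting_diff counting_add)
  have J: "lnorm r h = lnorm 1 h + counting r (\<lambda>c. ord c h)" if "h \<in> \<M>" "h \<noteq> 0" for h
    using lnorm_jensen[OF that r] .
  have "max (lnorm r x) (max (lnorm r y) (lnorm r z)) - counting r m \<le> counting r E
      + (lnorm 1 x + lnorm 1 y + lnorm 1 z + lnorm 1 ?t - lnorm 1 w)"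
    using N L J[of x] J[of y] J[of z] J[of ?t] J[of w] M nz w by simp
  then show "max (lnorm r x) (max (lnorm r y) (lnorm r z)) - counting r m \<le>
    counting r (\<lambda>c. min 2 (ord c x - m c) + min 2 (ord c y - m c)
      + min 2 (ord c z - m c) + min 2 (ord c ?t - m c))
      + (lnorm 1 x + lnorm 1 y + lnorm 1 z + lnorm 1 ?t - lnorm 1 w)"
    unfolding E_def e_def .
qed

end

subsection \<open>Polynomials in meromorphic functions\<close>

lemma poly_of_fun_0 [simp]: "poly_of_fun 0 f = 0"
  by (simp add: poly_of_fun_def)

lemma poly_of_fun_pCons [simp]: "poly_of_fun (pCons c p) f = fls_const c + f * poly_of_fun p f"
  by (simp add: poly_of_fun_def map_poly_pCons)

lemma poly_of_fun_add: "poly_of_fun (p + q) f = poly_of_fun p f + poly_of_fun q f"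
proof (induction p q rule: poly_induct2)
  case (pCons c p d q)
  then show ?case by (simp add: fls_plus_const[symmetric] algebra_simps)
qed simp

lemma poly_of_fun_smult: "poly_of_fun (smult c p) f = fls_const c * poly_of_fun p f"
  by (induction p) (simp_all add: algebra_simps flip: fls_const_mult_const)

lemma poly_of_fun_mult: "poly_of_fun (p * q) f = poly_of_fun p f * poly_of_fun q f"
  by (induction p) (simp_all add: poly_of_fun_add poly_of_fun_smult algebra_simps)

lemma poly_of_fun_1 [simp]: "poly_of_fun 1 f = 1"
  by (simp add: one_pCons del: pCons_one)

lemma poly_of_fun_power: "poly_of_fun (p ^ n) f = poly_of_fun p f ^ n"
  by (induction n) (simp_all add: poly_of_fun_mult)

lemma poly_of_fun_prod: "poly_of_fun (\<Prod>i\<in>I. p i) f = (\<Prod>i\<in>I. poly_of_fun (p i) f)"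
  by (induction I rule: infinite_finite_induct) (simp_all add: poly_of_fun_mult)

lemma poly_of_fun_linear: "poly_of_fun [:- c, 1:] f = f - fls_const c"
  by simp

lemma fls_deriv_poly_of_fun: "fls_deriv (poly_of_fun p f) = fls_deriv f * poly_of_fun (pderiv p) f"
  by (induction p) (simp_all add: pderiv_pCons poly_of_fun_add algebra_simps)

lemma notin_range_fls_const:
  assumes "f \<notin> range fls_const"
  shows "f \<noteq> fls_const k" "f \<noteq> 0"
  using assms by (blast, metis fls_const_0 rangeI)

lemma fls_const_mult_eq_const:
  assumes "fls_const a * f = fls_const b" "(a :: 'a :: field) \<noteq> 0"
  shows "f \<in> range fls_const"
proof -
  have "f = fls_const (inverse a) * (fls_const a * f)"
    using assms(2) by (simp flip: mult.assoc)
  also have "\<dots> = fls_const (inverse a * b)" unfolding assms(1) by simp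
  finally show ?thesis by (rule range_eqI)
qed

context padic_field
begin

lemma meromorphic_poly_of_fun [simp]: "f \<in> \<M> \<Longrightarrow> poly_of_fun p f \<in> \<M>"
  by (induction p) auto

lemma lnorm_diff_const_bounds:
  assumes "f \<in> \<M>" "f \<notin> range fls_const" "r \<ge> 1"
  shows "lnorm r f \<le> max (lnorm r (f - fls_const \<beta>)) (max 0 (ln (v \<beta>)))"
proof -
  have f0: "f \<noteq> fls_const \<beta>" "f \<noteq> 0" using notin_range_fls_const[OF assms(2)] by auto
  have "lnorm r ((f - fls_const \<beta>) + fls_const \<beta>) \<le> max (lnorm r (f - fls_const \<beta>)) (max 0 (ln (v \<beta>)))"
    using assms f0 by (intro lnorm_add) (auto simp: lnorm_const)
  then show ?thesis by simp
qed

text \<open>If \<open>f - \<beta>\<close> has norm at least 1 on the circle, Jensen's formula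
  provides as many zeros as the height allows. If the norm is smaller, \<open>f\<close> is bounded
  on the circle, and the height consists of poles up to a constant.\<close>

lemma height_diff_const_cases:
  assumes "f \<in> \<M>" "f \<notin> range fls_const"
  shows "\<exists>C. \<forall>r\<ge>1.
    (0 \<le> lnorm r (f - fls_const \<beta>) \<longrightarrow> height r f \<le> counting r (zero_div (f - fls_const \<beta>)) + C) \<and>
    (lnorm r (f - fls_const \<beta>) < 0 \<longrightarrow> height r f \<le> counting r (pole_div f) + C)"
proof (intro exI allI impI conjI)
  fix r :: real assume r: "r \<ge> 1"
  let ?A = "f - fls_const \<beta>" and ?C = "max 0 (ln (v \<beta>)) + \<bar>lnorm 1 (f - fls_const \<beta>)\<bar>"
  have f0: "f \<noteq> fls_const \<beta>" using assms(2) by auto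
  note L = lnorm_diff_const_bounds[OF assms r, of \<beta>]
  have Z: "counting r (zero_div ?A) = counting r (pole_div f) + lnorm r ?A - lnorm 1 ?A"
    using counting_zero_div[of ?A r] pole_div_diff_const[OF assms(1) f0] assms r f0 by simp
  show "height r f \<le> counting r (zero_div ?A) + ?C" if "0 \<le> lnorm r ?A"
    using L Z that unfolding height_def by linarith
  show "height r f \<le> counting r (pole_div f) + ?C" if "lnorm r ?A < 0"
    using L that unfolding height_def by linarith
qed

lemma ord_diff_const_eq_0:
  assumes "h \<in> \<M>" "ord c (h - fls_const x) > 0" "x \<noteq> y"
  shows "ord c (h - fls_const y) = 0"
proof (rule ccontr)
  assume nz: "ord c (h - fls_const y) \<noteq> 0"
  have "\<not> ord c h < 0" using ord_diff_const_pole[OF assms(1), of c x] assms(2) by auto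
  then have "ord c (h - fls_const y) \<ge> 0"
    using ord_diff_const_ge[OF assms(1), of y c] by (cases "h = fls_const y") auto
  then have g: "ord_ge c 1 (h - fls_const y)" "ord_ge c 1 (h - fls_const x)"
    using assms(2) nz by (simp_all only: ord_ge_def, linarith+)
  have "ord_ge c 1 ((h - fls_const y) - (h - fls_const x))"
    using assms(1) by (intro ord_ge_diff[OF _ _ g]) auto
  moreover have "(h - fls_const y) - (h - fls_const x) = fls_const (x - y)"
    by (simp add: fls_minus_const)
  ultimately show False using assms(3) by (auto simp: ord_ge_def fls_const_nonzero)
qed

text \<open>The two-term theorem for \<open>(y - e) + e = y\<close>. The value infinity comes from
  the constant term, whose order exceeds the minimal one exactly at the poles of
  \<open>y\<close>.\<close>

lemma truncated_smt_0_inf: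
  assumes y: "y \<in> \<M>" "y \<notin> range fls_const" and e: "e \<noteq> 0"
  shows "\<exists>C. \<forall>r\<ge>1. height r y \<le> counting r (\<lambda>c. min 1 (zero_div y c))
    + counting r (\<lambda>c. min 1 (pole_div y c)) + counting r (\<lambda>c. min 1 (zero_div (y - fls_const e) c)) + C"
proof -
  let ?x = "y - fls_const e" and ?e = "fls_const e"
  define m where "m = (\<lambda>c. min (ord c ?x) (ord c ?e))"
  have y0: "y \<noteq> fls_const e" "y \<noteq> 0" using notin_range_fls_const[OF y(2)] by auto
  have M: "?x \<in> \<M>" using y by simp
  have "?x / ?e \<notin> range fls_const"
  proof
    assume "?x / ?e \<in> range fls_const"
    then obtain k where "?x / ?e = fls_const k" by auto
    then have "y = fls_const (k * e + e)"
      using e by (simp add: field_simps fls_const_nonzero flip: fls_plus_const fls_const_mult_const)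
    then show False using y by auto
  qed
  then obtain C where C: "\<And>r. r \<ge> 1 \<Longrightarrow> pair_height r ?x ?e \<le>
    counting r (\<lambda>c. min 1 (ord c ?x - m c)) + counting r (\<lambda>c. min 1 (ord c ?e - m c))
    + counting r (\<lambda>c. min 1 (ord c (?x + ?e) - m c)) + C"
    using truncated_abc[of ?x ?e] y0 M e unfolding m_def by (auto simp: fls_const_nonzero)
  have pd: "pole_div ?x = pole_div y" using pole_div_diff_const y y0 by simp
  have m: "m c = - pole_div y c" for c
    using pd[THEN fun_cong, of c] by (simp add: m_def pole_div_def)
  have 1: "ord c ?x - m c = zero_div ?x c" for c
    unfolding m using pd[THEN fun_cong, of c] by (simp add: pole_div_def zero_div_def)
  have 2: "ord c (?x + ?e) - m c = zero_div y c" for c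
    unfolding m by (simp add: pole_div_def zero_div_def)
  have 3: "ord c ?e - m c = pole_div y c" for c
    unfolding m by simp
  have "height r y \<le> counting r (\<lambda>c. min 1 (zero_div y c))
    + counting r (\<lambda>c. min 1 (pole_div y c)) + counting r (\<lambda>c. min 1 (zero_div ?x c)) + (C + \<bar>ln (v e)\<bar>)"
    if r: "r \<ge> 1" for r
  proof -
    have "counting r (\<lambda>c. - 1 * pole_div y c) = - counting r (pole_div y)"
      using counting_cmult[of r "- 1"] by simp
    moreover have "m = (\<lambda>c. - 1 * pole_div y c)" using m by auto
    ultimately have "pair_height r ?x ?e = max (lnorm r ?x) (ln (v e)) + counting r (pole_div y)"
      using r unfolding pair_height_def m_def[symmetric] by (simp add: lnorm_const)
    moreover have "lnorm r y \<le> max (lnorm r ?x) (ln (v e))"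
    proof -
      have "lnorm r (?x + ?e) \<le> max (lnorm r ?x) (ln (v e))"
        using y0 M r by (intro lnorm_add) (auto simp: lnorm_const)
      then show ?thesis by simp
    qed
    ultimately have "height r y \<le> pair_height r ?x ?e + \<bar>ln (v e)\<bar>"
      unfolding height_def by linarith
    then show ?thesis using C[OF r] unfolding 1 2 3 by simp
  qed
  then show ?thesis by blast
qed

text \<open>The two-term theorem for
  \<open>(b - d) (f - a) + (d - a) (f - b) = (b - a) (f - d)\<close>. All three terms have the poles
  of \<open>f\<close>, so poles drop out after subtraction of the minimal order.\<close>

lemma truncated_smt_finite:
  assumes f: "f \<in> \<M>" "f \<notin> range fls_const" and ne: "a \<noteq> b" "a \<noteq> d" "b \<noteq> d"
  shows "\<exists>C. \<forall>r\<ge>1. height r f \<le> counting r (\<lambda>c. min 1 (zero_div (f - fls_const a) c))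
    + counting r (\<lambda>c. min 1 (zero_div (f - fls_const b) c))
    + counting r (\<lambda>c. min 1 (zero_div (f - fls_const d) c)) + C"
proof -
  define x y where "x = fls_const (b - d) * (f - fls_const a)" and "y = fls_const (d - a) * (f - fls_const b)"
  define m where "m = (\<lambda>c. min (ord c x) (ord c y))"
  have nz: "f - fls_const k \<noteq> 0" for k using f(2) by auto
  have xy: "x + y = fls_const (b - a) * (f - fls_const d)"
    by (simp add: x_def y_def algebra_simps flip: fls_minus_const fls_const_mult_const)
  have M: "x \<in> \<M>" "y \<in> \<M>" using f by (auto simp: x_def y_def)
  have nzxy: "x \<noteq> 0" "y \<noteq> 0" "x + y \<noteq> 0"
    unfolding xy unfolding x_def y_def mult_eq_0_iff
    using nz fls_const_nonzero[of "b - d"] fls_const_nonzero[of "d - a"] fls_const_nonzero[of "b - a"] ne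
    by (simp_all only: simp_thms right_minus_eq not_sym)
  have "x / y \<notin> range fls_const"
  proof
    assume "x / y \<in> range fls_const"
    then obtain k where "x = fls_const k * y" using nzxy by (auto simp: field_simps)
    then have "fls_const (b - d - k * (d - a)) * f = fls_const ((b - d) * a - k * (d - a) * b)"
      by (simp add: x_def y_def algebra_simps flip: fls_minus_const fls_const_mult_const fls_plus_const)
    moreover have "b - d - k * (d - a) \<noteq> 0"
    proof
      assume k: "b - d - k * (d - a) = 0"
      have "fls_const ((b - d) * a - k * (d - a) * b) = (0 :: 'a fls)" using calculation k by simp
      then have "(b - d) * a - k * (d - a) * b = 0" using fls_const_nonzero by blast
      moreover have "k * (d - a) = b - d" using k by simp
      ultimately have "(b - d) * a - (b - d) * b = 0" by simp
      then have "(b - d) * (a - b) = 0" by (simp add: algebra_simps)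
      then show False using ne by simp
    qed
    ultimately show False using f fls_const_mult_eq_const by blast
  qed
  then obtain C where C: "\<And>r. r \<ge> 1 \<Longrightarrow> pair_height r x y \<le>
    counting r (\<lambda>c. min 1 (ord c x - m c)) + counting r (\<lambda>c. min 1 (ord c y - m c))
    + counting r (\<lambda>c. min 1 (ord c (x + y) - m c)) + C"
    using truncated_abc[of x y] nzxy M unfolding m_def by auto
  have ord: "ord c x = ord c (f - fls_const a)" "ord c y = ord c (f - fls_const b)"
    "ord c (x + y) = ord c (f - fls_const d)" for c
    unfolding xy unfolding x_def y_def using f nz ne by (simp_all add: ord_mult fls_const_nonzero)
  have pd: "pole_div (f - fls_const k) c = pole_div f c" for k c
    using pole_div_diff_const[OF f(1) notin_range_fls_const(1)[OF f(2)]] by simp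
  \<comment> \<open>Where \<open>f\<close> is regular, \<open>f - a\<close> and \<open>f - b\<close>
    have no common zero, so the minimum is 0.\<close>
  have m: "m c = - pole_div f c" for c
  proof -
    have "0 < ord c (f - fls_const a) \<longrightarrow> ord c (f - fls_const b) = 0"
      using ord_diff_const_eq_0[of f c a b] ne f by simp
    then show ?thesis
      using pd[of a c] pd[of b c] unfolding m_def ord pole_div_def by linarith
  qed
  have e: "ord c (f - fls_const k) - m c = zero_div (f - fls_const k) c" for k c
    unfolding m using pd[of k c] by (simp add: pole_div_def zero_div_def)
  \<comment> \<open>A bound for all constant logarithms below. One \<open>K\<close> pays for the
    factors in \<open>x\<close> and \<open>y\<close>; two more are needed where the norms of
    \<open>f - a\<close> and \<open>f - b\<close> are only known to be at least
    \<open>exp (- K)\<close>.\<close>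
  define K where "K = \<bar>ln (v (b - d))\<bar> + \<bar>ln (v (d - a))\<bar> + \<bar>ln (v (a - b))\<bar> + \<bar>ln (v a)\<bar>"
  have "height r f \<le> counting r (\<lambda>c. min 1 (zero_div (f - fls_const a) c))
    + counting r (\<lambda>c. min 1 (zero_div (f - fls_const b) c))
    + counting r (\<lambda>c. min 1 (zero_div (f - fls_const d) c)) + (C + 3 * K)" if r: "r \<ge> 1" for r
  proof -
    have L: "lnorm r x = ln (v (b - d)) + lnorm r (f - fls_const a)"
      "lnorm r y = ln (v (d - a)) + lnorm r (f - fls_const b)"
      unfolding x_def y_def using nz f ne r by (simp_all add: lnorm_mult lnorm_const fls_const_nonzero)
    have "lnorm r ((f - fls_const b) - (f - fls_const a)) \<le>
        max (lnorm r (f - fls_const a)) (lnorm r (f - fls_const b))"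
      by (rule lnorm_diff) (use f r ne in \<open>auto simp: fls_minus_const fls_const_nonzero\<close>)
    moreover have "(f - fls_const b) - (f - fls_const a) = fls_const (a - b)" by (simp flip: fls_minus_const)
    ultimately have 1: "ln (v (a - b)) \<le> max (lnorm r (f - fls_const a)) (lnorm r (f - fls_const b))"
      using r by (simp add: lnorm_const)
    have 2: "lnorm r f \<le> max (lnorm r (f - fls_const a)) (max 0 (ln (v a)))"
      using lnorm_diff_const_bounds f r by blast
    have "max 0 (lnorm r f) \<le> max (lnorm r x) (lnorm r y) + 3 * K"
    proof -
      let ?M = "max (lnorm r (f - fls_const a)) (lnorm r (f - fls_const b))"
      have "lnorm r (f - fls_const a) \<le> lnorm r x + K" "lnorm r (f - fls_const b) \<le> lnorm r y + K"
        unfolding L K_def by linarith+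
      then have "?M \<le> max (lnorm r x) (lnorm r y) + K" by linarith
      moreover have "0 \<le> K" unfolding K_def by simp
      moreover have "- K \<le> ?M" using 1 unfolding K_def by linarith
      moreover have "lnorm r f \<le> max ?M K" using 2 unfolding K_def by linarith
      ultimately show ?thesis by linarith
    qed
    moreover have "counting r m = - counting r (pole_div f)"
      using counting_cmult[of r "- 1" "pole_div f"] ext[of m "\<lambda>c. - pole_div f c", OF m] by simp
    ultimately have "height r f \<le> pair_height r x y + 3 * K"
      by (simp add: height_def pair_height_def m_def[symmetric])
    then show ?thesis using C[OF r] unfolding ord e by simp
  qed
  then show ?thesis by blast
qed

end

text \<open>The factor \<open>w\<close> will be a constant or a constant multiple of the derivative of \<open>f\<close>.\<close>

locale fun_product = padic_field v
  for v :: "'a::{alg_closed_field,field_char_0} \<Rightarrow> real" +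
  fixes f w :: "'a fls" and \<beta> :: "'b \<Rightarrow> 'a" and \<mu> :: "'b \<Rightarrow> nat" and I :: "'b set"
  assumes f: "f \<in> \<M>" "f \<notin> range fls_const"
    and w: "w \<in> \<M>" "w \<noteq> 0"
    and ord_w_pole: "ord c f < 0 \<Longrightarrow> ord c w \<le> 0"
    and ord_w_reg: "ord c f \<ge> 0 \<Longrightarrow> ord c w \<ge> 0"
    and I: "finite I"
begin

definition G :: "'a fls" where "G = w * (\<Prod>i\<in>I. (f - fls_const (\<beta> i)) ^ \<mu> i)"

lemma f_neq_const [simp]: "f \<noteq> fls_const k"
  using f(2) by auto

lemma factor_meromorphic [simp]: "f - fls_const k \<in> \<M>"
  using f(1) by simp

lemma G_nonzero: "G \<noteq> 0"
  using w I by (simp add: G_def)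

lemma G_meromorphic: "G \<in> \<M>"
  using w by (simp add: G_def)

lemma ord_G: "ord c G = ord c w + (\<Sum>i\<in>I. int (\<mu> i) * ord c (f - fls_const (\<beta> i)))"
  using w I by (simp add: G_def ord_mult ord_prod ord_power)

lemma ord_factor_nonneg: "ord c f \<ge> 0 \<Longrightarrow> ord c (f - fls_const k) \<ge> 0"
  using ord_diff_const_ge[OF f(1), of k c] f(2) by auto

lemma ord_G_pole:
  assumes "ord c f < 0"
  shows "ord c G = ord c w + int (\<Sum>i\<in>I. \<mu> i) * ord c f"
  using ord_diff_const_pole[OF f(1) assms] by (simp add: ord_G sum_distrib_right)

text \<open>At a pole of \<open>f\<close> no factor has positive order, and elsewhere none has
  negative order; the assumptions on \<open>w\<close> extend this to \<open>w\<close>. Nothing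
  cancels, so zeros and poles can be counted factor by factor.\<close>

lemma zero_div_G:
  "zero_div G c = zero_div w c + (\<Sum>i\<in>I. int (\<mu> i) * zero_div (f - fls_const (\<beta> i)) c)"
proof (cases "ord c f < 0")
  case True
  have "int (\<Sum>i\<in>I. \<mu> i) * ord c f \<le> 0"
    using True by (intro mult_nonneg_nonpos) (auto intro: sum_nonneg)
  then show ?thesis
    using ord_G_pole[OF True] ord_w_pole[OF True] True ord_diff_const_pole[OF f(1) True]
    by (simp add: zero_div_def)
next
  case False
  then have *: "zero_div (f - fls_const (\<beta> i)) c = ord c (f - fls_const (\<beta> i))"
    "ord c (f - fls_const (\<beta> i)) \<ge> 0" for i
    using ord_factor_nonneg[of c] by (simp_all add: zero_div_def)
  have "(\<Sum>i\<in>I. int (\<mu> i) * ord c (f - fls_const (\<beta> i))) \<ge> 0"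
    using * by (intro sum_nonneg) auto
  then show ?thesis
    using ord_w_reg[of c] False unfolding * by (simp add: zero_div_def ord_G)
qed

lemma pole_div_G: "pole_div G c = pole_div w c + int (\<Sum>i\<in>I. \<mu> i) * pole_div f c"
proof (cases "ord c f < 0")
  case True
  have "int (\<Sum>i\<in>I. \<mu> i) * ord c f \<le> 0"
    using True by (intro mult_nonneg_nonpos) (auto intro: sum_nonneg)
  then show ?thesis
    using ord_G_pole[OF True] ord_w_pole[OF True] True by (simp add: pole_div_def)
next
  case False
  have "(\<Sum>i\<in>I. int (\<mu> i) * ord c (f - fls_const (\<beta> i))) \<ge> 0"
    using ord_factor_nonneg[of c] False by (intro sum_nonneg) auto
  then show ?thesis
    using ord_w_reg[of c] False by (simp add: pole_div_def ord_G)
qed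

lemma counting_zero_div_G:
  assumes "r \<ge> 1"
  shows "counting r (zero_div G) = counting r (zero_div w)
    + (\<Sum>i\<in>I. real (\<mu> i) * counting r (zero_div (f - fls_const (\<beta> i))))"
proof -
  have "zero_div G = (\<lambda>c. zero_div w c + (\<Sum>i\<in>I. int (\<mu> i) * zero_div (f - fls_const (\<beta> i)) c))"
    using zero_div_G by blast
  then show ?thesis using assms w by (simp add: counting_add counting_sum counting_cmult)
qed

lemma counting_pole_div_G:
  assumes "r \<ge> 1"
  shows "counting r (pole_div G) = counting r (pole_div w) + real (\<Sum>i\<in>I. \<mu> i) * counting r (pole_div f)"
proof -
  have "pole_div G = (\<lambda>c. pole_div w c + int (\<Sum>i\<in>I. \<mu> i) * pole_div f c)"
    using pole_div_G by blast
  then show ?thesis using assms w f counting_cmult[of r "int (\<Sum>i\<in>I. \<mu> i)"] by (simp add: counting_add)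
qed

text \<open>If \<open>f\<close> is not close to any of the values \<open>\<beta> i\<close> on the circle of radius \<open>r\<close>, then every
  \<open>f - \<beta> i\<close> has the maximal number of zeros; otherwise \<open>f\<close> is bounded there and has
  the maximal number of poles.\<close>

lemma height_G_lower:
  assumes B: "\<And>r i. r \<ge> 1 \<Longrightarrow> i \<in> I \<Longrightarrow> lnorm r (f - fls_const (\<beta> i)) < 0 \<Longrightarrow> lnorm r w \<le> B"
  shows "\<exists>C. \<forall>r\<ge>1. real (\<Sum>i\<in>I. \<mu> i) * height r f + counting r (zero_div w) \<le> height r G + C"
proof -
  have "\<forall>i. \<exists>C. \<forall>r\<ge>1.
    (0 \<le> lnorm r (f - fls_const (\<beta> i)) \<longrightarrow> height r f \<le> counting r (zero_div (f - fls_const (\<beta> i))) + C) \<and>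
    (lnorm r (f - fls_const (\<beta> i)) < 0 \<longrightarrow> height r f \<le> counting r (pole_div f) + C)"
    using height_diff_const_cases[OF f] by blast
  then obtain K where K: "\<And>i r. r \<ge> 1 \<Longrightarrow> 0 \<le> lnorm r (f - fls_const (\<beta> i)) \<Longrightarrow>
      height r f \<le> counting r (zero_div (f - fls_const (\<beta> i))) + K i"
    "\<And>i r. r \<ge> 1 \<Longrightarrow> lnorm r (f - fls_const (\<beta> i)) < 0 \<Longrightarrow> height r f \<le> counting r (pole_div f) + K i"
    by metis
  define S where "S = real (\<Sum>i\<in>I. \<mu> i)"
  define C1 where "C1 = (\<Sum>i\<in>I. real (\<mu> i) * \<bar>K i\<bar>) + \<bar>lnorm 1 G\<bar>"
  define C2 where "C2 = S * (\<Sum>i\<in>I. \<bar>K i\<bar>) + \<bar>B\<bar> + \<bar>lnorm 1 w\<bar>"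
  have S0: "S \<ge> 0" by (simp only: S_def of_nat_0_le_iff)
  have C12: "C1 \<ge> 0" "C2 \<ge> 0" using S0 by (auto simp: C1_def C2_def intro!: add_nonneg_nonneg sum_nonneg mult_nonneg_nonneg)
  have "S * height r f + counting r (zero_div w) \<le> height r G + (C1 + C2)" if r: "r \<ge> 1" for r
  proof (cases "\<exists>i\<in>I. lnorm r (f - fls_const (\<beta> i)) < 0")
    case False
    have "S * height r f = (\<Sum>i\<in>I. real (\<mu> i) * height r f)"
      by (simp add: S_def sum_distrib_right)
    also have "\<dots> \<le> (\<Sum>i\<in>I. real (\<mu> i) * counting r (zero_div (f - fls_const (\<beta> i))) + real (\<mu> i) * \<bar>K i\<bar>)"
    proof (rule sum_mono)
      fix i assume "i \<in> I"
      then have "height r f \<le> counting r (zero_div (f - fls_const (\<beta> i))) + \<bar>K i\<bar>"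
        using K(1)[OF r, of i] False by force
      then show "real (\<mu> i) * height r f \<le>
          real (\<mu> i) * counting r (zero_div (f - fls_const (\<beta> i))) + real (\<mu> i) * \<bar>K i\<bar>"
        unfolding distrib_left[symmetric] by (intro mult_left_mono) auto
    qed
    finally have "S * height r f + counting r (zero_div w) \<le> counting r (zero_div G) + (\<Sum>i\<in>I. real (\<mu> i) * \<bar>K i\<bar>)"
      by (simp add: counting_zero_div_G[OF r] sum.distrib)
    then show ?thesis
      using counting_zero_div_le[OF G_meromorphic G_nonzero r] C12 by (simp add: C1_def)
  next
    case True
    then obtain i where i: "i \<in> I" "lnorm r (f - fls_const (\<beta> i)) < 0" by blast
    have "K i \<le> \<bar>K i\<bar>" by simp
    also have "\<dots> \<le> (\<Sum>i\<in>I. \<bar>K i\<bar>)" using i(1) I by (intro member_le_sum) auto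
    finally have "height r f \<le> counting r (pole_div f) + (\<Sum>i\<in>I. \<bar>K i\<bar>)"
      using K(2)[OF r i(2)] by simp
    then have "S * height r f \<le> S * counting r (pole_div f) + S * (\<Sum>i\<in>I. \<bar>K i\<bar>)"
      using S0 unfolding distrib_left[symmetric] by (intro mult_left_mono)
    moreover have "counting r (zero_div w) \<le> counting r (pole_div w) + \<bar>B\<bar> + \<bar>lnorm 1 w\<bar>"
      using counting_zero_div[OF w r] B[OF r i] by simp
    ultimately show ?thesis
      using counting_pole_div_G[OF r] counting_pole_div_le[of r G] C12
      unfolding C2_def S_def by linarith
  qed
  then show ?thesis unfolding S_def by blast
qed

lemma height_G_upper:
  "\<exists>C. \<forall>r\<ge>1. height r G \<le> height r w + real (\<Sum>i\<in>I. \<mu> i) * height r f + C"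
proof -
  define K where "K = (\<lambda>i. max 0 (ln (v (\<beta> i))))"
  have "height r G \<le> height r w + real (\<Sum>i\<in>I. \<mu> i) * height r f + (\<Sum>i\<in>I. real (\<mu> i) * K i)"
    if r: "r \<ge> 1" for r
  proof -
    have Ki: "lnorm r (f - fls_const (\<beta> i)) \<le> max 0 (lnorm r f) + K i" for i
    proof -
      have "lnorm r (f - fls_const (\<beta> i)) \<le> max (max 0 (lnorm r f)) (K i)"
        using f r by (intro lnorm_diff) (auto simp: lnorm_const K_def)
      then show ?thesis by (auto simp: K_def)
    qed
    have "lnorm r G = lnorm r w + (\<Sum>i\<in>I. real (\<mu> i) * lnorm r (f - fls_const (\<beta> i)))"
      unfolding G_def using w r I by (simp add: lnorm_mult lnorm_prod lnorm_power)
    also have "\<dots> \<le> lnorm r w + (\<Sum>i\<in>I. real (\<mu> i) * (max 0 (lnorm r f) + K i))"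
      using Ki by (intro add_left_mono sum_mono mult_left_mono) auto
    also have "\<dots> = lnorm r w + real (\<Sum>i\<in>I. \<mu> i) * max 0 (lnorm r f) + (\<Sum>i\<in>I. real (\<mu> i) * K i)"
      by (simp add: distrib_left sum.distrib sum_distrib_right)
    finally have L: "lnorm r G \<le> lnorm r w + real (\<Sum>i\<in>I. \<mu> i) * max 0 (lnorm r f) + (\<Sum>i\<in>I. real (\<mu> i) * K i)" .
    have "0 \<le> real (\<Sum>i\<in>I. \<mu> i) * max 0 (lnorm r f)" "0 \<le> (\<Sum>i\<in>I. real (\<mu> i) * K i)"
      by (auto simp: K_def intro!: sum_nonneg mult_nonneg_nonneg)
    with L show ?thesis
      using counting_pole_div_G[OF r] unfolding height_def distrib_left by linarith
  qed
  then show ?thesis by blast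
qed

text \<open>Under truncation the exponents \<open>\<mu> i\<close> no longer matter; this is the gain
  over the full height.\<close>

lemma min_zero_div_G: "min 1 (zero_div G c) \<le> zero_div w c + (\<Sum>i\<in>I. zero_div (f - fls_const (\<beta> i)) c)"
proof (cases "(\<Sum>i\<in>I. zero_div (f - fls_const (\<beta> i)) c) = 0")
  case True
  then have "zero_div (f - fls_const (\<beta> i)) c = 0" if "i \<in> I" for i
    using that I by (simp add: sum_nonneg_eq_0_iff)
  then show ?thesis using True by (simp add: zero_div_G)
next
  case False
  moreover have "(\<Sum>i\<in>I. zero_div (f - fls_const (\<beta> i)) c) \<ge> 0" by (intro sum_nonneg) simp
  ultimately show ?thesis using zero_div_nonneg[of w c] by linarith
qed

lemma counting_factors_le:
  "\<exists>C. \<forall>r\<ge>1. (\<Sum>i\<in>I. counting r (zero_div (f - fls_const (\<beta> i)))) \<le> real (card I) * height r f + C"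
proof -
  have "\<forall>i. \<exists>C. \<forall>r\<ge>1. counting r (zero_div (f - fls_const (\<beta> i))) \<le> height r f + C"
    using counting_zero_div_diff_const[OF f(1)] f(2) by blast
  then obtain K where K: "\<And>i r. r \<ge> 1 \<Longrightarrow> counting r (zero_div (f - fls_const (\<beta> i))) \<le> height r f + K i"
    by metis
  have "(\<Sum>i\<in>I. counting r (zero_div (f - fls_const (\<beta> i)))) \<le> real (card I) * height r f + (\<Sum>i\<in>I. K i)"
    if "r \<ge> 1" for r
    using sum_mono[of I "\<lambda>i. counting r (zero_div (f - fls_const (\<beta> i)))" "\<lambda>i. height r f + K i"] K[OF that]
    by (simp add: sum.distrib)
  then show ?thesis by blast
qed

end

subsection \<open>The polynomial and its derivative\<close>

locale uniqueness_setup = padic_field v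
  for v :: "'a::{alg_closed_field,field_char_0} \<Rightarrow> real" +
  fixes P :: "'a poly" and b :: 'a and a :: "nat \<Rightarrow> 'a" and n l :: nat
  assumes pderiv_P: "pderiv P = smult b ([:- a 1, 1:] ^ n * (\<Prod>i=2..l. [:- a i, 1:]))"
    and b: "b \<noteq> 0" and l: "l \<ge> 3" and inj: "inj_on a {1..l}" and n: "n \<ge> l + 10"
begin

definition \<mu> :: "nat \<Rightarrow> nat" where "\<mu> i = (if i = 1 then n else 1)"

text \<open>By the chain rule this is the derivative of \<open>P(f)\<close>.\<close>

definition DP :: "'a fls \<Rightarrow> 'a fls" where "DP f = fls_deriv f * poly_of_fun (pderiv P) f"

lemma roots_split: "{1..l} = insert 1 {2..l}"
  using l by auto

lemma sum_roots: "(\<Sum>i\<in>{1..l}. h i) = h 1 + (\<Sum>i\<in>{2..l}. h i)"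
  unfolding roots_split by (subst sum.insert) auto

lemma prod_roots: "(\<Prod>i\<in>{1..l}. h i) = h 1 * (\<Prod>i\<in>{2..l}. h i)"
  unfolding roots_split by (subst prod.insert) auto

lemma sum_\<mu>: "(\<Sum>i\<in>{1..l}. \<mu> i) = n + l - 1"
proof -
  have "(\<Sum>i\<in>{2..l}. \<mu> i) = l - 1" by (simp add: \<mu>_def)
  then show ?thesis unfolding sum_roots using l by (simp add: \<mu>_def)
qed

lemma DP_eq: "DP f = fls_const b * fls_deriv f * (\<Prod>i\<in>{1..l}. (f - fls_const (a i)) ^ \<mu> i)"
proof -
  have "(\<Prod>i\<in>{2..l}. (f - fls_const (a i)) ^ \<mu> i) = (\<Prod>i\<in>{2..l}. f - fls_const (a i))"
    by (intro prod.cong) (auto simp: \<mu>_def)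
  then show ?thesis unfolding prod_roots
    by (simp add: DP_def pderiv_P poly_of_fun_smult poly_of_fun_mult poly_of_fun_power
        poly_of_fun_prod poly_of_fun_linear \<mu>_def mult_ac del: poly_of_fun_pCons)
qed

context
  fixes f :: "'a fls"
  assumes f: "f \<in> \<M>" "f \<notin> range fls_const"
begin

lemma deriv_nonzero: "fls_deriv f \<noteq> 0"
  using f(2) by (auto simp: fls_deriv_eq_0_iff)

lemma ord_w: "ord c (fls_const b * fls_deriv f) = ord c (fls_deriv f)"
  using f deriv_nonzero b by (simp add: ord_mult fls_const_nonzero)

lemma zero_div_w: "zero_div (fls_const b * fls_deriv f) = zero_div (fls_deriv f)"
  by (rule ext) (simp add: zero_div_def ord_w)

lemma pole_div_w: "pole_div (fls_const b * fls_deriv f) = pole_div (fls_deriv f)"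
  by (rule ext) (simp add: pole_div_def ord_w)

lemma ord_deriv_pole: "ord c f < 0 \<Longrightarrow> ord c (fls_deriv f) = ord c f - 1"
  using ord_deriv(1)[OF f(1)] by simp

interpretation fp: fun_product v f "fls_const b * fls_deriv f" a \<mu> "{1..l}"
proof unfold_locales
  show "ord c (fls_const b * fls_deriv f) \<le> 0" if "ord c f < 0" for c
    using ord_deriv_pole[OF that] that by (simp add: ord_w)
  show "ord c (fls_const b * fls_deriv f) \<ge> 0" if "ord c f \<ge> 0" for c
    using ord_deriv_nonneg[OF f(1) that] by (simp add: ord_w)
qed (use f b deriv_nonzero in \<open>auto simp: fls_const_nonzero\<close>)

lemma DP_G: "DP f = fp.G"
  unfolding DP_eq fp.G_def ..

lemma DP_meromorphic: "DP f \<in> \<M>"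
  using fp.G_meromorphic by (simp add: DP_G)

lemma DP_nonzero: "DP f \<noteq> 0"
  using fp.G_nonzero by (simp add: DP_G)

lemma zero_div_DP: "zero_div (DP f) c = zero_div (fls_deriv f) c
    + int n * zero_div (f - fls_const (a 1)) c + (\<Sum>i\<in>{2..l}. zero_div (f - fls_const (a i)) c)"
proof -
  have "(\<Sum>i\<in>{2..l}. int (\<mu> i) * zero_div (f - fls_const (a i)) c)
      = (\<Sum>i\<in>{2..l}. zero_div (f - fls_const (a i)) c)"
    by (intro sum.cong) (auto simp: \<mu>_def)
  then show ?thesis
    using fp.zero_div_G[of c] unfolding DP_G zero_div_w sum_roots by (simp add: \<mu>_def)
qed

text \<open>\<open>P\<close> has degree \<open>n + l\<close>, and derivation raises the pole order
  by one.\<close>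

lemma ord_DP_pole: "ord c f < 0 \<Longrightarrow> ord c (DP f) = int (n + l) * ord c f - 1"
  using fp.ord_G_pole[of c] ord_deriv_pole[of c] l unfolding DP_G[symmetric] ord_w sum_\<mu>
  by (simp add: of_nat_diff algebra_simps)

lemma ord_DP_neg_iff: "ord c (DP f) < 0 \<longleftrightarrow> ord c f < 0"
proof
  assume "ord c f < 0"
  moreover from this have "int (n + l) * ord c f \<le> 0" by (intro mult_nonneg_nonpos) auto
  ultimately show "ord c (DP f) < 0" by (simp add: ord_DP_pole)
next
  assume *: "ord c (DP f) < 0"
  show "ord c f < 0"
  proof (rule ccontr)
    assume "\<not> ord c f < 0"
    then have "pole_div (fls_deriv f) c = 0" "pole_div f c = 0"
      using ord_deriv_nonneg[OF f(1), of c] by (auto simp: pole_div_def)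
    then have "pole_div (DP f) c = 0" using fp.pole_div_G[of c] by (simp add: DP_G pole_div_w)
    then show False using * by (simp add: pole_div_def)
  qed
qed

lemma ord_DP_regular:
  assumes "ord c f \<ge> 0"
  shows "ord c (DP f) = ord c (fls_deriv f) + int n * zero_div (f - fls_const (a 1)) c
    + (\<Sum>i\<in>{2..l}. zero_div (f - fls_const (a i)) c)"
  using zero_div_DP[of c] ord_DP_neg_iff[of c] ord_deriv_nonneg[OF f(1) assms] assms
  by (simp add: zero_div_def[of "DP f"] zero_div_def[of "fls_deriv f"])

lemma lnorm_deriv_le: "r \<ge> 1 \<Longrightarrow> lnorm r (fls_deriv f) \<le> lnorm r f"
proof -
  assume "r \<ge> 1"
  then have "ln r \<ge> 0" "lnorm r (fls_deriv f) \<le> lnorm r f - ln r"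
    using lnorm_deriv[OF f(1) deriv_nonzero, of r] by auto
  then show ?thesis by linarith
qed

text \<open>The bound for products requires \<open>f'\<close> to be bounded on the circles where
  some \<open>f - a i\<close> is small. It is, because \<open>f'\<close> is also the derivative of
  \<open>f - a i\<close>. The zeros of \<open>f'\<close> stay on the left for later
  cancellation.\<close>

lemma height_DP_lower:
  "\<exists>C. \<forall>r\<ge>1. real (n + l - 1) * height r f + counting r (zero_div (fls_deriv f)) \<le> height r (DP f) + C"
proof -
  have "lnorm r (fls_const b * fls_deriv f) \<le> ln (v b)"
    if r: "r \<ge> 1" and i: "lnorm r (f - fls_const (a i)) < 0" for r i
  proof -
    have "fls_deriv (f - fls_const (a i)) = fls_deriv f" by simp
    then have "lnorm r (fls_deriv f) \<le> lnorm r (f - fls_const (a i)) - ln r"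
      using lnorm_deriv[of "f - fls_const (a i)" r] f deriv_nonzero r by simp
    then have "lnorm r (fls_deriv f) \<le> 0" using i r ln_ge_zero[of r] by linarith
    then show ?thesis
      using f b deriv_nonzero r by (simp add: lnorm_mult lnorm_const fls_const_nonzero)
  qed
  then show ?thesis
    using fp.height_G_lower[of "ln (v b)"] unfolding DP_G zero_div_w sum_\<mu> by blast
qed

lemma pole_div_deriv_le: "pole_div (fls_deriv f) c \<le> 2 * pole_div f c"
proof (cases "ord c f < 0")
  case True
  then show ?thesis using ord_deriv_pole[of c] by (simp add: pole_div_def)
next
  case False
  then show ?thesis using ord_deriv_nonneg[OF f(1), of c] by (simp add: pole_div_def)
qed

lemma counting_pole_div_deriv: "r \<ge> 1 \<Longrightarrow> counting r (pole_div (fls_deriv f)) \<le> 2 * counting r (pole_div f)"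
  using counting_mono[of r "pole_div (fls_deriv f)" "\<lambda>c. 2 * pole_div f c"] pole_div_deriv_le f
    counting_cmult[of r 2 "pole_div f"] by simp

text \<open>Jensen's formula for \<open>f'\<close>: a pole of order \<open>m\<close> of
  \<open>f\<close> becomes one of order \<open>m + 1 <= 2 m\<close>, and the norm of
  \<open>f'\<close> does not exceed that of \<open>f\<close>.\<close>

lemma counting_zero_div_deriv: "\<exists>C. \<forall>r\<ge>1. counting r (zero_div (fls_deriv f)) \<le> 2 * height r f + C"
proof (intro exI allI impI)
  fix r :: real assume r: "r \<ge> 1"
  show "counting r (zero_div (fls_deriv f)) \<le> 2 * height r f + \<bar>lnorm 1 (fls_deriv f)\<bar>"
    using counting_zero_div[OF _ deriv_nonzero r] f counting_pole_div_deriv[OF r]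
      lnorm_deriv_le[OF r] unfolding height_def by simp
qed

text \<open>The degree of \<open>P'\<close> accounts for \<open>n + l - 1\<close>, and the factor
  \<open>f'\<close> for the remaining 2.\<close>

lemma height_DP_upper: "\<exists>C. \<forall>r\<ge>1. height r (DP f) \<le> real (n + l + 1) * height r f + C"
proof -
  obtain C where C: "\<And>r. r \<ge> 1 \<Longrightarrow> height r (DP f) \<le> height r (fls_const b * fls_deriv f)
      + real (n + l - 1) * height r f + C"
    using fp.height_G_upper unfolding DP_G sum_\<mu> by blast
  have "height r (DP f) \<le> real (n + l + 1) * height r f + (C + \<bar>ln (v b)\<bar>)" if r: "r \<ge> 1" for r
  proof -
    have "lnorm r (fls_const b * fls_deriv f) = ln (v b) + lnorm r (fls_deriv f)"
      using f b deriv_nonzero r by (simp add: lnorm_mult lnorm_const fls_const_nonzero)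
    then have "max 0 (lnorm r (fls_const b * fls_deriv f)) \<le> max 0 (lnorm r f) + \<bar>ln (v b)\<bar>"
      using lnorm_deriv_le[OF r] by linarith
    moreover have "0 \<le> max 0 (lnorm r f)" by simp
    ultimately have "height r (fls_const b * fls_deriv f) \<le> 2 * height r f + \<bar>ln (v b)\<bar>"
      using counting_pole_div_deriv[OF r] unfolding height_def pole_div_w distrib_left by linarith
    moreover have "real (n + l + 1) = real (n + l - 1) + 2" using l by linarith
    then have "real (n + l + 1) * height r f = real (n + l - 1) * height r f + 2 * height r f"
      by (simp only: distrib_right)
    ultimately show ?thesis using C[OF r] by linarith
  qed
  then show ?thesis by blast
qed

lemma factors_le: "\<exists>C. \<forall>i\<in>{1..l}. \<forall>r\<ge>1. counting r (zero_div (f - fls_const (a i))) \<le> height r f + C"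
proof -
  have "\<forall>i. \<exists>C. \<forall>r\<ge>1. counting r (zero_div (f - fls_const (a i))) \<le> height r f + C"
    using counting_zero_div_diff_const[OF f(1)] f(2) by blast
  then obtain K where K: "\<And>i r. r \<ge> 1 \<Longrightarrow> counting r (zero_div (f - fls_const (a i))) \<le> height r f + K i"
    by metis
  have "counting r (zero_div (f - fls_const (a i))) \<le> height r f + (\<Sum>i\<in>{1..l}. \<bar>K i\<bar>)"
    if i: "i \<in> {1..l}" and r: "r \<ge> 1" for i r
  proof -
    have "K i \<le> \<bar>K i\<bar>" by simp
    also have "\<dots> \<le> (\<Sum>i\<in>{1..l}. \<bar>K i\<bar>)" using i by (intro member_le_sum) auto
    finally show ?thesis using K[OF r, of i] by simp
  qed
  then show ?thesis by blast
qed

text \<open>A majorant of the zeros of \<open>DP f\<close> truncated at 2: the \<open>n\<close>-fold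
  factor needs only the coefficient 2, and everything else keeps its multiplicity.\<close>

definition ZD :: "'a \<Rightarrow> int" where
  "ZD c = zero_div (fls_deriv f) c + 2 * zero_div (f - fls_const (a 1)) c
    + (\<Sum>i\<in>{2..l}. zero_div (f - fls_const (a i)) c)"

lemma min_zero_div_DP: "min 2 (zero_div (DP f) c) \<le> ZD c"
proof (cases "zero_div (f - fls_const (a 1)) c = 0")
  case True
  then show ?thesis by (simp add: ZD_def zero_div_DP)
next
  case False
  then have "zero_div (f - fls_const (a 1)) c \<ge> 1" using zero_div_nonneg[of "f - fls_const (a 1)" c] by linarith
  moreover have "(\<Sum>i\<in>{2..l}. zero_div (f - fls_const (a i)) c) \<ge> 0" by (intro sum_nonneg) simp
  ultimately show ?thesis
    using zero_div_nonneg[of "fls_deriv f" c] unfolding ZD_def by linarith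
qed

lemma ZD_locally_finite: "locally_finite ZD"
  unfolding ZD_def using f by simp

lemma ZD_nonneg: "ZD c \<ge> 0"
  unfolding ZD_def by (intro add_nonneg_nonneg sum_nonneg) auto

text \<open>One height for each root of \<open>P'\<close>, with \<open>a 1\<close> counted twice:
  \<open>l + 1 = 2 + (l - 1)\<close>.\<close>

lemma counting_ZD:
  "\<exists>C. \<forall>r\<ge>1. counting r ZD \<le> counting r (zero_div (fls_deriv f)) + real (l + 1) * height r f + C"
proof -
  obtain K where K: "\<And>i r. i \<in> {1..l} \<Longrightarrow> r \<ge> 1 \<Longrightarrow> counting r (zero_div (f - fls_const (a i))) \<le> height r f + K"
    using factors_le by blast
  have "counting r ZD \<le> counting r (zero_div (fls_deriv f)) + real (l + 1) * height r f + real (l + 1) * K"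
    if r: "r \<ge> 1" for r
  proof -
    have "counting r ZD = counting r (zero_div (fls_deriv f)) + 2 * counting r (zero_div (f - fls_const (a 1)))
        + (\<Sum>i\<in>{2..l}. counting r (zero_div (f - fls_const (a i))))"
      unfolding ZD_def using f r counting_cmult[of r 2 "zero_div (f - fls_const (a 1))"]
      by (simp add: counting_add counting_sum)
    also have "(\<Sum>i\<in>{2..l}. counting r (zero_div (f - fls_const (a i)))) \<le> (\<Sum>i\<in>{2..l}. height r f + K)"
      using K r by (intro sum_mono) auto
    also have "(\<Sum>i\<in>{2..l}. height r f + K) = real (l - 1) * (height r f + K)" by simp
    also have "counting r (zero_div (f - fls_const (a 1))) \<le> height r f + K" using K[of 1 r] r l by simp
    finally have "counting r ZD \<le> counting r (zero_div (fls_deriv f))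
        + 2 * (height r f + K) + real (l - 1) * (height r f + K)" by simp
    also have "\<dots> = counting r (zero_div (fls_deriv f)) + real (l + 1) * (height r f + K)"
      using l by (simp add: of_nat_diff algebra_simps)
    finally show ?thesis by (simp add: distrib_left)
  qed
  then show ?thesis by blast
qed

text \<open>With truncation at 1 each of the \<open>l\<close> roots costs one height, and the poles
  cost one more.\<close>

lemma counting_min_DP:
  "\<exists>C. \<forall>r\<ge>1. counting r (\<lambda>c. min 1 (zero_div (DP f) c)) + counting r (\<lambda>c. min 1 (pole_div (DP f) c))
    \<le> counting r (zero_div (fls_deriv f)) + real (l + 1) * height r f + C"
proof -
  obtain K where K: "\<And>r. r \<ge> 1 \<Longrightarrow>
      (\<Sum>i\<in>{1..l}. counting r (zero_div (f - fls_const (a i)))) \<le> real l * height r f + K"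
    using fp.counting_factors_le by auto
  have "counting r (\<lambda>c. min 1 (zero_div (DP f) c)) + counting r (\<lambda>c. min 1 (pole_div (DP f) c))
    \<le> counting r (zero_div (fls_deriv f)) + real (l + 1) * height r f + K" if r: "r \<ge> 1" for r
  proof -
    let ?D = "\<lambda>c. zero_div (fls_deriv f) c + (\<Sum>i\<in>{1..l}. zero_div (f - fls_const (a i)) c)"
    have "counting r (\<lambda>c. min 1 (zero_div (DP f) c)) \<le> counting r ?D"
    proof (rule counting_mono[OF r])
      show "min 1 (zero_div (DP f) c) \<le> ?D c" for c
        using fp.min_zero_div_G[of c] by (simp only: DP_G zero_div_w)
    qed (use f DP_meromorphic in simp_all)
    also have "counting r ?D = counting r (zero_div (fls_deriv f))
        + (\<Sum>i\<in>{1..l}. counting r (zero_div (f - fls_const (a i))))"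
      using f r by (simp add: counting_add counting_sum)
    also have "\<dots> \<le> counting r (zero_div (fls_deriv f)) + (real l * height r f + K)"
      using K[OF r] by simp
    finally have 1: "counting r (\<lambda>c. min 1 (zero_div (DP f) c))
        \<le> counting r (zero_div (fls_deriv f)) + (real l * height r f + K)" .
    have "counting r (\<lambda>c. min 1 (pole_div (DP f) c)) \<le> counting r (pole_div f)"
    proof (rule counting_mono[OF r])
      show "min 1 (pole_div (DP f) c) \<le> pole_div f c" for c
        using ord_DP_neg_iff[of c] by (auto simp: pole_div_def)
    qed (use f DP_meromorphic in simp_all)
    also have "\<dots> \<le> height r f" by (rule counting_pole_div_le)
    finally show ?thesis using 1 by (simp add: algebra_simps)
  qed
  then show ?thesis by blast
qed

end

end

subsection \<open>Functions with the same shared values\<close>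

context padic_field
begin

text \<open>All proofs by contradiction end here: smallness makes
  \<open>K * height r \<alpha>\<close> at most half the height of \<open>f\<close> for large
  \<open>r\<close>, and that height would remain bounded.\<close>

lemma small_wrt_contradiction:
  assumes f: "f \<in> \<M>" "f \<notin> range fls_const"
    and \<alpha>: "\<alpha> \<in> \<M>" "\<alpha> \<noteq> 0" "small_wrt v \<alpha> f"
    and le: "\<And>r. r \<ge> 1 \<Longrightarrow> height r f \<le> K * height r \<alpha> + C" and K: "K \<ge> 0"
  shows False
proof -
  define \<epsilon> where "\<epsilon> = 1 / (2 * K + 2)"
  have \<epsilon>: "\<epsilon> > 0" "K * \<epsilon> \<le> 1 / 2" using K by (auto simp: \<epsilon>_def field_simps)
  have "\<forall>\<^sub>F r in at_top. height r \<alpha> \<le> \<epsilon> * height r f"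
    using small_wrt_height[OF \<alpha>(3,1,2) f \<epsilon>(1)] .
  moreover have "\<forall>\<^sub>F r in at_top. 2 * C + 1 \<le> height r f"
    using height_at_top[OF f] by (simp add: filterlim_at_top)
  moreover have "\<forall>\<^sub>F r::real in at_top. r \<ge> 1" by (rule eventually_ge_at_top)
  ultimately have "\<forall>\<^sub>F r::real in at_top. False"
  proof eventually_elim
    case (elim r)
    have "K * height r \<alpha> \<le> K * (\<epsilon> * height r f)" using elim K by (intro mult_left_mono) auto
    also have "\<dots> = (K * \<epsilon>) * height r f" by simp
    also have "\<dots> \<le> 1 / 2 * height r f"
      using \<epsilon> height_nonneg[OF f(1) elim(3)] by (intro mult_right_mono) auto
    finally show ?case using le[OF elim(3)] elim(2) by linarith
  qed
  then show False by simp
qed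

lemma locally_finite_abs_ord: "h \<in> \<M> \<Longrightarrow> locally_finite (\<lambda>c. \<bar>ord c h\<bar>)"
  by (rule locally_finite_subset[of "\<lambda>c. ord c h"]) auto

lemma counting_abs_ord:
  assumes "h \<in> \<M>" "h \<noteq> 0" "r \<ge> 1"
  shows "counting r (\<lambda>c. \<bar>ord c h\<bar>) \<le> 2 * height r h + \<bar>lnorm 1 h\<bar>"
proof -
  have "(\<lambda>c. \<bar>ord c h\<bar>) = (\<lambda>c. zero_div h c + pole_div h c)"
    by (auto simp: zero_div_def pole_div_def)
  then have "counting r (\<lambda>c. \<bar>ord c h\<bar>) = counting r (zero_div h) + counting r (pole_div h)"
    using assms by (simp add: counting_add)
  then show ?thesis
    using counting_zero_div_le[OF assms] counting_pole_div_le[of r h] by linarith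
qed

lemma ord_diff_pole:
  assumes "h \<in> \<M>" "k \<in> \<M>" "ord c h < 0" "ord c k = 0"
  shows "ord c (h - k) = ord c h"
proof -
  have "ord_ge c (ord c h) (h - k)" using assms by (intro ord_ge_diff) (auto simp: ord_ge_def)
  moreover have nz: "h - k \<noteq> 0" using assms by auto
  moreover have "\<not> ord c h + 1 \<le> ord c (h - k)"
  proof
    assume "ord c h + 1 \<le> ord c (h - k)"
    then have "ord_ge c (ord c h + 1) ((h - k) + k)"
      using assms by (intro ord_ge_add) (auto simp: ord_ge_def)
    then show False using assms by (auto simp: ord_ge_def)
  qed
  ultimately show ?thesis by (auto simp: ord_ge_def)
qed

lemma ord_diff_regular:
  assumes "h \<in> \<M>" "k \<in> \<M>" "ord c h \<ge> 0" "ord c k = 0"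
  shows "ord c (h - k) \<ge> 0"
proof -
  have "ord_ge c 0 (h - k)" using assms by (intro ord_ge_diff) (auto simp: ord_ge_def)
  then show ?thesis by (cases "h - k = 0") (auto simp: ord_ge_def)
qed

text \<open>With a constant third entry the determinant is, up to sign, the Wronskian of
  \<open>x'\<close> and \<open>h'\<close>. When it vanishes, either \<open>h\<close> is constant or
  \<open>x'\<close> is a constant multiple of \<open>h'\<close>, which integrates to a linear
  relation.\<close>

lemma wronskian3_const_eq_0:
  assumes "wronskian3 x h (- 1) = 0"
  obtains c1 c2 c3 where "fls_const c1 * x + fls_const c2 * h + fls_const c3 = 0" "c1 \<noteq> 0 \<or> c2 \<noteq> 0"
proof (cases "fls_deriv h = 0")
  case True
  then obtain k where "h = fls_const k" by (auto simp: fls_deriv_eq_0_iff)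
  then show thesis using that[of 0 1 "- k"] by simp
next
  case False
  have "wronskian2 (fls_deriv x) (fls_deriv h) = 0"
    using assms by (simp add: wronskian3_def wronskian2_def)
  then obtain k where "fls_deriv x / fls_deriv h = fls_const k"
    using wronskian2_eq_0[OF _ False] by auto
  then have "fls_deriv x = fls_const k * fls_deriv h" using False by (simp add: field_simps)
  then have "fls_deriv (x - fls_const k * h) = 0" by (simp add: fls_deriv_mult_const_left)
  then obtain d where "x - fls_const k * h = fls_const d" by (metis fls_deriv_eq_0_iff)
  then show thesis using that[of 1 "- k" "- d"] by (simp add: algebra_simps)
qed

end

text \<open>The local estimate for Cartan's theorem at a point where \<alpha> has order 0.
  \<open>F\<close> and \<open>G\<close> are the orders of the two functions, \<open>u\<close> and
  \<open>w\<close> those of their differences with \<alpha>, and \<open>u - w\<close> is the order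
  of \<open>h\<close>. If both are regular, sharing gives \<open>u = w\<close>, so \<open>h\<close>
  is a unit. At a pole of one of them, sharing keeps the other difference from vanishing, and each
  pole adds at most 2.\<close>

lemma shared_orders_bound:
  fixes F G u w :: int
  assumes "nat u = nat w" "F \<ge> 0 \<Longrightarrow> u \<ge> 0" "F < 0 \<Longrightarrow> u = F" "G \<ge> 0 \<Longrightarrow> w \<ge> 0" "G < 0 \<Longrightarrow> w = G"
  defines "m \<equiv> min F (min (u - w) 0)"
  shows "min 2 (F - m) + min 2 (u - w - m) + min 2 (0 - m) + min 2 (u - w + G - m)
    \<le> 2 * min 1 (max 0 (- F)) + 2 * min 1 (max 0 (- G)) + min 2 (max 0 F) + min 2 (max 0 G)"
proof -
  consider "F \<ge> 0" "G \<ge> 0" | "F \<ge> 0" "G < 0" | "F < 0" "G \<ge> 0" | "F < 0" "G < 0" by linarith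
  then show ?thesis
  proof cases
    case 1
    then have "u = w" using assms by (simp add: eq_nat_nat_iff)
    then show ?thesis using 1 by (simp add: m_def)
  next
    case 2
    then have "w = G" "u = 0" using assms by auto
    then show ?thesis using 2 by (simp add: m_def)
  next
    case 3
    then have "u = F" "w = 0" using assms by auto
    then show ?thesis using 3 by (simp add: m_def)
  next
    case 4
    then have "w = G" "u = F" using assms by auto
    then show ?thesis using 4 by (simp add: m_def)
  qed
qed

section \<open>Quotients by the small function, and Cartan's theorem for the shared value\<close>

context uniqueness_setup
begin

context
  fixes f \<alpha> :: "'a fls"
  assumes f: "f \<in> \<M>" "f \<notin> range fls_const"
    and \<alpha>: "\<alpha> \<in> \<M>" "\<alpha> \<noteq> 0"
begin

lemma height_DP_quot_lower:
  "\<exists>C. \<forall>r\<ge>1. real (n + l - 1) * height r f + counting r (zero_div (fls_deriv f))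
    \<le> height r (DP f / \<alpha>) + height r \<alpha> + C"
proof -
  obtain C where C: "\<And>r. r \<ge> 1 \<Longrightarrow> real (n + l - 1) * height r f + counting r (zero_div (fls_deriv f))
      \<le> height r (DP f) + C" using height_DP_lower[OF f] by blast
  have "real (n + l - 1) * height r f + counting r (zero_div (fls_deriv f))
    \<le> height r (DP f / \<alpha>) + height r \<alpha> + C" if r: "r \<ge> 1" for r
  proof -
    have "height r (DP f / \<alpha> * \<alpha>) \<le> height r (DP f / \<alpha>) + height r \<alpha>"
      using DP_meromorphic[OF f] DP_nonzero[OF f] \<alpha> r by (intro height_mult) auto
    then show ?thesis using C[OF r] \<alpha> by simp
  qed
  then show ?thesis by blast
qed

lemma height_DP_quot_upper:
  "\<exists>C. \<forall>r\<ge>1. height r (DP f / \<alpha>) \<le> real (n + l + 1) * height r f + height r \<alpha> + C"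
proof -
  obtain C where C: "\<And>r. r \<ge> 1 \<Longrightarrow> height r (DP f) \<le> real (n + l + 1) * height r f + C"
    using height_DP_upper[OF f] by blast
  have "height r (DP f / \<alpha>) \<le> real (n + l + 1) * height r f + height r \<alpha> + (C - lnorm 1 \<alpha>)"
    if r: "r \<ge> 1" for r
  proof -
    have "height r (DP f * inverse \<alpha>) \<le> height r (DP f) + height r (inverse \<alpha>)"
      using DP_meromorphic[OF f] DP_nonzero[OF f] \<alpha> r by (intro height_mult) auto
    then show ?thesis using C[OF r] height_inverse[OF \<alpha> r] by (simp add: divide_inverse)
  qed
  then show ?thesis by blast
qed

text \<open>Division by \<alpha> alters each of the two truncated counts by at most the divisor of
  absolute orders of \<alpha>, which costs two heights of \<alpha> each time.\<close>

lemma counting_min_DP_quot: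
  "\<exists>C. \<forall>r\<ge>1. counting r (\<lambda>c. min 1 (zero_div (DP f / \<alpha>) c)) + counting r (\<lambda>c. min 1 (pole_div (DP f / \<alpha>) c))
    \<le> counting r (zero_div (fls_deriv f)) + real (l + 1) * height r f + 4 * height r \<alpha> + C"
proof -
  obtain C where C: "\<And>r. r \<ge> 1 \<Longrightarrow> counting r (\<lambda>c. min 1 (zero_div (DP f) c)) + counting r (\<lambda>c. min 1 (pole_div (DP f) c))
    \<le> counting r (zero_div (fls_deriv f)) + real (l + 1) * height r f + C"
    using counting_min_DP[OF f] by blast
  note DP = DP_meromorphic[OF f] DP_nonzero[OF f]
  have M: "DP f / \<alpha> \<in> \<M>" using DP \<alpha> by simp
  have ord: "ord c (DP f / \<alpha>) = ord c (DP f) - ord c \<alpha>" for c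
    using DP \<alpha> by (simp add: ord_divide)
  have "counting r (\<lambda>c. min 1 (zero_div (DP f / \<alpha>) c)) + counting r (\<lambda>c. min 1 (pole_div (DP f / \<alpha>) c))
    \<le> counting r (zero_div (fls_deriv f)) + real (l + 1) * height r f + 4 * height r \<alpha> + (C + 2 * \<bar>lnorm 1 \<alpha>\<bar>)"
    if r: "r \<ge> 1" for r
  proof -
    have lf: "locally_finite (\<lambda>c. \<bar>ord c \<alpha>\<bar>)" by (rule locally_finite_abs_ord[OF \<alpha>(1)])
    have 1: "counting r (\<lambda>c. min 1 (zero_div (DP f / \<alpha>) c)) \<le> counting r (\<lambda>c. min 1 (zero_div (DP f) c) + \<bar>ord c \<alpha>\<bar>)"
    proof (rule counting_mono[OF r])
      show "min 1 (zero_div (DP f / \<alpha>) c) \<le> min 1 (zero_div (DP f) c) + \<bar>ord c \<alpha>\<bar>" for c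
        unfolding zero_div_def ord by linarith
    qed (use M DP lf in simp_all)
    have 2: "counting r (\<lambda>c. min 1 (pole_div (DP f / \<alpha>) c)) \<le> counting r (\<lambda>c. min 1 (pole_div (DP f) c) + \<bar>ord c \<alpha>\<bar>)"
    proof (rule counting_mono[OF r])
      show "min 1 (pole_div (DP f / \<alpha>) c) \<le> min 1 (pole_div (DP f) c) + \<bar>ord c \<alpha>\<bar>" for c
        unfolding pole_div_def ord by linarith
    qed (use M DP lf in simp_all)
    show ?thesis
      using 1 2 C[OF r] counting_abs_ord[OF \<alpha> r] lf DP r by (simp add: counting_add)
  qed
  then show ?thesis by blast
qed

text \<open>Otherwise the lower bound for \<open>DP f / \<alpha>\<close> would bound the height of
  \<open>f\<close> by that of \<alpha>.\<close>

lemma DP_quot_nonconst: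
  assumes "small_wrt v \<alpha> f"
  shows "DP f / \<alpha> \<notin> range fls_const"
proof
  assume "DP f / \<alpha> \<in> range fls_const"
  then obtain k where k: "DP f / \<alpha> = fls_const k" by auto
  obtain C where C: "\<And>r. r \<ge> 1 \<Longrightarrow> real (n + l - 1) * height r f + counting r (zero_div (fls_deriv f))
    \<le> height r (DP f / \<alpha>) + height r \<alpha> + C" using height_DP_quot_lower by blast
  have "height r f \<le> 1 * height r \<alpha> + (C + max 0 (ln (v k)))" if r: "r \<ge> 1" for r
  proof -
    have "pole_div (fls_const k) = (\<lambda>c. 0)" by (auto simp: pole_div_def)
    then have "height r (fls_const k) = max 0 (ln (v k))" using r by (simp add: height_def lnorm_const)
    moreover have "0 \<le> counting r (zero_div (fls_deriv f))"
      using f r by (intro counting_nonneg) auto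
    moreover have "1 * height r f \<le> real (n + l - 1) * height r f"
      using height_nonneg[OF f(1) r] l by (intro mult_right_mono) auto
    ultimately show ?thesis using C[OF r] unfolding k by linarith
  qed
  then show False using small_wrt_contradiction[OF f \<alpha> assms, of 1 "C + max 0 (ln (v k))"] by simp
qed

end

text \<open>Cartan's characteristic \<open>X\<close> of \<open>[x : h : -1]\<close> dominates the
  height of \<open>x\<close>, by comparison with the last coordinate. As the coordinates sum to
  \<open>h * y\<close>, it also dominates the height of \<open>y = h * y / h\<close>.\<close>

lemma cartan_case:
  assumes f: "f \<in> \<M>" "f \<notin> range fls_const"
    and g: "g \<in> \<M>" "g \<notin> range fls_const"
    and \<alpha>: "\<alpha> \<in> \<M>" "\<alpha> \<noteq> 0" and small: "small_wrt v \<alpha> f"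
    and share: "share_CM v \<alpha> (DP f) (DP g)"
    and nz: "DP f \<noteq> \<alpha>" "DP g \<noteq> \<alpha>"
  defines "h \<equiv> (DP f - \<alpha>) / (DP g - \<alpha>)"
  shows "wronskian3 (DP f / \<alpha>) h (- 1) = 0"
proof (rule ccontr)
  assume W: "wronskian3 (DP f / \<alpha>) h (- 1) \<noteq> 0"
  define x y where "x = DP f / \<alpha>" and "y = DP g / \<alpha>"
  note F = DP_meromorphic[OF f] DP_nonzero[OF f] and G = DP_meromorphic[OF g] DP_nonzero[OF g]
  have M: "x \<in> \<M>" "y \<in> \<M>" "h \<in> \<M>" "- 1 \<in> \<M>"
    using F G \<alpha> by (auto simp: x_def y_def h_def)
  have nz': "x \<noteq> 0" "y \<noteq> 0" "h \<noteq> 0" using F G \<alpha> nz by (auto simp: x_def y_def h_def)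
  have sum: "x + h + - 1 = h * y"
  proof -
    have "h * (DP g - \<alpha>) = DP f - \<alpha>" using nz by (simp add: h_def)
    then have "h * y - h = x - 1" using \<alpha> by (simp add: x_def y_def field_simps)
    then show ?thesis by (simp add: algebra_simps)
  qed
  have sum0: "x + h + - 1 \<noteq> 0" unfolding sum using nz' by simp
  define m where "m = (\<lambda>c. min (ord c x) (min (ord c h) (ord c (- 1))))"
  define E where "E = (\<lambda>c. min 2 (ord c x - m c) + min 2 (ord c h - m c)
      + min 2 (ord c (- 1) - m c) + min 2 (ord c (h * y) - m c))"
  define X where "X = (\<lambda>r. max (lnorm r x) (max (lnorm r h) (lnorm r (- 1))) - counting r m)"
  obtain c4 where c4: "\<And>r. r \<ge> 1 \<Longrightarrow> X r \<le> counting r E + c4"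
    using truncated_cartan[of x h "- 1"] M nz' sum0 W[folded x_def]
    unfolding X_def E_def m_def sum by fastforce
  have ord1: "ord c (- 1) = 0" for c using ord_const[of c "- 1"] by simp
  have lm: "locally_finite m" unfolding m_def using M by simp
  have lE: "locally_finite E"
  proof -
    have L: "locally_finite (\<lambda>c. min 2 (ord c k - m c))" if "k \<in> \<M>" for k
      using that lm by (rule_tac locally_finite_subset2[of "\<lambda>c. ord c k" m]) auto
    show ?thesis unfolding E_def by (intro locally_finite_add L) (use M in auto)
  qed
  define D where "D = (\<lambda>c. 2 * min 1 (pole_div f c) + 2 * min 1 (pole_div g c) + ZD f c + ZD g c + 8 * \<bar>ord c \<alpha>\<bar>)"
  have ED: "E c \<le> D c" for c
  proof (cases "ord c \<alpha> = 0")
    case False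
    \<comment> \<open>Four terms truncated at 2; a point in the divisor of \<alpha> is charged to
      \<alpha> as a whole.\<close>
    have "E c \<le> 8" unfolding E_def by linarith
    also have "8 \<le> 8 * \<bar>ord c \<alpha>\<bar>" using False by simp
    also have "\<dots> \<le> D c"
      using ZD_nonneg[OF f, of c] ZD_nonneg[OF g, of c] pole_div_nonneg[of f c] pole_div_nonneg[of g c]
      unfolding D_def by linarith
    finally show ?thesis .
  next
    case True
    define u w where "u = ord c (DP f - \<alpha>)" and "w = ord c (DP g - \<alpha>)"
    have ox: "ord c x = ord c (DP f)" and oy: "ord c y = ord c (DP g)"
      using True F G \<alpha> by (simp_all add: x_def y_def ord_divide)
    have oh: "ord c h = u - w"
      unfolding h_def u_def w_def using F G \<alpha> nz by (intro ord_divide) auto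
    have ohy: "ord c (h * y) = u - w + ord c (DP g)"
      using M nz' by (simp add: ord_mult oh oy)
    have "zero_multiplicity v c (DP f - \<alpha>) = zero_multiplicity v c (DP g - \<alpha>)"
      using share by (simp add: share_CM_def)
    then have "nat u = nat w" using nz by (simp add: zero_multiplicity_def u_def w_def)
    then have "min 2 (ord c (DP f) - m c) + min 2 (u - w - m c) + min 2 (0 - m c) + min 2 (u - w + ord c (DP g) - m c)
        \<le> 2 * min 1 (max 0 (- ord c (DP f))) + 2 * min 1 (max 0 (- ord c (DP g)))
          + min 2 (max 0 (ord c (DP f))) + min 2 (max 0 (ord c (DP g)))"
      unfolding m_def ox oh ord1
      using ord_diff_pole[OF F(1) \<alpha>(1)] ord_diff_pole[OF G(1) \<alpha>(1)]
        ord_diff_regular[OF F(1) \<alpha>(1)] ord_diff_regular[OF G(1) \<alpha>(1)] True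
      by (intro shared_orders_bound) (auto simp: u_def w_def)
    also have "\<dots> \<le> D c"
      using min_zero_div_DP[OF f, of c] min_zero_div_DP[OF g, of c]
        ord_DP_neg_iff[OF f, of c] ord_DP_neg_iff[OF g, of c] True
      unfolding D_def zero_div_def pole_div_def by (auto simp: min_def max_def split: if_splits)
    finally show ?thesis unfolding E_def ox oh ohy ord1 by simp
  qed
  obtain c1 where c1: "\<And>r. r \<ge> 1 \<Longrightarrow> real (n + l - 1) * height r f + counting r (zero_div (fls_deriv f))
    \<le> height r x + height r \<alpha> + c1" using height_DP_quot_lower[OF f \<alpha>] unfolding x_def by blast
  obtain c1' where c1': "\<And>r. r \<ge> 1 \<Longrightarrow> real (n + l - 1) * height r g + counting r (zero_div (fls_deriv g))
    \<le> height r y + height r \<alpha> + c1'" using height_DP_quot_lower[OF g \<alpha>] unfolding y_def by blast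
  obtain c6 where c6: "\<And>r. r \<ge> 1 \<Longrightarrow> counting r (ZD f) \<le> counting r (zero_div (fls_deriv f)) + real (l + 1) * height r f + c6"
    using counting_ZD[OF f] by blast
  obtain c6' where c6': "\<And>r. r \<ge> 1 \<Longrightarrow> counting r (ZD g) \<le> counting r (zero_div (fls_deriv g)) + real (l + 1) * height r g + c6'"
    using counting_ZD[OF g] by blast
  obtain c8 where c8: "\<And>r. r \<ge> 1 \<Longrightarrow> counting r (zero_div (fls_deriv f)) \<le> 2 * height r f + c8"
    using counting_zero_div_deriv[OF f] by blast
  obtain c8' where c8': "\<And>r. r \<ge> 1 \<Longrightarrow> counting r (zero_div (fls_deriv g)) \<le> 2 * height r g + c8'"
    using counting_zero_div_deriv[OF g] by blast
  \<comment> \<open>The bound for \<open>E\<close> is used twice, for \<open>x\<close> and for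
    \<open>y\<close>. So the divisor of \<alpha> enters 16 times at two heights each; the two lower
    bounds add 2, which makes 34.\<close>
  have "height r f \<le> 34 * height r \<alpha> + (c1 + c1' - lnorm 1 h + 2 * c4 + 2 * c6 + 2 * c6' + 16 * \<bar>lnorm 1 \<alpha>\<bar> + c8 + c8')"
    if r: "r \<ge> 1" for r
  proof -
    have Xx: "height r x \<le> X r"
    proof -
      have "counting r (pole_div x) \<le> counting r (\<lambda>c. - 1 * m c)"
      proof (rule counting_mono[OF r])
        show "pole_div x c \<le> - 1 * m c" for c unfolding pole_div_def m_def ord1 by linarith
      qed (use M lm locally_finite_cmult[of m "- 1"] in auto)
      then have "counting r (pole_div x) \<le> - counting r m" using counting_cmult[of r "- 1" m] by simp
      moreover have "lnorm r (- 1) = 0" using r lnorm_uminus[of 1 r] by simp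
      ultimately show ?thesis unfolding X_def height_def by simp
    qed
    have Xy: "height r y \<le> X r - lnorm 1 h"
    proof -
      let ?MX = "max (lnorm r x) (max (lnorm r h) (lnorm r (- 1)))"
      have "lnorm r (x + h + - 1) \<le> ?MX"
      proof (rule lnorm_add)
        show "lnorm r (x + h) \<le> ?MX" if "x + h \<noteq> 0"
          by (rule lnorm_add) (use that M r in auto)
      qed (use M r sum0 in auto)
      then have "max (lnorm r (h * y)) (lnorm r h) \<le> ?MX" unfolding sum by simp
      moreover have "counting r m \<le> counting r (\<lambda>c. min (ord c (h * y)) (ord c h))"
      proof (rule counting_mono[OF r])
        fix c
        have "ord_ge c (m c) (x + h + - 1)"
          using M by (intro ord_ge_add) (auto simp: ord_ge_def m_def)
        then have "m c \<le> ord c (h * y)" using sum0 unfolding sum by (simp add: ord_ge_def)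
        then show "m c \<le> min (ord c (h * y)) (ord c h)" by (simp add: m_def)
      qed (use M lm in auto)
      ultimately have "pair_height r (h * y) h \<le> X r" unfolding pair_height_def X_def by linarith
      moreover have "height r (h * y / h) = pair_height r (h * y) h - lnorm 1 h"
        using M nz' r by (intro height_divide) auto
      ultimately show ?thesis using nz' by simp
    qed
    have "counting r E \<le> counting r D"
    proof (rule counting_mono[OF r lE _ ED])
      show "locally_finite D"
        unfolding D_def using f g ZD_locally_finite[OF f] ZD_locally_finite[OF g] locally_finite_abs_ord[OF \<alpha>(1)]
        by simp
    qed
    also have "counting r D = 2 * counting r (\<lambda>c. min 1 (pole_div f c)) + 2 * counting r (\<lambda>c. min 1 (pole_div g c))
        + counting r (ZD f) + counting r (ZD g) + 8 * counting r (\<lambda>c. \<bar>ord c \<alpha>\<bar>)"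
    proof -
      have "counting r (\<lambda>c. 2 * k c) = 2 * counting r k" "counting r (\<lambda>c. 8 * k c) = 8 * counting r k" for k
        using counting_cmult[of r 2 k] counting_cmult[of r 8 k] by simp_all
      then show ?thesis
        unfolding D_def using f g r ZD_locally_finite[OF f] ZD_locally_finite[OF g] locally_finite_abs_ord[OF \<alpha>(1)]
        by (simp add: counting_add)
    qed
    also have "counting r (\<lambda>c. min 1 (pole_div f c)) \<le> height r f"
      by (rule order_trans[OF counting_mono[OF r] counting_pole_div_le]) (use f in auto)
    also have "counting r (\<lambda>c. min 1 (pole_div g c)) \<le> height r g"
      by (rule order_trans[OF counting_mono[OF r] counting_pole_div_le]) (use g in auto)
    finally have EE: "counting r E \<le> 2 * height r f + 2 * height r g + counting r (ZD f) + counting r (ZD g)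
        + 8 * counting r (\<lambda>c. \<bar>ord c \<alpha>\<bar>)" by simp
    have T0: "0 \<le> height r f" "0 \<le> height r g" using height_nonneg f g r by auto
    \<comment> \<open>Cartan's inequality uses up \<open>2 l + 8\<close> heights of \<open>f\<close>
      and of \<open>g\<close>; one of each is left.\<close>
    have N: "real (2 * l + 9) * t \<le> real (n + l - 1) * t" if "0 \<le> t" for t
      using that n l by (intro mult_right_mono) auto
    have split: "real (2 * l + 9) * t = 2 * (real l * t) + 9 * t" "real (l + 1) * t = real l * t + t" for t
      by (simp_all add: algebra_simps)
    show ?thesis
      using c1[OF r] c1'[OF r] Xx Xy c4[OF r] EE c6[OF r] c6'[OF r] counting_abs_ord[OF \<alpha> r]
        c8[OF r] c8'[OF r] N[OF T0(1)] N[OF T0(2)] T0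
      unfolding split by linarith
  qed
  then show False using small_wrt_contradiction[OF f \<alpha> small, of 34] by fastforce
qed

section \<open>Moebius relations between meromorphic functions\<close>

lemma ord_const_plus:
  assumes "u \<in> \<M>" "ord_ge c 1 u" "k \<noteq> 0"
  shows "ord c (fls_const k + u) = 0"
proof (rule ccontr)
  assume *: "ord c (fls_const k + u) \<noteq> 0"
  have "ord_ge c 0 (fls_const k + u)"
    using assms ord_ge_mono[OF assms(2), of 0] by (intro ord_ge_add) (auto simp: ord_ge_def)
  then have "ord_ge c 1 (fls_const k + u)" using * by (auto simp: ord_ge_def)
  then have "ord_ge c 1 ((fls_const k + u) - u)" using assms by (intro ord_ge_diff[OF _ _ _ assms(2)]) auto
  then show False using assms(3) by (simp add: ord_ge_def fls_const_nonzero)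
qed

lemma ord_ge_cmult: "u \<in> \<M> \<Longrightarrow> ord_ge c j u \<Longrightarrow> ord_ge c j (fls_const k * u)"
  using ord_ge_mult[of "fls_const k" u c 0 j] by (simp add: ord_ge_def)

text \<open>Numerator and denominator have no poles beyond those of \<open>y\<close>, with
  multiplicity, and their norms are bounded by that of \<open>y\<close> up to constants; so the
  height of the pair is at most that of \<open>y\<close>.\<close>

lemma height_linear_quot:
  assumes y: "y \<in> \<M>" "y \<notin> range fls_const"
    and nz: "fls_const p + fls_const s * y \<noteq> 0" "fls_const q + fls_const t * y \<noteq> 0"
  shows "\<exists>C. \<forall>r\<ge>1. height r ((fls_const p + fls_const s * y) / (fls_const q + fls_const t * y)) \<le> height r y + C"
proof -
  let ?u = "fls_const p + fls_const s * y" and ?w = "fls_const q + fls_const t * y"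
  have y0: "y \<noteq> 0" using notin_range_fls_const[OF y(2)] by blast
  have M: "?u \<in> \<M>" "?w \<in> \<M>" using y by auto
  have L: "lnorm r (fls_const d + fls_const e * y) \<le> max 0 (lnorm r y) + (\<bar>ln (v d)\<bar> + \<bar>ln (v e)\<bar>)"
    if "r \<ge> 1" "fls_const d + fls_const e * y \<noteq> 0" for r d e
  proof (rule lnorm_add)
    assume "fls_const e * y \<noteq> 0"
    then have "lnorm r (fls_const e * y) = ln (v e) + lnorm r y"
      using y y0 that by (simp add: lnorm_mult lnorm_const)
    then show "lnorm r (fls_const e * y) \<le> max 0 (lnorm r y) + (\<bar>ln (v d)\<bar> + \<bar>ln (v e)\<bar>)" by linarith
  qed (use that y in \<open>auto simp: lnorm_const\<close>)
  have O: "ord c (fls_const d + fls_const e * y) \<ge> - pole_div y c"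
    if "fls_const d + fls_const e * y \<noteq> 0" for c d e
  proof -
    have "ord_ge c (- pole_div y c) (fls_const d + fls_const e * y)"
      using y y0 by (intro ord_ge_add ord_ge_cmult) (auto simp: ord_ge_def pole_div_def)
    then show ?thesis using that by (simp add: ord_ge_def)
  qed
  have "height r (?u / ?w) \<le> height r y
      + (\<bar>ln (v p)\<bar> + \<bar>ln (v s)\<bar> + \<bar>ln (v q)\<bar> + \<bar>ln (v t)\<bar> - lnorm 1 ?w)" if r: "r \<ge> 1" for r
  proof -
    have "counting r (\<lambda>c. - 1 * pole_div y c) \<le> counting r (\<lambda>c. min (ord c ?u) (ord c ?w))"
    proof (rule counting_mono[OF r])
      show "- 1 * pole_div y c \<le> min (ord c ?u) (ord c ?w)" for c
        using O[OF nz(1), of c] O[OF nz(2), of c] by simp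
    qed (use M y locally_finite_cmult[of "pole_div y" "- 1"] in auto)
    then have "- counting r (pole_div y) \<le> counting r (\<lambda>c. min (ord c ?u) (ord c ?w))"
      using counting_cmult[of r "- 1" "pole_div y"] by simp
    then show ?thesis
      using height_divide[OF M nz r] L[OF r nz(1)] L[OF r nz(2)]
      unfolding pair_height_def height_def by linarith
  qed
  then show ?thesis by blast
qed

text \<open>The relation reads \<open>x (q + t y) = - (p + s y)\<close>, and since the determinant
  is nonzero the two linear forms do not vanish for the same \<open>y\<close>. At a zero of
  \<open>y - e\<close>, one form vanishes and the other is a unit, so \<open>x\<close> has a zero or
  a pole there.\<close>

lemma zeros_moebius:
  assumes M: "x \<in> \<M>" "y \<in> \<M>" and y: "y \<notin> range fls_const" and x: "x \<noteq> 0"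
    and rel: "fls_const p + fls_const q * x + fls_const s * y + fls_const t * (x * y) = 0"
    and det: "p * t \<noteq> q * s"
  shows "s \<noteq> 0 \<Longrightarrow> p + s * e = 0 \<Longrightarrow> min 1 (zero_div (y - fls_const e) c) \<le> min 1 (zero_div x c)"
    and "t \<noteq> 0 \<Longrightarrow> q + t * e = 0 \<Longrightarrow> min 1 (zero_div (y - fls_const e) c) \<le> min 1 (pole_div x c)"
proof -
  have prod: "x * (fls_const q + fls_const t * y) = - (fls_const p + fls_const s * y)"
  proof -
    have "x * (fls_const q + fls_const t * y) + (fls_const p + fls_const s * y) = 0"
      using rel by (simp add: algebra_simps)
    then show ?thesis by (simp only: eq_neg_iff_add_eq_0)
  qed
  have shift: "fls_const d + fls_const k * y = fls_const (d + k * z) + fls_const k * (y - fls_const z)" for d k z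
    by (simp add: algebra_simps flip: fls_plus_const fls_const_mult_const)
  have ny: "y - fls_const z \<noteq> 0" for z using y by auto
  have My: "y - fls_const z \<in> \<M>" for z using M by simp
  have nsing: "p + s * e \<noteq> 0 \<or> q + t * e \<noteq> 0"
  proof (rule ccontr)
    assume "\<not> ?thesis"
    then have "p = - (s * e)" "q = - (t * e)" by (simp_all add: eq_neg_iff_add_eq_0)
    then show False using det by simp
  qed
  show "min 1 (zero_div (y - fls_const e) c) \<le> min 1 (zero_div x c)" if ps: "s \<noteq> 0" "p + s * e = 0"
  proof (cases "ord c (y - fls_const e) > 0")
    case False
    then show ?thesis by (simp add: zero_div_def)
  next
    case True
    have k: "q + t * e \<noteq> 0" using nsing ps by simp
    have "ord_ge c 1 (fls_const t * (y - fls_const e))"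
      using True My by (intro ord_ge_cmult) (auto simp: ord_ge_def)
    then have 1: "ord c (fls_const q + fls_const t * y) = 0"
      unfolding shift[of q t e] using k My by (intro ord_const_plus) auto
    have 2: "fls_const p + fls_const s * y = fls_const s * (y - fls_const e)"
      unfolding shift[of p s e] using ps by simp
    have n1: "fls_const s * (y - fls_const e) \<noteq> 0" using ny ps by (simp add: fls_const_nonzero)
    then have n2: "fls_const q + fls_const t * y \<noteq> 0" using prod unfolding 2 by auto
    have "ord c x + ord c (fls_const q + fls_const t * y) = ord c (x * (fls_const q + fls_const t * y))"
      using M x n2 by (subst ord_mult) auto
    also have "\<dots> = ord c (fls_const s * (y - fls_const e))"
      unfolding prod 2 using My by (intro ord_uminus) auto
    also have "\<dots> = ord c (y - fls_const e)"
      using My ny ps by (subst ord_mult) (auto simp: fls_const_nonzero)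
    finally show ?thesis using 1 True by (simp add: zero_div_def)
  qed
  show "min 1 (zero_div (y - fls_const e) c) \<le> min 1 (pole_div x c)" if tq: "t \<noteq> 0" "q + t * e = 0"
  proof (cases "ord c (y - fls_const e) > 0")
    case False
    then show ?thesis by (simp add: zero_div_def)
  next
    case True
    have k: "p + s * e \<noteq> 0" using nsing tq by simp
    have "ord_ge c 1 (fls_const s * (y - fls_const e))"
      using True My by (intro ord_ge_cmult) (auto simp: ord_ge_def)
    then have 1: "ord c (fls_const p + fls_const s * y) = 0"
      unfolding shift[of p s e] using k My by (intro ord_const_plus) auto
    have 2: "fls_const q + fls_const t * y = fls_const t * (y - fls_const e)"
      unfolding shift[of q t e] using tq by simp
    have n1: "fls_const t * (y - fls_const e) \<noteq> 0" using ny tq by (simp add: fls_const_nonzero)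
    have "ord c x + ord c (y - fls_const e) = ord c x + ord c (fls_const t * (y - fls_const e))"
      using My ny tq ord_mult[of "fls_const t" "y - fls_const e" c] by (simp add: fls_const_nonzero)
    also have "\<dots> = ord c (x * (fls_const t * (y - fls_const e)))"
      using M My x n1 by (subst ord_mult) auto
    also have "\<dots> = ord c (- (fls_const p + fls_const s * y))" using prod unfolding 2 by simp
    also have "\<dots> = 0" using 1 M ord_uminus[of "fls_const p + fls_const s * y" c] by simp
    finally show ?thesis using True by (simp add: pole_div_def)
  qed
qed

end

context uniqueness_setup
begin

text \<open>\<open>X\<close> and \<open>Y\<close> stand for \<open>l + 3\<close> times the heights
  of \<open>f\<close> and \<open>g\<close>, and \<open>t\<close> for the height of \<open>g\<close>.
  The surplus \<open>2 * t\<close> in \<open>U\<close> against the single \<open>t\<close> on the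
  right of the bound for \<open>X\<close> gives the result.\<close>

lemma moebius_linear_arith:
  fixes X Y U V t d e :: real
  assumes "X \<le> Y + 1 / 2 * (2 * t + d)" "U \<le> V" "U = Y + 2 * t" "V \<le> X + e + k" "0 \<le> d"
  shows "t \<le> d + e + k"
  using assms by (simp add: field_simps)

text \<open>By \<open>ne\<close>, the value of \<open>y\<close> at which \<open>x\<close> vanishes,
  or that at which \<open>x\<close> has a pole, is neither 0 nor infinity, so it can serve as the
  third value \<open>e\<close>. Its truncated count is then bounded by zeros and poles of
  \<open>x\<close>, and the heights of \<open>f\<close> and \<open>g\<close> are compared through
  those of \<open>x\<close> and \<open>y\<close>.\<close>

lemma moebius_case:
  assumes f: "f \<in> \<M>" "f \<notin> range fls_const"
    and g: "g \<in> \<M>" "g \<notin> range fls_const"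
    and \<alpha>: "\<alpha> \<in> \<M>" "\<alpha> \<noteq> 0" and small: "small_wrt v \<alpha> f" "small_wrt v \<alpha> g"
    and rel: "fls_const p + fls_const q * (DP f / \<alpha>) + fls_const s * (DP g / \<alpha>)
      + fls_const t * (DP f / \<alpha> * (DP g / \<alpha>)) = 0"
    and det: "p * t \<noteq> q * s" and ne: "p \<noteq> 0 \<and> s \<noteq> 0 \<or> t \<noteq> 0 \<and> q \<noteq> 0"
  shows False
proof -
  define x y where "x = DP f / \<alpha>" and "y = DP g / \<alpha>"
  note F = DP_meromorphic[OF f] DP_nonzero[OF f] and G = DP_meromorphic[OF g] DP_nonzero[OF g]
  have M: "x \<in> \<M>" "y \<in> \<M>" using F G \<alpha> by (auto simp: x_def y_def)
  have x0: "x \<noteq> 0" using F \<alpha> by (auto simp: x_def)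
  have yn: "y \<notin> range fls_const" using DP_quot_nonconst[OF g \<alpha> small(2)] by (simp add: y_def)
  note rel' = rel[folded x_def y_def]
  define e where "e = (if p \<noteq> 0 \<and> s \<noteq> 0 then - p / s else - q / t)"
  have e0: "e \<noteq> 0" using ne by (auto simp: e_def)
  have ze: "min 1 (zero_div (y - fls_const e) c) \<le> min 1 (zero_div x c) + min 1 (pole_div x c)" for c
  proof (cases "p \<noteq> 0 \<and> s \<noteq> 0")
    case True
    then have "p + s * e = 0" "s \<noteq> 0" by (simp_all add: e_def)
    then have "min 1 (zero_div (y - fls_const e) c) \<le> min 1 (zero_div x c)"
      by (intro zeros_moebius(1)[OF M yn x0 rel' det])
    then show ?thesis using pole_div_nonneg[of x c] by linarith
  next
    case False
    then have "q + t * e = 0" "t \<noteq> 0" using ne unfolding e_def by (simp_all only: if_False) auto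
    then have "min 1 (zero_div (y - fls_const e) c) \<le> min 1 (pole_div x c)"
      by (intro zeros_moebius(2)[OF M yn x0 rel' det])
    then show ?thesis using zero_div_nonneg[of x c] by linarith
  qed
  have nu: "fls_const p + fls_const s * y \<noteq> 0"
  proof
    assume *: "fls_const p + fls_const s * y = 0"
    then have "fls_const s * y = fls_const (- p)" by (simp add: eq_neg_iff_add_eq_0 add.commute)
    then have "s = 0" using fls_const_mult_eq_const[of s y "- p"] yn by blast
    then show False using * det by (auto simp: fls_const_nonzero)
  qed
  have nw: "fls_const q + fls_const t * y \<noteq> 0"
  proof
    assume *: "fls_const q + fls_const t * y = 0"
    then have "fls_const t * y = fls_const (- q)" by (simp add: eq_neg_iff_add_eq_0 add.commute)
    then have "t = 0" using fls_const_mult_eq_const[of t y "- q"] yn by blast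
    then show False using * det by (auto simp: fls_const_nonzero)
  qed
  have xq: "x = - ((fls_const p + fls_const s * y) / (fls_const q + fls_const t * y))"
  proof -
    have "x * (fls_const q + fls_const t * y) + (fls_const p + fls_const s * y) = 0"
      using rel' by (simp add: algebra_simps)
    then have "x * (fls_const q + fls_const t * y) = - (fls_const p + fls_const s * y)"
      by (simp only: eq_neg_iff_add_eq_0)
    then have "x = - (fls_const p + fls_const s * y) / (fls_const q + fls_const t * y)"
      using nw by (metis nonzero_mult_div_cancel_right)
    then show ?thesis by (simp only: minus_divide_left)
  qed
  obtain d1 where d1: "\<And>r. r \<ge> 1 \<Longrightarrow> height r y \<le> counting r (\<lambda>c. min 1 (zero_div y c))
    + counting r (\<lambda>c. min 1 (pole_div y c)) + counting r (\<lambda>c. min 1 (zero_div (y - fls_const e) c)) + d1"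
    using truncated_smt_0_inf[OF M(2) yn e0] by blast
  obtain d2 where d2: "\<And>r. r \<ge> 1 \<Longrightarrow> counting r (\<lambda>c. min 1 (zero_div x c)) + counting r (\<lambda>c. min 1 (pole_div x c))
    \<le> counting r (zero_div (fls_deriv f)) + real (l + 1) * height r f + 4 * height r \<alpha> + d2"
    using counting_min_DP_quot[OF f \<alpha>] unfolding x_def by blast
  obtain d3 where d3: "\<And>r. r \<ge> 1 \<Longrightarrow> counting r (\<lambda>c. min 1 (zero_div y c)) + counting r (\<lambda>c. min 1 (pole_div y c))
    \<le> counting r (zero_div (fls_deriv g)) + real (l + 1) * height r g + 4 * height r \<alpha> + d3"
    using counting_min_DP_quot[OF g \<alpha>] unfolding y_def by blast
  obtain d4 where d4: "\<And>r. r \<ge> 1 \<Longrightarrow> real (n + l - 1) * height r f + counting r (zero_div (fls_deriv f))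
    \<le> height r x + height r \<alpha> + d4" using height_DP_quot_lower[OF f \<alpha>] unfolding x_def by blast
  obtain d5 where d5: "\<And>r. r \<ge> 1 \<Longrightarrow> real (n + l - 1) * height r g + counting r (zero_div (fls_deriv g))
    \<le> height r y + height r \<alpha> + d5" using height_DP_quot_lower[OF g \<alpha>] unfolding y_def by blast
  obtain d6 where d6: "\<And>r. r \<ge> 1 \<Longrightarrow> counting r (zero_div (fls_deriv f)) \<le> 2 * height r f + d6"
    using counting_zero_div_deriv[OF f] by blast
  obtain d7 where d7: "\<And>r. r \<ge> 1 \<Longrightarrow> height r y \<le> real (n + l + 1) * height r g + height r \<alpha> + d7"
    using height_DP_quot_upper[OF g \<alpha>] unfolding y_def by blast
  obtain d8 where d8: "\<And>r. r \<ge> 1 \<Longrightarrow> height r x \<le> height r y + d8"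
  proof -
    obtain C where C: "\<And>r. r \<ge> 1 \<Longrightarrow>
        height r ((fls_const p + fls_const s * y) / (fls_const q + fls_const t * y)) \<le> height r y + C"
      using height_linear_quot[OF M(2) yn nu nw] by blast
    have hx: "height r x = height r ((fls_const p + fls_const s * y) / (fls_const q + fls_const t * y))"
      if "r \<ge> 1" for r
    proof -
      have "pole_div x = pole_div ((fls_const p + fls_const s * y) / (fls_const q + fls_const t * y))"
        unfolding xq using M by (intro ext) (simp add: pole_div_def)
      then show ?thesis using M that by (simp add: height_def xq)
    qed
    show thesis by (rule that[of C]) (simp only: hx C)
  qed
  define K where "K = d1 + d2 + d3 + d5 + d6 + \<bar>d4 + d7 + d8\<bar>"
  have "height r g \<le> 12 * height r \<alpha> + K" if r: "r \<ge> 1" for r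
  proof -
    define Tf Tg Ta N where "Tf = height r f" and "Tg = height r g" and "Ta = height r \<alpha>"
      and "N = real (n + l - 1)"
    have T0: "0 \<le> Tf" "0 \<le> Tg" "0 \<le> Ta" using height_nonneg f g \<alpha> r by (auto simp: Tf_def Tg_def Ta_def)
    have N: "N = real n + real l - 1" "real (n + l + 1) = N + 2" using l by (auto simp: N_def of_nat_diff)
    have N1: "2 * (real l + 3) \<le> N" "0 < N"
    proof -
      have "real n \<ge> real l + 10" using of_nat_mono[OF n, where 'a = real] by simp
      then show "2 * (real l + 3) \<le> N" "0 < N" unfolding N by simp_all
    qed
    have zf: "0 \<le> counting r (zero_div (fls_deriv f))" using f r by (intro counting_nonneg) auto
    have "counting r (\<lambda>c. min 1 (zero_div (y - fls_const e) c))
        \<le> counting r (\<lambda>c. min 1 (zero_div x c) + min 1 (pole_div x c))"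
      using M ze by (intro counting_mono[OF r]) auto
    also have "\<dots> = counting r (\<lambda>c. min 1 (zero_div x c)) + counting r (\<lambda>c. min 1 (pole_div x c))"
      using M r by (intro counting_add) auto
    finally have E: "counting r (\<lambda>c. min 1 (zero_div (y - fls_const e) c))
        \<le> counting r (\<lambda>c. min 1 (zero_div x c)) + counting r (\<lambda>c. min 1 (pole_div x c))" .
    have split: "(real l + 1) * u = real l * u + u" "real (l + 1) * u = real l * u + u" for u
      by (simp_all add: algebra_simps)
    \<comment> \<open>The zeros of \<open>g'\<close> cancel against those kept in the lower bound
      for \<open>y\<close>, and the zeros of \<open>f'\<close> cost \<open>2 * Tf\<close>. The 9 is
      \<open>4 + 4\<close> from the truncated counts and 1 from the lower bound.\<close>
    have "N * Tg \<le> (real l + 1) * Tg + (real l + 1) * Tf + 2 * Tf + 9 * Ta + (d1 + d2 + d3 + d5 + d6)"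
      using E d1[OF r] d2[OF r] d3[OF r] d5[OF r] d6[OF r]
      unfolding Tf_def Tg_def Ta_def N_def split by linarith
    then have A: "(N - real l - 1) * Tg \<le> (real l + 3) * Tf + 9 * Ta + (d1 + d2 + d3 + d5 + d6)"
      by (simp add: algebra_simps)
    define D where "D = 2 * Ta + \<bar>d4 + d7 + d8\<bar>"
    have D0: "0 \<le> D" using T0 by (simp add: D_def)
    have B: "N * Tf \<le> (N + 2) * Tg + D"
      using d4[OF r] d7[OF r] d8[OF r] zf unfolding N(2) Tf_def Tg_def Ta_def N_def D_def by linarith
    \<comment> \<open>The factor that turns \<open>B\<close> into a bound for
      \<open>(l + 3) * Tf\<close>, the term to be eliminated from \<open>A\<close>. As it is at most
      \<open>1 / 2\<close>, the excess \<open>2 * Tg + D\<close> enters only by half.\<close>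
    define \<theta> where "\<theta> = (real l + 3) / N"
    have \<theta>: "0 \<le> \<theta>" "\<theta> \<le> 1 / 2" "\<theta> * N = real l + 3" using N1 by (auto simp: \<theta>_def field_simps)
    have "\<theta> * (N * Tf) \<le> \<theta> * ((N + 2) * Tg + D)" using B \<theta> by (intro mult_left_mono)
    also have "\<dots> = (\<theta> * N) * Tg + \<theta> * (2 * Tg + D)" by (simp add: algebra_simps)
    also have "\<dots> \<le> (\<theta> * N) * Tg + 1 / 2 * (2 * Tg + D)"
      using \<theta> T0 D0 by (intro add_left_mono mult_right_mono) auto
    also have "\<theta> * (N * Tf) = (\<theta> * N) * Tf" by simp
    finally have "(real l + 3) * Tf \<le> (real l + 3) * Tg + 1 / 2 * (2 * Tg + D)" unfolding \<theta>(3) .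
    moreover have "(real l + 5) * Tg \<le> (N - real l - 1) * Tg"
      using n T0 unfolding N by (intro mult_right_mono) auto
    moreover have "(real l + 5) * Tg = (real l + 3) * Tg + 2 * Tg" by (simp add: algebra_simps)
    ultimately have "Tg \<le> D + 9 * Ta + (d1 + d2 + d3 + d5 + d6)"
      using A D0 by (rule moebius_linear_arith)
    then show ?thesis using T0 unfolding K_def D_def Tg_def Ta_def by simp
  qed
  then show False using small_wrt_contradiction[OF g \<alpha> small(2), of 12 K] by simp
qed

section \<open>The case in which \<open>x y = 1\<close>\<close>

lemma zero_orders:
  assumes f: "f \<in> \<M>" "f \<notin> range fls_const"
    and i: "i \<in> {1..l}" and z: "ord c (f - fls_const (a i)) > 0"
  shows "ord c (DP f) = int (\<mu> i + 1) * zero_div (f - fls_const (a i)) c - 1"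
proof -
  let ?m = "ord c (f - fls_const (a i))"
  have other: "zero_div (f - fls_const (a j)) c = 0" if "j \<in> {1..l}" "j \<noteq> i" for j
  proof -
    have "a i \<noteq> a j" using inj_onD[OF inj _ i that(1)] that(2) by blast
    then show ?thesis using ord_diff_const_eq_0[OF f(1) z, of "a j"] by (simp add: zero_div_def)
  qed
  have reg: "ord c f \<ge> 0"
    using ord_diff_const_pole[OF f(1), of c "a i"] z by (cases "ord c f < 0") auto
  \<comment> \<open>An \<open>m\<close>-fold zero of \<open>f - a i\<close> contributes
    \<open>\<mu> i * m\<close> through its own factor and \<open>m - 1\<close> through
    \<open>f'\<close>; the other factors are units there.\<close>
  have "fls_deriv (f - fls_const (a i)) = fls_deriv f" by simp
  then have d: "ord c (fls_deriv f) = ?m - 1" using ord_deriv(1)[of "f - fls_const (a i)" c] f z by simp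
  have zi: "zero_div (f - fls_const (a i)) c = ?m" using z by (simp add: zero_div_def)
  show ?thesis
  proof (cases "i = 1")
    case True
    have "(\<Sum>j\<in>{2..l}. zero_div (f - fls_const (a j)) c) = 0"
      using other True by (intro sum.neutral) auto
    then show ?thesis
      using ord_DP_regular[OF f reg] zi d unfolding True by (simp add: \<mu>_def algebra_simps)
  next
    case False
    have "(\<Sum>j\<in>{2..l}. zero_div (f - fls_const (a j)) c) = (\<Sum>j\<in>{2..l}. if j = i then ?m else 0)"
      using other zi by (intro sum.cong) auto
    also have "\<dots> = ?m" using i False by simp
    finally have s: "(\<Sum>j\<in>{2..l}. zero_div (f - fls_const (a j)) c) = ?m" .
    have "zero_div (f - fls_const (a 1)) c = 0" using other[of 1] False l by simp
    then show ?thesis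
      using ord_DP_regular[OF f reg] s d zi False by (simp add: \<mu>_def)
  qed
qed

text \<open>A zero of \<open>f - a i\<close> off the divisor of \<open>\<alpha>\<close> is a pole of \<open>g\<close>, which forces a high multiplicity.\<close>

lemma product_case:
  assumes f: "f \<in> \<M>" "f \<notin> range fls_const"
    and g: "g \<in> \<M>" "g \<notin> range fls_const"
    and \<alpha>: "\<alpha> \<in> \<M>" "\<alpha> \<noteq> 0" and small: "small_wrt v \<alpha> f"
    and eq: "DP f * DP g = \<alpha> * \<alpha>"
  shows False
proof -
  have mult: "(\<mu> i \<noteq> 1 \<longrightarrow> 2 \<le> zero_div (f - fls_const (a i)) c) \<and> (\<mu> i = 1 \<longrightarrow> 5 \<le> zero_div (f - fls_const (a i)) c)"
    if i: "i \<in> {1..l}" and z: "ord c (f - fls_const (a i)) > 0" and \<alpha>0: "ord c \<alpha> = 0" for i c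
  proof -
    define m where "m = zero_div (f - fls_const (a i)) c"
    have m1: "m \<ge> 1" using z by (simp add: m_def zero_div_def)
    have oF: "ord c (DP f) = int (\<mu> i + 1) * m - 1" unfolding m_def by (rule zero_orders[OF f i z])
    have "int (\<mu> i + 1) * m \<ge> 2 * 1"
      using m1 n by (intro mult_mono) (auto simp: \<mu>_def)
    then have pos: "ord c (DP f) > 0" using oF by simp
    have "ord c (DP f) + ord c (DP g) = 0"
      using arg_cong[OF eq, of "ord c"] DP_meromorphic[OF f] DP_nonzero[OF f] DP_meromorphic[OF g]
        DP_nonzero[OF g] \<alpha> \<alpha>0 by (simp add: ord_mult)
    then have oG: "ord c (DP g) < 0" "ord c (DP g) = - ord c (DP f)" using pos by auto
    have gp: "ord c g < 0" using oG(1) by (rule ord_DP_neg_iff[OF g, THEN iffD1])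
    \<comment> \<open>\<open>DP g\<close> has a pole of order at least \<open>n + l + 1\<close> at
      \<open>c\<close>, and this order equals that of the zero of \<open>DP f\<close>, namely
      \<open>(\<mu> i + 1) * m - 1\<close>.\<close>
    have "int (n + l) * ord c g \<le> int (n + l) * (- 1)" using gp by (intro mult_left_mono) auto
    then have "int (\<mu> i + 1) * m \<ge> int (n + l) + 2"
      using ord_DP_pole[OF g gp] oG oF by simp
    then have *: "int (\<mu> i + 1) * m \<ge> int (n + l) + 2" .
    show ?thesis
    proof (cases "i = 1")
      case True
      have "m \<noteq> 1"
      proof
        assume "m = 1"
        then show False using * True l by (simp add: \<mu>_def)
      qed
      then show ?thesis using m1 n True unfolding m_def[symmetric] by (simp add: \<mu>_def)
    next
      case False
      then have "2 * m \<ge> int (n + l) + 2" using * by (simp add: \<mu>_def)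
      then show ?thesis using False n l unfolding m_def[symmetric] by (simp add: \<mu>_def)
    qed
  qed
  have \<mu>1: "\<mu> 1 \<noteq> 1" "\<mu> 2 = 1" "\<mu> 3 = 1" using n by (auto simp: \<mu>_def)
  have b1: "2 * min 1 (zero_div (f - fls_const (a 1)) c) \<le> zero_div (f - fls_const (a 1)) c + 2 * \<bar>ord c \<alpha>\<bar>" for c
    using mult[of 1 c] l \<mu>1 by (cases "ord c \<alpha> = 0"; cases "ord c (f - fls_const (a 1)) > 0") (auto simp: zero_div_def)
  have b2: "5 * min 1 (zero_div (f - fls_const (a i)) c) \<le> zero_div (f - fls_const (a i)) c + 5 * \<bar>ord c \<alpha>\<bar>"
    if "i = 2 \<or> i = 3" for i c
    using mult[of i c] l \<mu>1 that by (cases "ord c \<alpha> = 0"; cases "ord c (f - fls_const (a i)) > 0") (auto simp: zero_div_def)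
  have lf: "locally_finite (\<lambda>c. \<bar>ord c \<alpha>\<bar>)" by (rule locally_finite_abs_ord[OF \<alpha>(1)])
  have B: "of_int k * counting r (\<lambda>c. min 1 (zero_div (f - fls_const z) c))
      \<le> counting r (zero_div (f - fls_const z)) + of_int k * counting r (\<lambda>c. \<bar>ord c \<alpha>\<bar>)"
    if "r \<ge> 1" "\<And>c. k * min 1 (zero_div (f - fls_const z) c) \<le> zero_div (f - fls_const z) c + k * \<bar>ord c \<alpha>\<bar>"
    for k :: int and r z
  proof -
    have "counting r (\<lambda>c. k * min 1 (zero_div (f - fls_const z) c))
        \<le> counting r (\<lambda>c. zero_div (f - fls_const z) c + k * \<bar>ord c \<alpha>\<bar>)"
      using that f lf by (intro counting_mono) auto
    then show ?thesis using that(1) f lf by (simp add: counting_cmult counting_add)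
  qed
  have "a i \<noteq> a j" if "i \<in> {1..l}" "j \<in> {1..l}" "i \<noteq> j" for i j
    using inj_onD[OF inj _ that(1,2)] that(3) by blast
  then have "a 1 \<noteq> a 2" "a 1 \<noteq> a 3" "a 2 \<noteq> a 3" using l by simp_all
  then obtain C where C: "\<And>r. r \<ge> 1 \<Longrightarrow> height r f \<le> counting r (\<lambda>c. min 1 (zero_div (f - fls_const (a 1)) c))
    + counting r (\<lambda>c. min 1 (zero_div (f - fls_const (a 2)) c))
    + counting r (\<lambda>c. min 1 (zero_div (f - fls_const (a 3)) c)) + C"
    using truncated_smt_finite[OF f] by blast
  obtain K where K: "\<And>i r. i \<in> {1..l} \<Longrightarrow> r \<ge> 1 \<Longrightarrow> counting r (zero_div (f - fls_const (a i))) \<le> height r f + K"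
    using factors_le[OF f] by blast
  \<comment> \<open>With multiplicities at least 2, 5, 5 at the three values,
    \<open>1/2 + 1/5 + 1/5 = 9/10 < 1\<close>. After multiplication by 10, the divisor of \<alpha>
    enters 30 times at two heights each.\<close>
  have "height r f \<le> 60 * height r \<alpha> + (9 * K + 10 * C + 30 * \<bar>lnorm 1 \<alpha>\<bar>)" if r: "r \<ge> 1" for r
    using C[OF r] K[of 1 r] K[of 2 r] K[of 3 r] r l counting_abs_ord[OF \<alpha> r]
      B[OF r b1] B[OF r b2[of 2]] B[OF r b2[of 3]]
    by simp
  then show False using small_wrt_contradiction[OF f \<alpha> small, of 60 "9 * K + 10 * C + 30 * \<bar>lnorm 1 \<alpha>\<bar>"] by simp
qed

lemma height_unbounded:
  assumes "h \<in> \<M>" "h \<notin> range fls_const" "\<And>r. r \<ge> 1 \<Longrightarrow> height r h \<le> C"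
  shows False
proof -
  have "\<forall>\<^sub>F r in at_top. C + 1 \<le> height r h"
    using height_at_top[OF assms(1,2)] by (simp add: filterlim_at_top)
  moreover have "\<forall>\<^sub>F r::real in at_top. r \<ge> 1" by (rule eventually_ge_at_top)
  ultimately have "\<forall>\<^sub>F r::real in at_top. False"
    by eventually_elim (use assms(3) in fastforce)
  then show False by simp
qed

end

section \<open>The case in which \<open>x = y\<close>\<close>

context uniqueness_setup
begin

text \<open>The difference has degree \<open>n + l\<close>, and since \<open>P'\<close> vanishes to
  order \<open>n\<close> at \<open>a 1\<close>, it is divisible by the power \<open>n + 1\<close> of
  \<open>X - a 1\<close>. The \<open>l - 1\<close> remaining roots are listed with repetition. The
  value at \<open>a 1\<close> is chosen because it leaves at most \<open>l\<close> distinct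
  roots.\<close>

lemma P_minus_value_factor:
  obtains k \<beta> where "k \<noteq> 0"
    "P - [:poly P (a 1):] = smult k (\<Prod>i<l. [:- \<beta> i, 1:] ^ (if i = 0 then n + 1 else 1))"
proof -
  define Q where "Q = P - [:poly P (a 1):]"
  let ?x = "[:- a 1, 1:]"
  have dQ: "pderiv Q = pderiv P" by (simp add: Q_def pderiv_diff pderiv_pCons)
  have nz: "pderiv P \<noteq> 0" using b by (simp add: pderiv_P)
  have Q0: "Q \<noteq> 0" using dQ nz by auto
  have root: "poly Q (a 1) = 0" by (simp add: Q_def)
  have "degree (pderiv P) = n + (l - 1)"
    using b by (simp add: pderiv_P degree_mult_eq degree_power_eq degree_prod_eq_sum_degree)
  then have degQ: "degree Q = n + l" using dQ degree_pderiv[of Q] l by simp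
  have "?x ^ n dvd pderiv Q" unfolding dQ pderiv_P by (intro dvd_smult dvd_triv_left)
  then have "n \<le> order (a 1) (pderiv Q)" using nz dQ by (simp add: order_divides)
  then have "?x ^ (n + 1) dvd Q" using order_pderiv[OF Q0 root] Q0 by (simp add: order_divides del: power_Suc)
  then obtain R where R: "Q = ?x ^ (n + 1) * R" by (elim dvdE)
  have R0: "R \<noteq> 0" using Q0 R by auto
  have degR: "degree R = l - 1"
    using degQ R0 unfolding R by (simp add: degree_mult_eq degree_power_eq del: power_Suc)
  obtain Z where Z: "size Z = degree R" "R = smult (lead_coeff R) (\<Prod>z\<in>#Z. [:- z, 1:])"
    using alg_closed_imp_factorization[OF R0] by blast
  obtain zs where zs: "mset zs = Z" using ex_mset by blast
  have len: "length zs = l - 1" using Z zs degR by (metis size_mset)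
  have prodR: "R = smult (lead_coeff R) (\<Prod>i<l - 1. [:- zs ! i, 1:])"
  proof -
    have "(\<Prod>z\<in>#Z. [:- z, 1:]) = prod_list (map (\<lambda>z. [:- z, 1:]) zs)"
      by (simp only: prod_mset_prod_list[symmetric] mset_map zs)
    also have "\<dots> = (\<Prod>i = 0..<length (map (\<lambda>z. [:- z, 1:]) zs). map (\<lambda>z. [:- z, 1:]) zs ! i)"
      by (rule prod.list_conv_set_nth)
    also have "\<dots> = (\<Prod>i<l - 1. [:- zs ! i, 1:])"
      by (rule prod.cong) (auto simp: len)
    finally show ?thesis using Z(2) by simp
  qed
  define \<beta> where "\<beta> i = (case i of 0 \<Rightarrow> a 1 | Suc j \<Rightarrow> zs ! j)" for i
  have "(\<Prod>i<l. [:- \<beta> i, 1:] ^ (if i = 0 then n + 1 else 1)) =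
      (\<Prod>i<Suc (l - 1). [:- \<beta> i, 1:] ^ (if i = 0 then n + 1 else 1))" using l by simp
  also have "\<dots> = ?x ^ (n + 1) * (\<Prod>i<l - 1. [:- zs ! i, 1:])"
    unfolding prod.lessThan_Suc_shift by (simp add: \<beta>_def)
  finally have prod: "(\<Prod>i<l. [:- \<beta> i, 1:] ^ (if i = 0 then n + 1 else 1)) =
      ?x ^ (n + 1) * (\<Prod>i<l - 1. [:- zs ! i, 1:])" .
  define k where "k = lead_coeff R"
  have "Q = ?x ^ (n + 1) * smult k (\<Prod>i<l - 1. [:- zs ! i, 1:])"
    using R prodR[folded k_def] by metis
  also have "\<dots> = smult k (?x ^ (n + 1) * (\<Prod>i<l - 1. [:- zs ! i, 1:]))"
    by (rule mult_smult_right)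
  finally have "P - [:poly P (a 1):] = smult k (\<Prod>i<l. [:- \<beta> i, 1:] ^ (if i = 0 then n + 1 else 1))"
    unfolding prod Q_def .
  then show thesis by (rule that[rotated]) (use R0 in \<open>simp add: k_def\<close>)
qed

text \<open>\<open>U\<close> is a product of linear factors in \<open>f\<close>: its height is the
  full \<open>n + l\<close> times that of \<open>f\<close>, whereas its truncated zeros cost only
  \<open>l\<close> heights and its truncated poles one.\<close>

lemma P_minus_value_bounds:
  assumes f: "f \<in> \<M>" "f \<notin> range fls_const"
  defines "U \<equiv> poly_of_fun P f - fls_const (poly P (a 1))"
  shows "U \<in> \<M>" "U \<notin> range fls_const"
    and "\<exists>C. \<forall>r\<ge>1. real (n + l) * height r f \<le> height r U + C"
    and "\<exists>C. \<forall>r\<ge>1. counting r (\<lambda>c. min 1 (zero_div U c)) \<le> real l * height r f + C"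
    and "\<And>r. r \<ge> 1 \<Longrightarrow> counting r (\<lambda>c. min 1 (pole_div U c)) \<le> height r f"
proof -
  show M: "U \<in> \<M>" using f by (simp add: U_def)
  show "U \<notin> range fls_const"
  proof
    assume "U \<in> range fls_const"
    then have "fls_deriv U = 0" by auto
    then have "DP f = 0" by (simp add: U_def DP_def fls_deriv_poly_of_fun)
    then show False using DP_nonzero[OF f] by simp
  qed
  obtain k \<beta> where k: "k \<noteq> 0"
    and fac: "P - [:poly P (a 1):] = smult k (\<Prod>i<l. [:- \<beta> i, 1:] ^ (if i = 0 then n + 1 else 1))"
    by (rule P_minus_value_factor)
  define e :: "nat \<Rightarrow> nat" where "e i = (if i = 0 then n + 1 else 1)" for i
  interpret fp: fun_product v f "fls_const k" \<beta> e "{..<l}"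
    by unfold_locales (use f k in \<open>auto simp: fls_const_nonzero\<close>)
  have "poly_of_fun (P - [:poly P (a 1):] + [:poly P (a 1):]) f
      = poly_of_fun (P - [:poly P (a 1):]) f + poly_of_fun [:poly P (a 1):] f"
    by (rule poly_of_fun_add)
  then have "U = poly_of_fun (P - [:poly P (a 1):]) f" by (simp add: U_def)
  then have U: "U = fp.G"
    unfolding fac fp.G_def e_def
    by (simp add: poly_of_fun_smult poly_of_fun_prod poly_of_fun_power poly_of_fun_linear
        del: poly_of_fun_pCons power_Suc)
  have "(\<Sum>i<l. e i) = (\<Sum>i<Suc (l - 1). e i)" using l by simp
  also have "\<dots> = n + l" unfolding sum.lessThan_Suc_shift using l by (simp add: e_def)
  finally have sum_e: "(\<Sum>i<l. e i) = n + l" .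
  have w: "zero_div (fls_const k) = (\<lambda>c. 0)" "pole_div (fls_const k) = (\<lambda>c. 0)"
    by (auto simp: zero_div_def pole_div_def)
  show "\<exists>C. \<forall>r\<ge>1. real (n + l) * height r f \<le> height r U + C"
    using fp.height_G_lower[of "ln (v k)"] unfolding U sum_e w by (simp add: lnorm_const)
  show "counting r (\<lambda>c. min 1 (pole_div U c)) \<le> height r f" if r: "r \<ge> 1" for r
  proof -
    have "counting r (\<lambda>c. min 1 (pole_div U c)) \<le> counting r (pole_div f)"
    proof (rule counting_mono[OF r])
      show "min 1 (pole_div U c) \<le> pole_div f c" for c
      proof (cases "pole_div f c = 0")
        case True
        then show ?thesis using fp.pole_div_G[of c] unfolding U w by simp
      next
        case False
        then show ?thesis using pole_div_nonneg[of f c] by linarith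
      qed
    qed (use f M in simp_all)
    then show ?thesis using counting_pole_div_le[of r f] by linarith
  qed
  obtain C where C: "\<And>r. r \<ge> 1 \<Longrightarrow>
      (\<Sum>i<l. counting r (zero_div (f - fls_const (\<beta> i)))) \<le> real l * height r f + C"
    using fp.counting_factors_le by auto
  have "counting r (\<lambda>c. min 1 (zero_div U c)) \<le> real l * height r f + C" if r: "r \<ge> 1" for r
  proof -
    have "counting r (\<lambda>c. min 1 (zero_div U c)) \<le> counting r (\<lambda>c. \<Sum>i<l. zero_div (f - fls_const (\<beta> i)) c)"
    proof (rule counting_mono[OF r])
      show "min 1 (zero_div U c) \<le> (\<Sum>i<l. zero_div (f - fls_const (\<beta> i)) c)" for c
        using fp.min_zero_div_G[of c] unfolding U w by simp
    qed (use f M in simp_all)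
    also have "\<dots> = (\<Sum>i<l. counting r (zero_div (f - fls_const (\<beta> i))))"
      using f r by (intro counting_sum) auto
    finally show ?thesis using C[OF r] by simp
  qed
  then show "\<exists>C. \<forall>r\<ge>1. counting r (\<lambda>c. min 1 (zero_div U c)) \<le> real l * height r f + C" by blast
qed

text \<open>\<open>U\<close> and \<open>V\<close> differ by \<kappa>, so the zeros of
  \<open>V\<close> are the points where \<open>U\<close> takes the value \<kappa>. The second main
  theorem applies to \<open>U\<close> with the values 0, infinity and \<kappa>.\<close>

lemma shifted_value_bound:
  assumes f: "f \<in> \<M>" "f \<notin> range fls_const"
    and g: "g \<in> \<M>" "g \<notin> range fls_const"
    and eq: "poly_of_fun P f - poly_of_fun P g = fls_const \<kappa>" and \<kappa>: "\<kappa> \<noteq> 0"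
  shows "\<exists>C. \<forall>r\<ge>1. real (n + l) * height r f \<le> real (l + 1) * height r f + real l * height r g + C"
proof -
  define U V where "U = poly_of_fun P f - fls_const (poly P (a 1))"
    and "V = poly_of_fun P g - fls_const (poly P (a 1))"
  note U = P_minus_value_bounds[OF f, folded U_def] and V = P_minus_value_bounds[OF g, folded V_def]
  have UV: "U - fls_const \<kappa> = V" using eq by (simp add: U_def V_def algebra_simps)
  obtain c1 where c1: "\<And>r. r \<ge> 1 \<Longrightarrow> height r U \<le> counting r (\<lambda>c. min 1 (zero_div U c))
    + counting r (\<lambda>c. min 1 (pole_div U c)) + counting r (\<lambda>c. min 1 (zero_div V c)) + c1"
    using truncated_smt_0_inf[OF U(1,2) \<kappa>] unfolding UV by blast
  obtain c2 where c2: "\<And>r. r \<ge> 1 \<Longrightarrow> real (n + l) * height r f \<le> height r U + c2" using U(3) by blast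
  obtain c3 where c3: "\<And>r. r \<ge> 1 \<Longrightarrow> counting r (\<lambda>c. min 1 (zero_div U c)) \<le> real l * height r f + c3"
    using U(4) by blast
  obtain c4 where c4: "\<And>r. r \<ge> 1 \<Longrightarrow> counting r (\<lambda>c. min 1 (zero_div V c)) \<le> real l * height r g + c4"
    using V(4) by blast
  have split: "real (l + 1) * t = real l * t + t" for t by (simp add: algebra_simps)
  have "real (n + l) * height r f \<le> real (l + 1) * height r f + real l * height r g + (c1 + c2 + c3 + c4)"
    if r: "r \<ge> 1" for r
    using c1[OF r] c2[OF r] c3[OF r] c4[OF r] U(5)[OF r] unfolding split by linarith
  then show ?thesis by blast
qed

text \<open>Equal derivatives make \<open>P(f) - P(g)\<close> a constant. If it were nonzero, the
  bounds for both orders of \<open>f\<close> and \<open>g\<close> would add up to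
  \<open>(n + l) T <= (2 l + 1) T\<close> plus a constant, \<open>T\<close> being the sum of the
  heights, and \<open>T\<close> would be bounded.\<close>

lemma equal_case:
  assumes f: "f \<in> \<M>" "f \<notin> range fls_const"
    and g: "g \<in> \<M>" "g \<notin> range fls_const"
    and eq: "DP f = DP g" and uniq: "polynomial_of_uniqueness P (nonconstant_meromorphic v)"
  shows "f = g"
proof -
  have "fls_deriv (poly_of_fun P f - poly_of_fun P g) = 0"
    using eq by (simp add: DP_def fls_deriv_poly_of_fun)
  then obtain \<kappa> where \<kappa>: "poly_of_fun P f - poly_of_fun P g = fls_const \<kappa>"
    by (metis fls_deriv_eq_0_iff)
  have "\<kappa> = 0"
  proof (rule ccontr)
    assume "\<kappa> \<noteq> 0"
    moreover have "poly_of_fun P g - poly_of_fun P f = fls_const (- \<kappa>)"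
      using \<kappa> by (metis fls_const_uminus minus_diff_eq)
    ultimately obtain c c' where c: "\<And>r. r \<ge> 1 \<Longrightarrow> real (n + l) * height r f
        \<le> real (l + 1) * height r f + real l * height r g + c"
      "\<And>r. r \<ge> 1 \<Longrightarrow> real (n + l) * height r g \<le> real (l + 1) * height r g + real l * height r f + c'"
      using shifted_value_bound[OF f g \<kappa>] shifted_value_bound[OF g f, of "- \<kappa>"] by auto
    have "height r f \<le> c + c'" if r: "r \<ge> 1" for r
    proof -
      have T0: "0 \<le> height r f" "0 \<le> height r g" using height_nonneg f g r by auto
      have N: "real (2 * l + 2) * t \<le> real (n + l) * t" if "0 \<le> t" for t
        using that n by (intro mult_right_mono) auto
      have split: "real (2 * l + 2) * t = 2 * (real l * t) + 2 * t" "real (l + 1) * t = real l * t + t" for t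
        by (simp_all add: algebra_simps)
      show ?thesis
        using c(1)[OF r] c(2)[OF r] N[OF T0(1)] N[OF T0(2)] T0 unfolding split by linarith
    qed
    then show False by (rule height_unbounded[OF f])
  qed
  then have "poly_of_fun P f = poly_of_fun P g" using \<kappa> by simp
  then show ?thesis
    using uniq f g unfolding polynomial_of_uniqueness_def nonconstant_meromorphic_def by blast
qed

text \<open>Multiplying the linear relation between \<open>x\<close>, \<open>h\<close> and 1 by
  \<open>y - 1\<close> eliminates \<open>h\<close>, because \<open>h (y - 1) = x - 1\<close>. What
  remains is bilinear in \<open>x\<close> and \<open>y\<close>.\<close>

lemma DP_share_eq:
  assumes f: "f \<in> \<M>" "f \<notin> range fls_const"
    and g: "g \<in> \<M>" "g \<notin> range fls_const"
    and \<alpha>: "\<alpha> \<in> \<M>" "\<alpha> \<noteq> 0" and small: "small_wrt v \<alpha> f" "small_wrt v \<alpha> g"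
    and share: "share_CM v \<alpha> (DP f) (DP g)"
  shows "DP f = DP g"
proof -
  define x y where "x = DP f / \<alpha>" and "y = DP g / \<alpha>"
  have xn: "x \<notin> range fls_const" and yn: "y \<notin> range fls_const"
    using DP_quot_nonconst[OF f \<alpha> small(1)] DP_quot_nonconst[OF g \<alpha> small(2)] by (auto simp: x_def y_def)
  have "x \<noteq> fls_const 1" "y \<noteq> fls_const 1" using xn yn by blast+
  then have x1: "x - 1 \<noteq> 0" and y1: "y - 1 \<noteq> 0" by auto
  then have nz: "DP f \<noteq> \<alpha>" "DP g \<noteq> \<alpha>" using \<alpha> by (auto simp: x_def y_def)
  define h where "h = (DP f - \<alpha>) / (DP g - \<alpha>)"
  have "wronskian3 x h (- 1) = 0"
    unfolding x_def h_def by (rule cartan_case[OF f g \<alpha> small(1) share nz])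
  then obtain c1 c2 c3 where rel: "fls_const c1 * x + fls_const c2 * h + fls_const c3 = 0"
    and c12: "c1 \<noteq> 0 \<or> c2 \<noteq> 0" by (rule wronskian3_const_eq_0)
  have hxy: "h * (y - 1) = x - 1"
    using \<alpha> nz by (simp add: h_def x_def y_def divide_simps)
  have "(fls_const c1 * x + fls_const c3) * (y - 1) + fls_const c2 * (h * (y - 1)) = 0"
  proof -
    have "(fls_const c1 * x + fls_const c3) * (y - 1) + fls_const c2 * (h * (y - 1))
        = (fls_const c1 * x + fls_const c2 * h + fls_const c3) * (y - 1)" by (simp add: algebra_simps)
    then show ?thesis using rel by simp
  qed
  then have rel2: "(fls_const c1 * x + fls_const c3) * (y - 1) + fls_const c2 * (x - 1) = 0"
    unfolding hxy .
  \<comment> \<open>The coefficients of \<open>rel2\<close> after expansion. They sum to 0, since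
    \<open>rel2\<close> is formally satisfied by \<open>x = y = 1\<close>.\<close>
  define p q s t where "p = - (c2 + c3)" and "q = c2 - c1" and "s = c3" and "t = c1"
  have rel3: "fls_const p + fls_const q * x + fls_const s * y + fls_const t * (x * y) = 0"
    using rel2 unfolding p_def q_def s_def t_def
    by (simp add: algebra_simps flip: fls_plus_const fls_minus_const)
  have c2: "c2 \<noteq> 0"
  proof
    assume "c2 = 0"
    then have "fls_const c1 * x = fls_const (- c3)" using rel by (simp add: eq_neg_iff_add_eq_0)
    then show False using fls_const_mult_eq_const[of c1 x "- c3"] c12 \<open>c2 = 0\<close> xn by blast
  qed
  have c13: "c1 + c3 \<noteq> 0"
  proof
    assume "c1 + c3 = 0"
    then have c3: "c3 = - c1" by (simp add: eq_neg_iff_add_eq_0 add.commute)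
    have "(x - 1) * (fls_const c1 * (y - 1) + fls_const c2) = 0"
      using rel2 unfolding c3 by (simp add: algebra_simps)
    then have "fls_const c1 * (y - 1) + fls_const c2 = 0" using x1 by simp
    then have "fls_const c1 * y = fls_const (c1 - c2)"
      by (simp add: algebra_simps flip: fls_minus_const)
    then have "c1 = 0" using fls_const_mult_eq_const yn by blast
    then show False using c2 \<open>fls_const c1 * (y - 1) + fls_const c2 = 0\<close> by (simp add: fls_const_nonzero)
  qed
  \<comment> \<open>Degeneracy would let the bilinear relation split into a factor in
    \<open>x\<close> and a factor in \<open>y\<close>; this is incompatible with both being
    nonconstant.\<close>
  have "p * t - q * s = - (c2 * (c1 + c3))" by (simp add: p_def q_def s_def t_def algebra_simps)
  then have det: "p * t \<noteq> q * s" using c2 c13 by auto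
  have rel4: "fls_const p + fls_const s * y + fls_const q * x + fls_const t * (y * x) = 0"
    using rel3 by (simp add: algebra_simps)
  \<comment> \<open>In terms of the Moebius transformation between \<open>x\<close> and
    \<open>y\<close>: it permutes 0 and infinity, and by \<open>pqst\<close> it fixes 1, so it is
    the identity or the inversion.\<close>
  have n1: "\<not> (p \<noteq> 0 \<and> s \<noteq> 0 \<or> t \<noteq> 0 \<and> q \<noteq> 0)"
    using moebius_case[OF f g \<alpha> small rel3[unfolded x_def y_def] det] by blast
  have n2: "\<not> (p \<noteq> 0 \<and> q \<noteq> 0 \<or> t \<noteq> 0 \<and> s \<noteq> 0)"
    using moebius_case[OF g f \<alpha> small(2,1) rel4[unfolded x_def y_def]] det by (metis mult.commute)
  have pqst: "p + q + s + t = 0" by (simp add: p_def q_def s_def t_def)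
  show ?thesis
  proof (cases "p = 0")
    case True
    then have "q \<noteq> 0" "s \<noteq> 0" using det by auto
    then have "t = 0" "s = - q" using n1 pqst True by (auto simp: eq_neg_iff_add_eq_0 add.commute)
    then have "fls_const q * (x - y) = 0" using rel3 True by (simp add: algebra_simps)
    then have "x = y" using \<open>q \<noteq> 0\<close> by (simp add: fls_const_nonzero)
    then show ?thesis using \<alpha> by (simp add: x_def y_def)
  next
    case False
    then have "s = 0" "q = 0" using n1 n2 by auto
    then have "t = - p" using pqst by (simp add: eq_neg_iff_add_eq_0 add.commute)
    then have "fls_const p * (1 - x * y) = 0"
      using rel3 \<open>s = 0\<close> \<open>q = 0\<close> by (simp add: algebra_simps)
    then have "x * y = 1" using False by (simp add: fls_const_nonzero)
    then have "DP f * DP g = \<alpha> * \<alpha>" using \<alpha> by (simp add: x_def y_def field_simps)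
    then show ?thesis using product_case[OF f g \<alpha> small(1)] by blast
  qed
qed

end

lemma transcendental_nonconst: "transcendental f \<Longrightarrow> f \<notin> range fls_const"
proof
  assume "transcendental f" "f \<in> range fls_const"
  then obtain c where "f = fls_const c" by auto
  moreover have "fps_to_fls (fps_of_poly [:c:]) = fls_const c" by (intro fls_eqI) (auto simp: fps_of_poly_const)
  ultimately have "f = fps_to_fls (fps_of_poly [:c:]) / fps_to_fls (fps_of_poly 1)" by simp
  then have "rational_function f" unfolding rational_function_def by (metis one_neq_zero)
  then show False using \<open>transcendental f\<close> by (simp add: transcendental_def)
qed

theorem theorem5:
  fixes v :: "'a::{alg_closed_field, field_char_0} \<Rightarrow> real"
    and P :: "'a poly" and b :: 'a and a :: "nat \<Rightarrow> 'a" and n l :: nat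
    and f g \<alpha> :: "'a fls"
  assumes "complete_ultrametric_absolute_value v"
    and "polynomial_of_uniqueness P (nonconstant_meromorphic v)"
    and "pderiv P = smult b ([:- a 1, 1:] ^ n * (\<Prod>i=2..l. [:- a i, 1:]))"
    and "b \<noteq> 0" and "l \<ge> 3" and "inj_on a {1..l}"
    and "n > 0" and "n \<ge> l + 10" and "l = 3 \<longrightarrow> n \<noteq> 2 * l - 1"
    and "f \<in> meromorphic v" and "transcendental f"
    and "g \<in> meromorphic v" and "transcendental g"
    and "\<alpha> \<in> meromorphic v" and "\<alpha> \<noteq> 0"
    and "small_wrt v \<alpha> f" and "small_wrt v \<alpha> g"
    and "share_CM v \<alpha> (fls_deriv f * poly_of_fun (pderiv P) f)
                      (fls_deriv g * poly_of_fun (pderiv P) g)"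
  shows "f = g"
proof -
  interpret uniqueness_setup v P b a n l
    by (intro uniqueness_setup.intro padic_field.intro uniqueness_setup_axioms.intro assms)
  have f: "f \<in> meromorphic v" "f \<notin> range fls_const" and g: "g \<in> meromorphic v" "g \<notin> range fls_const"
    using assms transcendental_nonconst by auto
  have "share_CM v \<alpha> (DP f) (DP g)" unfolding DP_def by (rule assms(18))
  then have "DP f = DP g" by (rule DP_share_eq[OF f g assms(14-17)])
  then show "f = g" by (rule equal_case[OF f g _ assms(2)])
qed

end
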